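(* Let $I,I'\subset\mathbb{R}$ be bounded intervals, let $r\ge0$, and let $\{x_i^{(m)}\}_{i=0}^m\subset I'$ ($m\ge1$) be any quasi-Chebyshev set. Then for every integer $m\ge1$ and every $f\in H^r(I)$ there exists $a=(a_0,\dots,a_m)\in\mathbb{R}^{m+1}$ such that, for every $0\le s\le r$, $$\Big\|f-\sum_{i=0}^m a_i\tanh\big(x-x_i^{(m)}\big)\Big\|_{H^s(I)}\le K\,m^{-(r-s)}\|f\|_{H^r(I)},$$ where the constant $K>0$ is independent of $m$ and $f$.
   Context: Intervals are nondegenerate; $H^s$ is the $L^2$-based Sobolev space of real order $s\ge0$ (the norm is taken in the variable $x$). Quasi-uniform and quasi-Chebyshev sets are understood as families indexed by $m$. A family $\{\theta_j^{(m)}\}_{j}\subset[a,b]$ is quasi-uniform if there is a constant $c$ independent of $m$ with $\max_{\theta\in[a,b]}\min_j|\theta-\theta_j^{(m)}|\le c\min_{i\ne j}|\theta_i^{(m)}-\theta_j^{(m)}|$ for all $m$. A family $\{x_j^{(m)}\}_j$ in a bounded interval with endpoints $a<b$ is quasi-Chebyshev if there is a quasi-uniform family $\{\theta_j^{(m)}\}_j$ (same index set) on $[0,\pi]$ with $x_j^{(m)}=\frac{a+b}{2}+\frac{b-a}{2}\cos\theta_j^{(m)}$. *)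

theory Defs
  imports "HOL-Analysis.Analysis"
begin

definition bounded_interval :: "real set \<Rightarrow> bool" where
  "bounded_interval I \<longleftrightarrow> is_interval I \<and> bounded I \<and> (\<exists>a\<in>I. \<exists>b\<in>I. a < b)"

definition square_integrable :: "(real \<Rightarrow> 'a::{real_normed_vector, second_countable_topology}) \<Rightarrow> bool" where
  "square_integrable F \<longleftrightarrow> F \<in> borel_measurable lborel \<and> integrable lborel (\<lambda>x. (norm (F x))\<^sup>2)"

definition truncated_fourier :: "(real \<Rightarrow> real) \<Rightarrow> nat \<Rightarrow> real \<Rightarrow> complex" where
  "truncated_fourier F n \<xi> =
     complex_of_real (1 / sqrt (2 * pi)) *
       set_lebesgue_integral lborel {- real n..real n} (\<lambda>x. complex_of_real (F x) * cis (- (x * \<xi>)))"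

(* The Fourier-Plancherel transform (unitary normalization), as the limit in the mean of
   the transforms of the truncations of F.  It is determined up to null sets. *)
definition is_fourier_transform :: "(real \<Rightarrow> real) \<Rightarrow> (real \<Rightarrow> complex) \<Rightarrow> bool" where
  "is_fourier_transform F g \<longleftrightarrow>
     square_integrable F \<and> square_integrable g \<and>
     (\<lambda>n. \<integral>\<^sup>+ \<xi>. ennreal ((cmod (g \<xi> - truncated_fourier F n \<xi>))\<^sup>2) \<partial>lborel) \<longlonglongrightarrow> 0"

definition fourier_transform :: "(real \<Rightarrow> real) \<Rightarrow> real \<Rightarrow> complex" where
  "fourier_transform F = (SOME g. is_fourier_transform F g)"

definition sobolev_space_line :: "real \<Rightarrow> (real \<Rightarrow> real) set" where
  "sobolev_space_line s =
     {F. is_fourier_transform F (fourier_transform F) \<and>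
         integrable lborel (\<lambda>\<xi>. (1 + \<xi>\<^sup>2) powr s * (cmod (fourier_transform F \<xi>))\<^sup>2)}"

definition sobolev_norm_line :: "real \<Rightarrow> (real \<Rightarrow> real) \<Rightarrow> real" where
  "sobolev_norm_line s F =
     sqrt (\<integral>\<xi>. (1 + \<xi>\<^sup>2) powr s * (cmod (fourier_transform F \<xi>))\<^sup>2 \<partial>lborel)"

(* H^s(I) consists of the restrictions to I of elements of H^s on the line, with the quotient norm.
   Functions are total; their values outside I and on null sets are irrelevant. *)
definition sobolev_extensions :: "real \<Rightarrow> real set \<Rightarrow> (real \<Rightarrow> real) \<Rightarrow> (real \<Rightarrow> real) set" where
  "sobolev_extensions s I f =
     {F \<in> sobolev_space_line s. AE x in lborel. x \<in> I \<longrightarrow> F x = f x}"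

definition sobolev_space :: "real \<Rightarrow> real set \<Rightarrow> (real \<Rightarrow> real) set" where
  "sobolev_space s I = {f. sobolev_extensions s I f \<noteq> {}}"

(* Meaningful only for f in sobolev_space s I: otherwise this is the infimum of the empty set. *)
definition sobolev_norm :: "real \<Rightarrow> real set \<Rightarrow> (real \<Rightarrow> real) \<Rightarrow> real" where
  "sobolev_norm s I f = (INF F \<in> sobolev_extensions s I f. sobolev_norm_line s F)"

(* A family of point sets indexed by m >= 1; the m-th set consists of the points
   \<theta> m 0, ..., \<theta> m m.  The supremum over {a..b} is a maximum. *)
definition quasi_uniform :: "real \<Rightarrow> real \<Rightarrow> (nat \<Rightarrow> nat \<Rightarrow> real) \<Rightarrow> bool" where
  "quasi_uniform a b \<theta> \<longleftrightarrow>
     (\<forall>m\<ge>1. \<forall>j\<le>m. \<theta> m j \<in> {a..b}) \<and>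
     (\<exists>c. \<forall>m\<ge>1.
        (SUP t\<in>{a..b}. Min ((\<lambda>j. \<bar>t - \<theta> m j\<bar>) ` {..m}))
          \<le> c * Min {\<bar>\<theta> m i - \<theta> m j\<bar> | i j. i \<le> m \<and> j \<le> m \<and> i \<noteq> j})"

definition quasi_Chebyshev :: "real set \<Rightarrow> (nat \<Rightarrow> nat \<Rightarrow> real) \<Rightarrow> bool" where
  "quasi_Chebyshev J x \<longleftrightarrow>
     (\<forall>m\<ge>1. \<forall>j\<le>m. x m j \<in> J) \<and>
     (\<exists>\<theta>. quasi_uniform 0 pi \<theta> \<and>
        (\<forall>m\<ge>1. \<forall>j\<le>m.
           x m j = (Inf J + Sup J) / 2 + (Sup J - Inf J) / 2 * cos (\<theta> m j)))"

end

theory Submission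
  imports Defs "HOL-Probability.Probability" "HOL-Complex_Analysis.Complex_Analysis"
begin

text \<open>
  The approximant is built in two steps, and the step size couples them.

  \<^emph>\<open>Smoothing.\<close>  An extension \<open>F\<close> of \<open>f\<close> to the line is replaced by a band-limited function
  \<open>H\<close>, its convolution with a kernel of Jackson type at scale \<open>1 / N\<close>.  On the Fourier side this
  multiplies the transform by a bounded \<open>\<mu>\<close> with \<open>|1 - \<mu> \<xi>| \<le> C (|\<xi>| / N)^k\<close>, so that the
  \<open>H^s\<close> norm of \<open>F - H\<close> is at most a constant times \<open>N^{-(r-s)}\<close> times the \<open>H^r\<close> norm of \<open>F\<close>, for
  all \<open>s\<close> in \<open>[0, r]\<close> at once (\<open>band_limited_smoothing\<close>).  The smoothed \<open>H\<close> is the restriction of an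
  entire function of exponential type \<open>R N\<close>, bounded by \<open>C N^{1/2} exp (R N |Im z|)\<close> times the
  \<open>L^2\<close> norm of the transform of \<open>F\<close>.

  \<^emph>\<open>Approximating an analytic function.\<close>  Put \<open>u = e^{2x}\<close> and \<open>v_j = e^{2 y_j}\<close>.  Then
  \<open>tanh (x - y_j) = (u - v_j) / (u + v_j)\<close> is a Blaschke factor of the right half-plane, and a combination
  of \<open>tanh (x - y_j)\<close> is a rational function of \<open>u\<close> with simple poles at the points \<open>- v_j\<close> and opposite
  values at \<open>0\<close> and \<open>\<infinity>\<close>.  Interpolating at the points \<open>v_j\<close> with these very poles leaves, by
  Cauchy's formula over a circle in the half-plane, an error controlled by
  \<open>\<Prod> tanh (x - y_j)\<close> divided by the same product on the circle.  The circle can be pushed so close to the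
  boundary of the half-plane, where Blaschke factors have modulus 1, that the quotient is at most \<open>q^n\<close>
  with \<open>q < 1\<close> fixed (\<open>prescribed_pole_approximation\<close>, \<open>tanh_span_approximation\<close>).

  With \<open>N = \<epsilon> m\<close> and \<open>\<epsilon>\<close> small, the growth \<open>exp (R N \<pi> / 4)\<close> of \<open>H\<close> on the strip \<open>|Im z| < \<pi> / 4\<close> is
  beaten by \<open>q^m\<close>: the second error is exponentially small in \<open>m\<close>, and by Cauchy's estimates so are its
  derivatives near the interval.  Multiplied by a smooth cutoff it becomes a function on the line whose
  transform decays fast enough to have small norm in every \<open>H^s\<close> with \<open>s \<le> r\<close>.

  The nodes enter as distinct points of a bounded interval; distinctness is what quasi-uniformity of the
  angles provides (\<open>quasi_Chebyshev_inj\<close>).  Since the norm on the interval is a quotient norm, all estimates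
  are made for explicit extensions on the line.  Convolution and truncation of \<open>L^2\<close> functions are handled
  by the inequality \<open>bessel_inequality\<close>, proved with Gaussian weights.
\<close>

section \<open>Products of translated hyperbolic tangents\<close>

text \<open>The addition theorem for \<open>tanh\<close>, read as a partial fraction decomposition of a product of two
  factors with different poles.\<close>

lemma tanh_mult_tanh:
  fixes a b :: real
  assumes "a \<noteq> b"
  shows "tanh a * tanh b = 1 - (tanh a - tanh b) / tanh (a - b)"
proof -
  have ne: "tanh (a - b) \<noteq> 0" using assms by simp
  have d: "1 - tanh a * tanh b \<noteq> 0"
  proof -
    have "\<bar>tanh a * tanh b\<bar> < 1 * 1"
      unfolding abs_mult by (rule abs_mult_less) (use tanh_real_lt_1 tanh_real_gt_neg1 in \<open>auto simp: abs_less_iff minus_less_iff\<close>)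
    then show ?thesis by auto
  qed
  have "tanh (a - b) = (tanh a - tanh b) / (1 - tanh a * tanh b)"
    using tanh_add[of a "-b"] by simp
  then have "tanh a - tanh b = tanh (a - b) * (1 - tanh a * tanh b)" using d by simp
  then show ?thesis using ne by (simp add: field_simps)
qed

text \<open>Partial fractions with the constant left undetermined; \<open>newton_sum_in_span_tanh\<close> removes it in the
  combination that matters.\<close>

lemma prod_tanh_eq_const_plus_sum_tanh:
  fixes y :: "nat \<Rightarrow> real"
  assumes "finite S" "inj_on y S"
  shows "\<exists>C c. \<forall>x. (\<Prod>j\<in>S. tanh (x - y j)) = C + (\<Sum>j\<in>S. c j * tanh (x - y j))"
  using assms
proof (induction S rule: finite_induct)
  case empty
  then show ?case by (intro exI[of _ 1]) auto
next
  case (insert i S)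
  then obtain C c where c: "\<And>x. (\<Prod>j\<in>S. tanh (x - y j)) = C + (\<Sum>j\<in>S. c j * tanh (x - y j))" by auto
  let ?t = "\<lambda>j. tanh (y i - y j)"
  have yij: "y i \<noteq> y j" if "j \<in> S" for j using insert that by (auto simp: inj_on_def)
  define c' where "c' = (\<lambda>j. if j = i then C - (\<Sum>j\<in>S. c j / tanh (y j - y i))
      else c j / tanh (y j - y i))"
  have "(\<Prod>j\<in>insert i S. tanh (x - y j)) = (\<Sum>j\<in>S. c j) + (\<Sum>j\<in>insert i S. c' j * tanh (x - y j))" for x
  proof -
    have "(\<Prod>j\<in>insert i S. tanh (x - y j)) = tanh (x - y i) * (C + (\<Sum>j\<in>S. c j * tanh (x - y j)))"
      using insert c by simp
    also have "\<dots> = C * tanh (x - y i) + (\<Sum>j\<in>S. c j * (tanh (x - y i) * tanh (x - y j)))"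
      by (simp add: algebra_simps sum_distrib_left)
    also have "(\<Sum>j\<in>S. c j * (tanh (x - y i) * tanh (x - y j))) = 
      (\<Sum>j\<in>S. c j - c j / tanh (y j - y i) * tanh (x - y i) + c j / tanh (y j - y i) * tanh (x - y j))"
    proof (rule sum.cong[OF refl])
      fix j assume "j \<in> S"
      then have "x - y i \<noteq> x - y j" using yij by auto
      from arg_cong[OF tanh_mult_tanh[OF this], of "\<lambda>z. c j * z"]
      show "c j * (tanh (x - y i) * tanh (x - y j)) = c j - c j / tanh (y j - y i) * tanh (x - y i)
         + c j / tanh (y j - y i) * tanh (x - y j)"
        by (simp add: algebra_simps diff_divide_distrib)
    qed
    also have "\<dots> = (\<Sum>j\<in>S. c j) - (\<Sum>j\<in>S. c j / tanh (y j - y i)) * tanh (x - y i) 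
       + (\<Sum>j\<in>S. c' j * tanh (x - y j))"
    proof -
      have "(\<Sum>j\<in>S. c j / tanh (y j - y i) * tanh (x - y j)) = (\<Sum>j\<in>S. c' j * tanh (x - y j))"
        using insert(2) by (intro sum.cong) (auto simp: c'_def)
      then show ?thesis by (simp add: sum.distrib sum_subtractf sum_distrib_right)
    qed
    finally show ?thesis using insert(1,2) by (simp add: c'_def algebra_simps sum_negf)
  qed
  then show ?case by blast
qed

lemma sum_alternating_telescope:
  fixes b :: "nat \<Rightarrow> real"
  shows "(\<Sum>k<n. (-1)^k * (b (Suc k) + b k)) = b 0 - (-1)^n * b n"
  by (induction n) (auto simp: algebra_simps)

text \<open>The Newton-type sums produced by the Cauchy kernel expansion carry no constant term when \<open>n\<close> is even.
  By partial fractions the sum is \<open>D\<close> plus a combination of \<open>tanh\<close>, whose limits at the two ends of the line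
  are \<open>D + \<Sum> a_j\<close> and \<open>D - \<Sum> a_j\<close>; computed directly, the same two limits telescope to
  \<open>b_n - b_0\<close> and \<open>b_0 - b_n\<close>, hence \<open>D = 0\<close>.\<close>

lemma newton_sum_in_span_tanh:
  fixes b y :: "nat \<Rightarrow> real"
  assumes "even n" "inj_on y {..<n}"
  shows "\<exists>a. \<forall>x. (\<Sum>k<n. b (Suc k) * (\<Prod>j<k. tanh (x - y j)) - b k * (\<Prod>j<Suc k. tanh (x - y j)))
     = (\<Sum>j<n. a j * tanh (x - y j))"
proof -
  have "\<exists>C c. \<forall>x. (\<Prod>j<k. tanh (x - y j)) = C + (\<Sum>j<k. c j * tanh (x - y j))" if "k \<le> n" for k
    by (rule prod_tanh_eq_const_plus_sum_tanh) (use assms that in \<open>auto intro: inj_on_subset\<close>)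
  then obtain C c where c: "\<And>k x. k \<le> n \<Longrightarrow> (\<Prod>j<k. tanh (x - y j)) = C k + (\<Sum>j<k. c k j * tanh (x - y j))"
    by metis
  define c' where "c' = (\<lambda>k j. if j < k then c k j else 0)"
  have c2: "(\<Prod>j<k. tanh (x - y j)) = C k + (\<Sum>j<n. c' k j * tanh (x - y j))" if "k \<le> n" for k x
  proof -
    have "(\<Sum>j<n. c' k j * tanh (x - y j)) = (\<Sum>j<k. c k j * tanh (x - y j))"
      by (rule sum.mono_neutral_cong_right) (use that in \<open>auto simp: c'_def\<close>)
    then show ?thesis using c[OF that] by simp
  qed
  define R where "R = (\<lambda>x. \<Sum>k<n. b (Suc k) * (\<Prod>j<k. tanh (x - y j)) - b k * (\<Prod>j<Suc k. tanh (x - y j)))"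
  define D where "D = (\<Sum>k<n. b (Suc k) * C k - b k * C (Suc k))"
  define a where "a = (\<lambda>j. \<Sum>k<n. b (Suc k) * c' k j - b k * c' (Suc k) j)"
  have R: "R x = D + (\<Sum>j<n. a j * tanh (x - y j))" for x
  proof -
    have "R x = (\<Sum>k<n. (b (Suc k) * C k - b k * C (Suc k)) + 
       (\<Sum>j<n. (b (Suc k) * c' k j - b k * c' (Suc k) j) * tanh (x - y j)))"
      unfolding R_def
      by (rule sum.cong[OF refl], subst c2, simp, subst c2, simp)
        (simp add: algebra_simps sum_distrib_left sum_subtractf sum.distrib)
    also have "\<dots> = D + (\<Sum>j<n. a j * tanh (x - y j))"
      unfolding D_def a_def sum.distrib sum_distrib_right by (subst sum.swap) simp
    finally show ?thesis .
  qed
  have top: "((\<lambda>x. tanh (x - y j)) \<longlongrightarrow> 1) at_top" for j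
    by (rule filterlim_compose[OF tanh_real_at_top]) 
       (use filterlim_tendsto_add_at_top[OF tendsto_const[of "- y j"] filterlim_ident] in \<open>simp add: add.commute\<close>)
  have bot: "((\<lambda>x. tanh (x - y j)) \<longlongrightarrow> -1) at_bot" for j
    by (rule filterlim_compose[OF tanh_real_at_bot]) 
       (use filterlim_tendsto_add_at_bot_iff[OF tendsto_const[of "- y j" at_bot], of "\<lambda>x. x"] filterlim_ident in \<open>simp add: add.commute\<close>)
  have "(R \<longlongrightarrow> (\<Sum>k<n. b (Suc k) * (\<Prod>j<k. 1) - b k * (\<Prod>j<Suc k. 1))) at_top"
    unfolding R_def by (intro tendsto_intros top)
  moreover have "(R \<longlongrightarrow> D + (\<Sum>j<n. a j * 1)) at_top"
    unfolding R by (intro tendsto_intros top)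
  ultimately have 1: "D + sum a {..<n} = b n - b 0"
    by (auto dest: tendsto_unique[rotated] simp: sum_lessThan_telescope)
  have "(R \<longlongrightarrow> (\<Sum>k<n. b (Suc k) * (\<Prod>j<k. -1) - b k * (\<Prod>j<Suc k. -1))) at_bot"
    unfolding R_def by (intro tendsto_intros bot)
  moreover have "(R \<longlongrightarrow> D + (\<Sum>j<n. a j * (-1))) at_bot"
    unfolding R by (intro tendsto_intros bot)
  ultimately have "D - sum a {..<n} = (\<Sum>k<n. b (Suc k) * (-1)^k + b k * (-1)^k)"
    by (auto dest: tendsto_unique[rotated] simp: sum_negf)
  also have "\<dots> = (\<Sum>k<n. (-1)^k * (b (Suc k) + b k))" by (simp add: algebra_simps)
  also have "\<dots> = b 0 - b n" using assms(1) by (subst sum_alternating_telescope) auto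
  finally have "D = 0" using 1 by simp
  then show ?thesis using R unfolding R_def by auto
qed

section \<open>Rational approximation with prescribed poles\<close>

text \<open>The product of the Blaschke factors of the right half-plane with zeros \<open>v_j\<close>; in the coordinate
  \<open>u = e^{2x}\<close> it is the product of the functions \<open>tanh (x - y_j)\<close> (\<open>blaschke_exp_eq_prod_tanh\<close>).\<close>

definition blaschke :: "(nat \<Rightarrow> real) \<Rightarrow> nat \<Rightarrow> complex \<Rightarrow> complex" where
  "blaschke v n u = (\<Prod>j<n. (u - of_real (v j)) / (u + of_real (v j)))"

lemma blaschke_0 [simp]: "blaschke v 0 u = 1"
  by (simp add: blaschke_def)

lemma blaschke_Suc: "blaschke v (Suc n) u = blaschke v n u * ((u - of_real (v n)) / (u + of_real (v n)))"
  by (simp add: blaschke_def)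

text \<open>With \<open>\<tau>(z) = (z - v) / (z + v)\<close> one has
  \<open>(s + u) / (s - u) (\<tau>(s) - \<tau>(u)) = 1 - \<tau>(s) \<tau>(u)\<close>, the addition theorem for \<open>tanh\<close> in exponential
  coordinates.  Splitting off one factor after the other gives the expansion of the kernel
  \<open>(s + u) / (s - u)\<close>, which is \<open>coth\<close> of the difference of the logarithmic coordinates.  This kernel,
  unlike \<open>1 / (s - u)\<close>, keeps the remainder \<open>B_n(u) / B_n(s)\<close> in the span of the \<open>tanh\<close> translates.\<close>

lemma blaschke_kernel_telescope:
  assumes "s \<noteq> u" "\<And>j. j < n \<Longrightarrow> s + of_real (v j) \<noteq> 0" "\<And>j. j < n \<Longrightarrow> u + of_real (v j) \<noteq> 0"
     "\<And>j. j < n \<Longrightarrow> s - of_real (v j) \<noteq> 0"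
  shows "(s + u) / (s - u) * (1 - blaschke v n u / blaschke v n s)
     = (\<Sum>k<n. blaschke v k u / blaschke v (Suc k) s - blaschke v (Suc k) u / blaschke v k s)"
  using assms(2-)
proof (induction n)
  case 0
  then show ?case by simp
next
  case (Suc n)
  have nz: "blaschke v n s \<noteq> 0" using Suc.prems by (auto simp: blaschke_def)
  define w :: complex where "w = of_real (v n)"
  have w: "s + w \<noteq> 0" "u + w \<noteq> 0" "s - w \<noteq> 0" using Suc.prems[of n] by (auto simp: w_def)
  have su: "s - u \<noteq> 0" using assms(1) by simp
  define p where "p = blaschke v n u"
  define r where "r = blaschke v n s"
  have key: "(s + u) / (s - u) * (1 - ((u - w) / (u + w)) / ((s - w) / (s + w)))
      = 1 / ((s - w) / (s + w)) - (u - w) / (u + w)"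
    using w su by (simp add: divide_simps) algebra
  have "(s + u) / (s - u) * (1 - blaschke v (Suc n) u / blaschke v (Suc n) s)
      = (s + u) / (s - u) * (1 - p / r)
        + p / r * ((s + u) / (s - u) * (1 - ((u - w) / (u + w)) / ((s - w) / (s + w))))"
  proof -
    have "k * (1 - t * z) = k * (1 - t) + t * (k * (1 - z))" for k t z :: complex
      by (simp add: algebra_simps)
    from this[of "(s + u) / (s - u)" "p / r" "((u - w) / (u + w)) / ((s - w) / (s + w))"]
    show ?thesis
      unfolding blaschke_Suc p_def[symmetric] r_def[symmetric] w_def[symmetric]
      by (simp only: times_divide_times_eq)
  qed
  also have "p / r * ((s + u) / (s - u) * (1 - ((u - w) / (u + w)) / ((s - w) / (s + w))))
     = blaschke v n u / blaschke v (Suc n) s - blaschke v (Suc n) u / blaschke v n s"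
    unfolding key unfolding blaschke_Suc p_def[symmetric] r_def[symmetric] w_def[symmetric]
    by (simp add: algebra_simps)
  finally show ?case using Suc by (simp add: p_def r_def)
qed

lemma cmod_diff_less_cmod_add:
  assumes "Re u > 0" "w > 0"
  shows "cmod (u - of_real w) < cmod (u + of_real w)"
proof (rule power2_less_imp_less)
  show "(cmod (u - of_real w))\<^sup>2 < (cmod (u + of_real w))\<^sup>2"
    using mult_pos_pos[OF assms] unfolding cmod_power2 by (simp add: power2_eq_square algebra_simps)
qed simp

lemma add_of_real_ne_0:
  assumes "Re u > 0" "w > 0"
  shows "u + complex_of_real w \<noteq> 0"
proof
  assume "u + complex_of_real w = 0"
  then have "Re u + w = 0" by (metis Re_complex_of_real plus_complex.sel(1) zero_complex.sel(1))
  then show False using assms by simp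
qed

text \<open>On the circle with centre \<open>c\<close> and radius \<open>c - \<delta>\<close> the real part of \<open>s\<close> is at most
  \<open>(|s|^2 + 2 c \<delta>) / (2 c)\<close>, so in
  \<open>|(s - w) / (s + w)|^2 = 1 - 4 w Re s / |s + w|^2\<close> the defect is at most \<open>2 w / c + 4 \<delta> / w\<close>.  A large
  circle that almost touches the imaginary axis therefore has Blaschke factors of modulus close to 1.\<close>

lemma cmod_circle_factor_ge:
  fixes s :: complex
  assumes s: "cmod (s - of_real c) = c - \<delta>" and w: "v1 \<le> w" "w \<le> v2" "0 < v1"
    and d: "0 < \<delta>" "\<delta> < c" "\<delta> \<le> v1 * \<eta> / 8" and c: "4 * v2 \<le> c * \<eta>" and \<eta>: "\<eta> = 1 - q\<^sup>2" "0 < q" "q < 1"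
  shows "q \<le> cmod ((s - of_real w) / (s + of_real w))"
proof -
  define \<sigma> where "\<sigma> = Re s"
  have "\<eta> > 0" using \<eta> by (simp add: power_less_one_iff)
  have rs: "\<sigma> \<ge> \<delta>"
    using abs_Re_le_cmod[of "s - of_real c"] s by (auto simp: \<sigma>_def)
  have pos: "\<sigma> > 0" using rs d by simp
  define N where "N = (cmod s)\<^sup>2"
  have "(cmod (s - of_real c))\<^sup>2 = N - 2 * c * \<sigma> + c\<^sup>2"
    unfolding N_def cmod_power2 \<sigma>_def by (simp add: power2_eq_square algebra_simps)
  then have N: "2 * c * \<sigma> = N + 2 * c * \<delta> - \<delta>\<^sup>2"
    unfolding s by (simp add: power2_eq_square algebra_simps)
  have N0: "N \<ge> 0" by (simp add: N_def)
  have wpos: "w > 0" using w by simp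
  have A: "(cmod (s + of_real w))\<^sup>2 = N + w\<^sup>2 + 2 * w * \<sigma>"
    unfolding N_def cmod_power2 \<sigma>_def by (simp add: power2_eq_square algebra_simps)
  have Bq: "(cmod (s - of_real w))\<^sup>2 = N + w\<^sup>2 - 2 * w * \<sigma>"
    unfolding N_def cmod_power2 \<sigma>_def by (simp add: power2_eq_square algebra_simps)
  have cpos: "c > 0" using d by simp
  have "4 * w * \<sigma> * c \<le> 2 * w * (N + 2 * c * \<delta>)"
  proof -
    have "2 * c * \<sigma> \<le> N + 2 * c * \<delta>" unfolding N by simp
    from mult_left_mono[OF this, of "2 * w"] wpos show ?thesis by (simp add: algebra_simps)
  qed
  also have "\<dots> \<le> \<eta> / 2 * N * c + \<eta> / 2 * w\<^sup>2 * c"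
  proof -
    have "2 * w * N \<le> \<eta> / 2 * N * c"
      using mult_right_mono[of "4 * w" "c * \<eta>" "N/2"] N0 c w by (simp add: algebra_simps)
    moreover have "8 * \<delta> \<le> w * \<eta>"
      using d(3) mult_right_mono[OF w(1), of \<eta>] \<open>\<eta> > 0\<close> by linarith
    then have "4 * w * c * \<delta> \<le> \<eta> / 2 * w\<^sup>2 * c"
      using mult_left_mono[of "8 * \<delta>" "w * \<eta>" "w * c / 2"] wpos cpos
      by (simp add: algebra_simps power2_eq_square)
    ultimately show ?thesis by (simp add: algebra_simps)
  qed
  also have "\<dots> \<le> c * (\<eta> * (N + w\<^sup>2 + 2 * w * \<sigma>))"
  proof -
    have "0 \<le> c * \<eta> * N" "0 \<le> c * \<eta> * w\<^sup>2" "0 \<le> c * \<eta> * (w * \<sigma>)"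
      using cpos \<open>\<eta> > 0\<close> N0 wpos pos by simp_all
    then show ?thesis by (simp add: algebra_simps)
  qed
  finally have "4 * w * \<sigma> \<le> \<eta> * (N + w\<^sup>2 + 2 * w * \<sigma>)"
    using cpos by (simp add: mult.commute)
  then have le: "q\<^sup>2 * (cmod (s + of_real w))\<^sup>2 \<le> (cmod (s - of_real w))\<^sup>2"
    unfolding A Bq \<eta>(1) by (simp add: algebra_simps)
  have "s + of_real w \<noteq> 0" using add_of_real_ne_0[of s w] pos wpos by (simp add: \<sigma>_def)
  moreover have "q * cmod (s + of_real w) \<le> cmod (s - of_real w)"
    by (rule power2_le_imp_le) (use le in \<open>simp_all add: power_mult_distrib\<close>)
  ultimately show ?thesis by (simp add: norm_divide divide_simps)
qed

text \<open>The quantitative core.  On the compact set \<open>K\<close> all Blaschke factors are at most \<open>q1 < 1\<close> in modulus;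
  the circle is chosen so large and so close to the imaginary axis that there they are at least
  \<open>q2 > q1\<close>.  Cauchy's formula with the kernel of \<open>blaschke_kernel_telescope\<close> then represents the error
  as an integral of \<open>B_n(u) / B_n(s)\<close>, of size \<open>(q1 / q2)^n\<close>.  The constants are uniform in the number and
  the position of the poles.\<close>

lemma prescribed_pole_approximation:
  fixes K :: "complex set"
  assumes K: "compact K" "\<And>u. u \<in> K \<Longrightarrow> Re u > 0" and v12: "0 < v1"
  shows "\<exists>q C. 0 < q \<and> q < 1 \<and> 0 < C \<and>
    (\<forall>n v G M. (\<forall>j<n. v j \<in> {v1..v2}) \<longrightarrow> G holomorphic_on {s. Re s > 0} \<longrightarrow> (\<forall>s. Re s > 0 \<longrightarrow> cmod (G s) \<le> M) \<longrightarrow>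
      (\<exists>b. \<forall>u\<in>K. cmod (G u - (\<Sum>k<n. b (Suc k) * blaschke v k u - b k * blaschke v (Suc k) u)) \<le> C * q ^ n * M))"
proof -
  obtain q1 where q1: "0 < q1" "q1 < 1" 
    "\<And>u w. u \<in> K \<Longrightarrow> w \<in> {v1..v2} \<Longrightarrow> cmod ((u - of_real w) / (u + of_real w)) \<le> q1"
  proof (cases "K \<times> {v1..v2} = {}")
    case True
    then show ?thesis using that[of "1/2"] by force
  next
    case False
    have cpt: "compact (K \<times> {v1..v2})" using K by (intro compact_Times) auto
    have "continuous_on (K \<times> {v1..v2}) (\<lambda>p. cmod ((fst p - of_real (snd p)) / (fst p + of_real (snd p))))"
      using add_of_real_ne_0[OF K(2) less_le_trans[OF v12]] by (intro continuous_intros) auto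
    from continuous_attains_sup[OF cpt False this] obtain u0 w0 where uw: "u0 \<in> K" "w0 \<in> {v1..v2}" and
      le: "\<And>u w. u \<in> K \<Longrightarrow> w \<in> {v1..v2} \<Longrightarrow> cmod ((u - of_real w) / (u + of_real w)) \<le> cmod ((u0 - of_real w0) / (u0 + of_real w0))"
      by fastforce
    have "cmod ((u0 - of_real w0) / (u0 + of_real w0)) < 1"
      using cmod_diff_less_cmod_add[of u0 w0] K(2)[OF uw(1)] uw v12 by (simp add: norm_divide divide_simps)
    then show ?thesis using le by (intro that[of "max (1/2) (cmod ((u0 - of_real w0) / (u0 + of_real w0)))"]) (auto simp: le_max_iff_disj)
  qed
  obtain \<kappa> where \<kappa>: "0 < \<kappa>" "\<And>u. u \<in> K \<Longrightarrow> Re u \<ge> \<kappa>"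
  proof (cases "K = {}")
    case True
    then show ?thesis using that[of 1] by simp
  next
    case False
    from continuous_attains_inf[OF K(1) this continuous_on_Re[OF continuous_on_id]] K(2)
    show ?thesis using that by auto
  qed
  obtain X where X: "0 < X" "\<And>u. u \<in> K \<Longrightarrow> cmod u \<le> X"
    using compact_imp_bounded[OF K(1)] unfolding bounded_pos by auto
  define q2 where "q2 = (1 + q1) / 2"
  have q2: "q1 < q2" "q2 < 1" "0 < q2" using q1 by (auto simp: q2_def)
  define \<eta> where "\<eta> = 1 - q2\<^sup>2"
  have \<eta>: "\<eta> > 0" using q2 by (simp add: \<eta>_def power_less_one_iff)
  define \<delta> where "\<delta> = min (\<kappa> / 4) (v1 * \<eta> / 8)"
  have \<delta>: "0 < \<delta>" "\<delta> \<le> \<kappa> / 4" "\<delta> \<le> v1 * \<eta> / 8" using \<kappa> \<eta> v12 by (auto simp: \<delta>_def)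
  define c where "c = max (max (X\<^sup>2 / \<kappa>) (4 * v2 / \<eta>)) (3 * \<delta>)"
  have "X\<^sup>2 / \<kappa> \<le> c" "4 * v2 / \<eta> \<le> c" "c \<ge> 3 * \<delta>" by (auto simp: c_def)
  then have c: "X\<^sup>2 \<le> c * \<kappa>" "4 * v2 \<le> c * \<eta>" "c \<ge> 3 * \<delta>" using \<kappa> \<eta> by (auto simp: divide_simps)
  have cpos: "0 < c" using c \<delta> by simp
  define \<rho> where "\<rho> = c - \<delta>"
  have \<rho>: "0 < \<rho>" using c \<delta> by (simp add: \<rho>_def)
  have K_in: "cmod (u - of_real c) \<le> c - 2 * \<delta>" if "u \<in> K" for u
  proof (rule power2_le_imp_le)
    have "(cmod (u - of_real c))\<^sup>2 = (cmod u)\<^sup>2 - 2 * c * Re u + c\<^sup>2"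
      unfolding cmod_power2 by (simp add: power2_eq_square algebra_simps)
    also have "(cmod u)\<^sup>2 \<le> c * \<kappa>" using c(1) power_mono[OF X(2)[OF that], of 2] by simp
    also have "c * \<kappa> - 2 * c * Re u + c\<^sup>2 \<le> c\<^sup>2 - c * \<kappa>"
      using mult_left_mono[OF \<kappa>(2)[OF that], of c] cpos by (simp add: algebra_simps)
    also have "\<dots> \<le> c\<^sup>2 - 4 * c * \<delta>" using mult_left_mono[OF \<delta>(2), of c] cpos by simp
    also have "\<dots> \<le> (c - 2 * \<delta>)\<^sup>2" by (simp add: power2_eq_square algebra_simps)
    finally show "(cmod (u - of_real c))\<^sup>2 \<le> (c - 2 * \<delta>)\<^sup>2" by simp
  qed (use c \<delta> in simp)
  have disk: "Re s > 0" if "cmod (s - of_real c) \<le> \<rho>" for s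
    using abs_Re_le_cmod[of "s - of_real c"] that \<delta>(1) by (auto simp: \<rho>_def)
  define q where "q = q1 / q2"
  define C where "C = \<rho> * ((2 * c + X) / (2 * \<delta> * \<delta>))"
  have Cpos: "C > 0" using \<rho> cpos X \<delta> by (simp add: C_def)
  have main: "\<exists>b. \<forall>u\<in>K. cmod (G u - (\<Sum>k<n. b (Suc k) * blaschke v k u - b k * blaschke v (Suc k) u)) \<le> C * q ^ n * M"
    if v: "\<forall>j<n. v j \<in> {v1..v2}" and hol: "G holomorphic_on {s. Re s > 0}" and bd: "\<forall>s. Re s > 0 \<longrightarrow> cmod (G s) \<le> M" for n v G M
  proof -
    have M0: "0 \<le> M" using bd[rule_format, of 1] norm_ge_zero[of "G 1"] by (simp del: norm_ge_zero)
    have fac: "q2 \<le> cmod ((s - of_real (v j)) / (s + of_real (v j)))" if "s \<in> sphere (of_real c) \<rho>" "j < n" for s j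
      by (rule cmod_circle_factor_ge[of s c \<delta> v1 _ v2 \<eta>])
        (use that v v12 \<delta> c q2 cpos in \<open>auto simp: \<rho>_def \<eta>_def dist_norm norm_minus_commute\<close>)
    have Bge: "q2 ^ k \<le> cmod (blaschke v k s)" if "s \<in> sphere (of_real c) \<rho>" "k \<le> n" for s k
    proof -
      have "(\<Prod>j<k. q2) \<le> (\<Prod>j<k. cmod ((s - of_real (v j)) / (s + of_real (v j))))"
        using fac[OF that(1)] that(2) q2 by (intro prod_mono) auto
      then show ?thesis by (simp add: blaschke_def prod_norm)
    qed
    have Ble: "cmod (blaschke v k u) \<le> q1 ^ k" if "u \<in> K" "k \<le> n" for u k
    proof -
      have "(\<Prod>j<k. cmod ((u - of_real (v j)) / (u + of_real (v j)))) \<le> (\<Prod>j<k. q1)"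
        using q1(3)[OF that(1)] that(2) v by (intro prod_mono) auto
      then show ?thesis by (simp add: blaschke_def prod_norm)
    qed
    have Bnz: "blaschke v k s \<noteq> 0" if "s \<in> sphere (of_real c) \<rho>" "k \<le> n" for s k
      using Bge[OF that] zero_less_power[OF q2(3), of k] by auto
    have Resph: "Re s > 0" if "s \<in> sphere (of_real c) \<rho>" for s
      using disk that by (simp add: dist_norm norm_minus_commute)
    have s0: "s \<noteq> 0" if "Re s > 0" for s using that by auto
    have contB: "continuous_on (sphere (of_real c) \<rho>) (blaschke v k)" if "k \<le> n" for k
    proof -
      have "s + of_real (v j) \<noteq> 0" if "s \<in> sphere (of_real c) \<rho>" "j < k" for s :: complex and j
      proof -
        have "v1 \<le> v j" using v that \<open>k \<le> n\<close> by auto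
        then show ?thesis using add_of_real_ne_0[OF Resph[OF that(1)], of "v j"] v12 by auto
      qed
      then show ?thesis unfolding blaschke_def by (intro continuous_intros) auto
    qed
    have contG: "continuous_on (sphere (of_real c) \<rho>) G"
      by (rule continuous_on_subset[OF holomorphic_on_imp_continuous_on[OF hol]]) (auto dest: Resph)
    define I where "I = (\<lambda>k. contour_integral (circlepath (of_real c) \<rho>) (\<lambda>s. G s / (2 * s * blaschke v k s)))"
    have I: "((\<lambda>s. G s / (2 * s * blaschke v k s)) has_contour_integral I k) (circlepath (of_real c) \<rho>)" if "k \<le> n" for k
      unfolding I_def using \<rho> that Bnz
      by (intro has_contour_integral_integral contour_integrable_continuous_circlepath continuous_intros)
         (auto intro!: continuous_intros contG contB dest: Resph s0)
    define b where "b = (\<lambda>k. I k / (2 * pi * \<i>))"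
    have "cmod (G u - (\<Sum>k<n. b (Suc k) * blaschke v k u - b k * blaschke v (Suc k) u)) \<le> C * q ^ n * M" if u: "u \<in> K" for u
    proof -
      have ub: "cmod (u - of_real c) < \<rho>" using K_in[OF u] \<delta>(1) by (simp add: dist_norm norm_minus_commute \<rho>_def)
      have Reu: "Re u > 0" using K u by auto
      \<comment> \<open>The measure \<open>ds / (2 s)\<close> of the logarithmic coordinate is part of the integrand; at \<open>s = u\<close> the factor
        \<open>(s + u) / (2 s)\<close> equals 1, and the point 0 lies outside the circle.\<close>
      have "((\<lambda>s. (G s * (s + u) / (2 * s)) / (s - u)) has_contour_integral (2 * of_real pi * \<i> * (G u * (u + u) / (2 * u)))) (circlepath (of_real c) \<rho>)"
      proof (rule Cauchy_integral_circlepath[OF _ _ ub])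
        have "(\<lambda>s. G s * (s + u) / (2 * s)) holomorphic_on cball (of_real c) \<rho>"
          using disk by (intro holomorphic_intros holomorphic_on_subset[OF hol]) (auto simp: dist_norm norm_minus_commute dest: s0)
        then show "continuous_on (cball (of_real c) \<rho>) (\<lambda>s. G s * (s + u) / (2 * s))" "(\<lambda>s. G s * (s + u) / (2 * s)) holomorphic_on ball (of_real c) \<rho>"
          by (auto intro: holomorphic_on_imp_continuous_on holomorphic_on_subset)
      qed
      moreover have "G u * (u + u) / (2 * u) = G u" using Reu by (auto simp: field_simps)
      ultimately have 1: "((\<lambda>s. (G s * (s + u) / (2 * s)) / (s - u)) has_contour_integral (2 * of_real pi * \<i> * G u)) (circlepath (of_real c) \<rho>)"
        by simp
      have 2: "((\<lambda>s. \<Sum>k<n. blaschke v k u * (G s / (2 * s * blaschke v (Suc k) s)) - blaschke v (Suc k) u * (G s / (2 * s * blaschke v k s)))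
          has_contour_integral (\<Sum>k<n. blaschke v k u * I (Suc k) - blaschke v (Suc k) u * I k)) (circlepath (of_real c) \<rho>)"
        by (intro has_contour_integral_sum has_contour_integral_diff has_contour_integral_lmul I) auto
      define S where "S = (\<Sum>k<n. b (Suc k) * blaschke v k u - b k * blaschke v (Suc k) u)"
      have S: "(\<Sum>k<n. blaschke v k u * I (Suc k) - blaschke v (Suc k) u * I k) = 2 * of_real pi * \<i> * S"
        unfolding S_def b_def sum_distrib_left by (intro sum.cong) (auto simp: field_simps)
      have 3: "((\<lambda>s. G s * (s + u) / (2 * s) / (s - u) * (blaschke v n u / blaschke v n s)) has_contour_integral
          2 * of_real pi * \<i> * (G u - S)) (circlepath (of_real c) \<rho>)"
      proof (rule has_contour_integral_eq)
        show "((\<lambda>s. (G s * (s + u) / (2 * s)) / (s - u) - 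
             (\<Sum>k<n. blaschke v k u * (G s / (2 * s * blaschke v (Suc k) s)) - blaschke v (Suc k) u * (G s / (2 * s * blaschke v k s))))
            has_contour_integral 2 * of_real pi * \<i> * (G u - S)) (circlepath (of_real c) \<rho>)"
          using has_contour_integral_diff[OF 1 2] unfolding S by (simp add: algebra_simps)
        fix s assume "s \<in> path_image (circlepath (complex_of_real c) \<rho>)"
        then have s: "s \<in> sphere (of_real c) \<rho>" using \<rho> by simp
        have su: "s \<noteq> u" using s ub by (auto simp: dist_norm norm_minus_commute)
        have Res: "Re s > 0" using Resph[OF s] .
        have "(s + u) / (s - u) * (1 - blaschke v n u / blaschke v n s)
           = (\<Sum>k<n. blaschke v k u / blaschke v (Suc k) s - blaschke v (Suc k) u / blaschke v k s)"
        proof (rule blaschke_kernel_telescope[OF su])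
          fix j assume "j < n"
          then have "v j > 0" using v v12 by auto
          then show "s + of_real (v j) \<noteq> 0" "u + of_real (v j) \<noteq> 0" using add_of_real_ne_0 Res Reu by blast+
          show "s - of_real (v j) \<noteq> 0" using fac[OF s \<open>j < n\<close>] q2 by auto
        qed
        moreover have "(\<Sum>k<n. blaschke v k u * (G s / (2 * s * blaschke v (Suc k) s)) - blaschke v (Suc k) u * (G s / (2 * s * blaschke v k s)))
           = G s / (2 * s) * (\<Sum>k<n. blaschke v k u / blaschke v (Suc k) s - blaschke v (Suc k) u / blaschke v k s)"
          unfolding sum_distrib_left by (intro sum.cong) (auto simp: right_diff_distrib mult.commute)
        ultimately have "(\<Sum>k<n. blaschke v k u * (G s / (2 * s * blaschke v (Suc k) s)) - blaschke v (Suc k) u * (G s / (2 * s * blaschke v k s)))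
           = G s / (2 * s) * ((s + u) / (s - u) * (1 - blaschke v n u / blaschke v n s))" by simp
        then show "(G s * (s + u) / (2 * s)) / (s - u) - 
             (\<Sum>k<n. blaschke v k u * (G s / (2 * s * blaschke v (Suc k) s)) - blaschke v (Suc k) u * (G s / (2 * s * blaschke v k s)))
            = G s * (s + u) / (2 * s) / (s - u) * (blaschke v n u / blaschke v n s)"
        proof -
          have alg: "g * p / e / d - g / e * (p / d * (1 - t)) = g * p / e / d * t" for g p e d t :: complex
            by (simp add: right_diff_distrib divide_inverse mult_ac)
          assume *: "(\<Sum>k<n. blaschke v k u * (G s / (2 * s * blaschke v (Suc k) s)) - blaschke v (Suc k) u * (G s / (2 * s * blaschke v k s)))
           = G s / (2 * s) * ((s + u) / (s - u) * (1 - blaschke v n u / blaschke v n s))"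
          show ?thesis unfolding * by (rule alg)
        qed
      qed
      have "cmod (2 * of_real pi * \<i> * (G u - S)) \<le> (M * (2 * c + X) / (2 * \<delta>) / \<delta> * (q1 ^ n / q2 ^ n)) * (2 * pi * \<rho>)"
      proof (rule has_contour_integral_bound_circlepath[OF 3])
        fix s assume "cmod (s - of_real c) = \<rho>"
        then have s: "s \<in> sphere (of_real c) \<rho>" and ns: "cmod (s - of_real c) = \<rho>" by (auto simp: dist_norm norm_minus_commute)
        have Res: "Re s \<ge> \<delta>" using abs_Re_le_cmod[of "s - of_real c"] ns by (auto simp: \<rho>_def)
        then have a1: "\<delta> \<le> cmod s" using abs_Re_le_cmod[of s] by simp
        have a2: "\<delta> \<le> cmod (s - u)"
          using norm_triangle_ineq[of "s - u" "u - of_real c"] K_in[OF u] ns by (simp add: \<rho>_def)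
        have a3: "cmod s \<le> 2 * c" using norm_triangle_ineq[of "s - of_real c" "of_real c"] ns cpos \<delta>(1) by (simp add: \<rho>_def)
        have a4: "cmod (s + u) \<le> 2 * c + X" using norm_triangle_ineq[of s u] a3 X(2)[OF u] by simp
        have a5: "cmod (G s) \<le> M" using bd Resph[OF s] by auto
        have "cmod (G s * (s + u) / (2 * s) / (s - u) * (blaschke v n u / blaschke v n s))
          = cmod (G s) * cmod (s + u) / (2 * cmod s) / cmod (s - u) * (cmod (blaschke v n u) / cmod (blaschke v n s))"
          by (simp add: norm_mult norm_divide)
        also have "\<dots> \<le> M * (2 * c + X) / (2 * \<delta>) / \<delta> * (q1 ^ n / q2 ^ n)"
          using a1 a2 a4 a5 \<delta>(1) M0 q1 q2 cpos X Bge[OF s order_refl] Ble[OF u order_refl]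
          by (intro mult_mono frac_le divide_nonneg_nonneg mult_nonneg_nonneg) auto
        finally show "cmod (G s * (s + u) / (2 * s) / (s - u) * (blaschke v n u / blaschke v n s))
            \<le> M * (2 * c + X) / (2 * \<delta>) / \<delta> * (q1 ^ n / q2 ^ n)" .
      qed (use \<rho> M0 q1 q2 \<delta> cpos X in auto)
      moreover have "cmod (2 * of_real pi * \<i> * (G u - S)) = 2 * pi * cmod (G u - S)"
        unfolding norm_mult by simp
      moreover have "(M * (2 * c + X) / (2 * \<delta>) / \<delta> * (q1 ^ n / q2 ^ n)) * (2 * pi * \<rho>) = 2 * pi * (C * q ^ n * M)"
        by (simp add: C_def q_def power_divide)
      ultimately have "2 * pi * cmod (G u - S) \<le> 2 * pi * (C * q ^ n * M)"
        by simp
      then show ?thesis by (simp add: S_def)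
    qed
    then show ?thesis by blast
  qed
  have "0 < q" "q < 1" using q1 q2 by (auto simp: q_def)
  then show ?thesis using Cpos main by blast
qed

lemma blaschke_exp_eq_prod_tanh:
  fixes x :: real and y :: "nat \<Rightarrow> real"
  shows "blaschke (\<lambda>j. exp (2 * y j)) k (exp (2 * of_real x)) = of_real (\<Prod>j<k. tanh (x - y j))"
proof -
  have "(exp (2 * x) - exp (2 * w)) / (exp (2 * x) + exp (2 * w)) = tanh (x - w)" for w :: real
  proof -
    have "exp (- (2 * (x - w))) = exp (2 * w) / exp (2 * x)" by (simp add: exp_diff[symmetric] algebra_simps)
    then have "tanh (x - w) = (1 - exp (2 * w) / exp (2 * x)) / (1 + exp (2 * w) / exp (2 * x))"
      by (simp add: tanh_real_altdef)
    then show ?thesis by (simp add: divide_simps add_pos_pos)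
  qed
  moreover have "exp (2 * complex_of_real x) = of_real (exp (2 * x))"
    by (simp add: exp_of_real[symmetric])
  ultimately show ?thesis
    unfolding blaschke_def of_real_prod by (metis (no_types, lifting) of_real_add of_real_diff of_real_divide)
qed

lemma Re_exp_double_pos:
  assumes "\<bar>Im z\<bar> < pi / 4"
  shows "Re (exp (2 * z)) > 0"
proof -
  have "cos (2 * Im z) > 0" using assms by (intro cos_gt_zero_pi) (auto simp: abs_less_iff)
  then show ?thesis by (simp add: Re_exp)
qed

text \<open>The estimate of \<open>prescribed_pole_approximation\<close> carried back to the variable \<open>z = (Ln u) / 2\<close>, which maps the half-plane to
  the strip \<open>|Im z| < \<pi> / 4\<close>.  The error is bounded on a complex neighbourhood of the interval, so that its
  derivatives can be estimated as well.  The function \<open>E\<close> may have complex coefficients; only its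
  real part on the real axis is a combination with real coefficients.\<close>

lemma tanh_span_approximation:
  fixes a b y1 y2 :: real
  shows "\<exists>q C. 0 < q \<and> q < 1 \<and> 0 < C \<and>
    (\<forall>n y H M. even n \<longrightarrow> inj_on y {..<n} \<longrightarrow> (\<forall>j<n. y j \<in> {y1..y2}) \<longrightarrow>
       H holomorphic_on UNIV \<longrightarrow> (\<forall>z. \<bar>Im z\<bar> < pi / 4 \<longrightarrow> cmod (H z) \<le> M) \<longrightarrow>
       (\<exists>(c :: nat \<Rightarrow> real) E. E holomorphic_on {z. \<bar>Im z\<bar> < pi / 4} \<and>
          (\<forall>x. Re (E (of_real x)) = Re (H (of_real x)) - (\<Sum>j<n. c j * tanh (x - y j))) \<and>
          (\<forall>z. Re z \<in> {a..b} \<longrightarrow> \<bar>Im z\<bar> \<le> pi / 8 \<longrightarrow> cmod (E z) \<le> C * q ^ n * M)))"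
proof -
  define Q where "Q = cbox (Complex a (- (pi / 8))) (Complex b (pi / 8))"
  have Q: "z \<in> Q \<longleftrightarrow> Re z \<in> {a..b} \<and> \<bar>Im z\<bar> \<le> pi / 8" for z
    by (auto simp: Q_def in_cbox_complex_iff)
  define K where "K = (\<lambda>z. exp (2 * z)) ` Q"
  have "compact K" unfolding K_def Q_def by (intro compact_continuous_image continuous_intros) auto
  moreover have "Re u > 0" if "u \<in> K" for u
  proof -
    from that obtain z where z: "u = exp (2 * z)" "\<bar>Im z\<bar> \<le> pi / 8" unfolding K_def by (auto simp: Q)
    then have "\<bar>Im z\<bar> < pi / 4" using pi_gt_zero by linarith
    then show ?thesis unfolding z(1) by (rule Re_exp_double_pos)
  qed
  ultimately obtain q C where q: "0 < q" "q < 1" "0 < C" and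
    main: "\<And>n v G M. (\<forall>j<n. v j \<in> {exp (2 * y1)..exp (2 * y2)}) \<Longrightarrow> G holomorphic_on {s. Re s > 0} \<Longrightarrow> 
       (\<forall>s. Re s > 0 \<longrightarrow> cmod (G s) \<le> M) \<Longrightarrow>
      (\<exists>\<beta>. \<forall>u\<in>K. cmod (G u - (\<Sum>k<n. \<beta> (Suc k) * blaschke v k u - \<beta> k * blaschke v (Suc k) u)) \<le> C * q ^ n * M)"
    using prescribed_pole_approximation[of K "exp (2 * y1)" "exp (2 * y2)"] by auto
  have "\<exists>(c :: nat \<Rightarrow> real) E. E holomorphic_on {z. \<bar>Im z\<bar> < pi / 4} \<and>
          (\<forall>x. Re (E (of_real x)) = Re (H (of_real x)) - (\<Sum>j<n. c j * tanh (x - y j))) \<and>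
          (\<forall>z. Re z \<in> {a..b} \<longrightarrow> \<bar>Im z\<bar> \<le> pi / 8 \<longrightarrow> cmod (E z) \<le> C * q ^ n * M)"
    if n: "even n" "inj_on y {..<n}" "\<forall>j<n. y j \<in> {y1..y2}" and H: "H holomorphic_on UNIV" 
      "\<forall>z. \<bar>Im z\<bar> < pi / 4 \<longrightarrow> cmod (H z) \<le> M" for n y H M
  proof -
    define v where "v = (\<lambda>j. exp (2 * y j))"
    define G where "G = (\<lambda>s. H (Ln s / 2))"
    have 1: "\<forall>j<n. v j \<in> {exp (2 * y1)..exp (2 * y2)}" using n by (simp add: v_def)
    have 2: "G holomorphic_on {s. Re s > 0}"
      unfolding G_def by (rule holomorphic_on_compose[OF _ holomorphic_on_subset[OF H(1)], unfolded o_def])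
        (auto intro!: holomorphic_intros elim!: nonpos_Reals_cases)
    have 3: "\<forall>s. Re s > 0 \<longrightarrow> cmod (G s) \<le> M"
    proof (intro allI impI)
      fix s :: complex assume "Re s > 0"
      moreover from this have "s \<noteq> 0" by auto
      ultimately have "\<bar>Im (Ln s)\<bar> < pi / 2" using Re_Ln_pos_lt by blast
      then show "cmod (G s) \<le> M" unfolding G_def by (intro H(2)[rule_format]) auto
    qed
    from main[OF 1 2 3] obtain \<beta> where \<beta>: "\<And>u. u \<in> K \<Longrightarrow>
       cmod (G u - (\<Sum>k<n. \<beta> (Suc k) * blaschke v k u - \<beta> k * blaschke v (Suc k) u)) \<le> C * q ^ n * M" by auto
    define E where "E = (\<lambda>z. H z - (\<Sum>k<n. \<beta> (Suc k) * blaschke v k (exp (2 * z)) - \<beta> k * blaschke v (Suc k) (exp (2 * z))))"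
    have hol: "E holomorphic_on {z. \<bar>Im z\<bar> < pi / 4}"
      unfolding E_def blaschke_def v_def
      by (intro holomorphic_intros holomorphic_on_subset[OF H(1)])
         (use add_of_real_ne_0[OF Re_exp_double_pos exp_gt_zero] in auto)
    obtain c where c: "\<And>x. (\<Sum>k<n. Re (\<beta> (Suc k)) * (\<Prod>j<k. tanh (x - y j)) - Re (\<beta> k) * (\<Prod>j<Suc k. tanh (x - y j)))
     = (\<Sum>j<n. c j * tanh (x - y j))"
      using newton_sum_in_span_tanh[OF n(1,2), of "\<lambda>k. Re (\<beta> k)"] by auto
    have re: "Re (E (of_real x)) = Re (H (of_real x)) - (\<Sum>j<n. c j * tanh (x - y j))" for x
      unfolding E_def v_def blaschke_exp_eq_prod_tanh c[symmetric] 
      by (simp del: prod.lessThan_Suc of_real_prod)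
    have "cmod (E z) \<le> C * q ^ n * M" if z: "Re z \<in> {a..b}" "\<bar>Im z\<bar> \<le> pi / 8" for z
    proof -
      have "exp (2 * z) \<in> K" using z by (auto simp: K_def Q)
      moreover have "\<bar>Im (2 * z)\<bar> \<le> pi / 4" using z(2) by (simp add: abs_mult)
      then have "Ln (exp (2 * z)) = 2 * z" using pi_gt_zero by (intro Ln_exp; linarith)
      ultimately show ?thesis using \<beta>[of "exp (2 * z)"] by (simp add: E_def G_def)
    qed
    then show ?thesis using hol re by blast
  qed
  then show ?thesis using q by blast
qed

section \<open>Real functions with bounded derivatives and compact support\<close>

text \<open>The function is \<open>k\<close> times continuously differentiable on the whole line, while the bound on the derivatives
  up to order \<open>k\<close> is required on \<open>S\<close> only: errors are small near the interval but not elsewhere, and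
  still have to be multiplied with cutoffs on the whole line.\<close>

primrec bounded_derivs :: "nat \<Rightarrow> real set \<Rightarrow> real \<Rightarrow> (real \<Rightarrow> real) \<Rightarrow> bool" where
  "bounded_derivs 0 S M G \<longleftrightarrow> continuous_on UNIV G \<and> (\<forall>x\<in>S. \<bar>G x\<bar> \<le> M)"
| "bounded_derivs (Suc k) S M G \<longleftrightarrow> (\<forall>x\<in>S. \<bar>G x\<bar> \<le> M) \<and>
     (\<exists>G'. (\<forall>x. (G has_real_derivative G' x) (at x)) \<and> bounded_derivs k S M G')"

lemma bounded_derivs_SucI:
  assumes "\<And>x. x \<in> S \<Longrightarrow> \<bar>G x\<bar> \<le> M" "\<And>x. (G has_real_derivative G' x) (at x)" "bounded_derivs k S M G'"
  shows "bounded_derivs (Suc k) S M G"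
  using assms by auto

lemma bounded_derivs_bound: "bounded_derivs k S M G \<Longrightarrow> x \<in> S \<Longrightarrow> \<bar>G x\<bar> \<le> M"
  by (cases k) auto

lemma bounded_derivs_continuous: "bounded_derivs k S M G \<Longrightarrow> continuous_on UNIV G"
  by (cases k) (auto intro!: continuous_at_imp_continuous_on dest: DERIV_isCont)

lemma bounded_derivs_SucD: "bounded_derivs (Suc k) S M G \<Longrightarrow> bounded_derivs k S M G"
proof (induction k arbitrary: G)
  case 0
  then show ?case using bounded_derivs_continuous[OF 0] by auto
qed auto

lemma bounded_derivs_mono: "bounded_derivs k S M G \<Longrightarrow> M \<le> N \<Longrightarrow> T \<subseteq> S \<Longrightarrow> bounded_derivs k T N G"
  by (induction k arbitrary: G) (fastforce)+

lemma bounded_derivs_add: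
  "bounded_derivs k S M G \<Longrightarrow> bounded_derivs k S N H \<Longrightarrow> bounded_derivs k S (M + N) (\<lambda>x. G x + H x)"
proof (induction k arbitrary: G H)
  case 0
  then show ?case by (auto intro!: continuous_intros order_trans[OF abs_triangle_ineq] add_mono)
next
  case (Suc k)
  then obtain G' H' where "\<And>x. (G has_real_derivative G' x) (at x)" "bounded_derivs k S M G'"
     "\<And>x. (H has_real_derivative H' x) (at x)" "bounded_derivs k S N H'" by auto
  then show ?case using Suc
    by (auto intro!: order_trans[OF abs_triangle_ineq] add_mono exI[of _ "\<lambda>x. G' x + H' x"] derivative_intros)
qed

lemma bounded_derivs_cmult:
  "bounded_derivs k S M G \<Longrightarrow> bounded_derivs k S (\<bar>c\<bar> * M) (\<lambda>x. c * G x)"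
proof (induction k arbitrary: G)
  case 0
  then show ?case by (auto intro!: continuous_intros mult_left_mono simp: abs_mult)
next
  case (Suc k)
  then obtain G' where "\<And>x. (G has_real_derivative G' x) (at x)" "bounded_derivs k S M G'" by auto
  then show ?case using Suc
    by (auto intro!: mult_left_mono exI[of _ "\<lambda>x. c * G' x"] derivative_eq_intros simp: abs_mult)
qed

lemma bounded_derivs_shift:
  "bounded_derivs k UNIV M G \<Longrightarrow> bounded_derivs k UNIV M (\<lambda>x. G (x + h))"
proof (induction k arbitrary: G)
  case 0
  have "continuous_on UNIV (\<lambda>x. G (x + h))"
    by (rule continuous_on_compose2[of UNIV G]) (use 0 in \<open>auto intro!: continuous_intros\<close>)
  then show ?case using 0 by auto
next
  case (Suc k)
  then obtain G' where G': "\<And>x. (G has_real_derivative G' x) (at x)" "bounded_derivs k UNIV M G'" by auto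
  show ?case
    by (rule bounded_derivs_SucI[OF _ DERIV_shift[THEN iffD1, OF G'(1)] Suc.IH[OF G'(2)]])
      (use Suc.prems in auto)
qed

text \<open>The factor \<open>2 ^ k\<close> is the sum of the binomial coefficients in Leibniz's rule, here produced by
  doubling once per derivative.\<close>

lemma bounded_derivs_mult:
  assumes "0 \<le> M" "0 \<le> N"
  shows "bounded_derivs k S M G \<Longrightarrow> bounded_derivs k S N H \<Longrightarrow> bounded_derivs k S (2 ^ k * (M * N)) (\<lambda>x. G x * H x)"
proof (induction k arbitrary: G H)
  case 0
  then show ?case using assms by (auto intro!: continuous_intros mult_mono simp: abs_mult)
next
  case (Suc k)
  then obtain G' H' where *: "\<And>x. (G has_real_derivative G' x) (at x)" "bounded_derivs k S M G'"
     "\<And>x. (H has_real_derivative H' x) (at x)" "bounded_derivs k S N H'" by auto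
  have "bounded_derivs k S (2 ^ k * (M * N)) (\<lambda>x. G' x * H x)" "bounded_derivs k S (2 ^ k * (M * N)) (\<lambda>x. G x * H' x)"
    using Suc * bounded_derivs_SucD by blast+
  from bounded_derivs_add[OF this]
  have 1: "bounded_derivs k S (2 ^ Suc k * (M * N)) (\<lambda>x. G' x * H x + G x * H' x)" by (simp add: algebra_simps)
  have 2: "\<bar>G x * H x\<bar> \<le> 2 ^ Suc k * (M * N)" if "x \<in> S" for x
  proof -
    have "\<bar>G x * H x\<bar> \<le> M * N" unfolding abs_mult using assms that Suc.prems by (intro mult_mono) auto
    also have "\<dots> \<le> 2 ^ Suc k * (M * N)" 
      using assms one_le_power[of "2::real" "Suc k"] mult_right_mono[of 1 "2 ^ Suc k" "M * N"] by simp
    finally show ?thesis .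
  qed
  have 3: "((\<lambda>x. G x * H x) has_real_derivative G' x * H x + G x * H' x) (at x)" for x
    using DERIV_mult[OF *(1,3)] by (simp add: add.commute mult.commute)
  show ?case by (rule bounded_derivs_SucI[OF 2 3 1])
qed

lemma bounded_derivs_Re_holomorphic:
  assumes T: "open T" "E holomorphic_on T" "range complex_of_real \<subseteq> T"
    and bd: "\<And>j x. j \<le> k \<Longrightarrow> x \<in> S \<Longrightarrow> cmod ((deriv ^^ j) E (of_real x)) \<le> D"
  shows "bounded_derivs k S D (\<lambda>x. Re (E (of_real x)))"
proof -
  have der: "((\<lambda>x. Re ((deriv ^^ j) E (of_real x))) has_real_derivative Re ((deriv ^^ Suc j) E (of_real x))) (at x)" for j x
  proof -
    have "(deriv ^^ j) E holomorphic_on T" using T by (simp add: holomorphic_higher_deriv)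
    then have "((deriv ^^ j) E has_field_derivative (deriv ^^ Suc j) E (of_real x)) (at (of_real x))"
      using T by (auto intro: holomorphic_derivI)
    from has_vector_derivative_real_field[OF this]
    have "((\<lambda>x. (deriv ^^ j) E (of_real x)) has_vector_derivative (deriv ^^ Suc j) E (of_real x)) (at x)" by simp
    from bounded_linear.has_vector_derivative[OF bounded_linear_Re this] show ?thesis by (simp add: has_real_derivative_iff_has_vector_derivative)
  qed
  have "i + m \<le> k \<Longrightarrow> bounded_derivs m S D (\<lambda>x. Re ((deriv ^^ i) E (of_real x)))" for m i
  proof (induction m arbitrary: i)
    case 0
    have "continuous_on UNIV (\<lambda>x. Re ((deriv ^^ i) E (of_real x)))"
      using der by (auto intro!: continuous_at_imp_continuous_on DERIV_isCont)
    then show ?case using bd 0 by (auto intro: order_trans[OF abs_Re_le_cmod])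
  next
    case (Suc m)
    then show ?case using bd der Suc.IH[of "Suc i"] by (auto intro!: order_trans[OF abs_Re_le_cmod] exI[of _ "\<lambda>x. Re ((deriv ^^ Suc i) E (of_real x))"])
  qed
  from this[of 0 k] show ?thesis by simp
qed

text \<open>Cauchy's inequalities on discs of radius \<open>\<pi> / 8\<close>; such a disc stays within distance 1 of its centre.\<close>

lemma bounded_derivs_of_small_on_strip:
  assumes E: "E holomorphic_on {z. \<bar>Im z\<bar> < pi / 4}" and M: "0 \<le> M"
    and small: "\<And>z. Re z \<in> {a-1..b+1} \<Longrightarrow> \<bar>Im z\<bar> \<le> pi / 8 \<Longrightarrow> cmod (E z) \<le> M"
  shows "bounded_derivs k {a..b} (fact k * (8/pi) ^ k * M) (\<lambda>x. Re (E (of_real x)))"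
proof (rule bounded_derivs_Re_holomorphic[OF _ E])
  show "open {z. \<bar>Im z\<bar> < pi / 4}" by (intro open_Collect_less continuous_intros)
  show "range complex_of_real \<subseteq> {z. \<bar>Im z\<bar> < pi / 4}" by auto
  fix j x assume j: "j \<le> k" and x: "x \<in> {a..b}"
  have sub: "cball (of_real x) (pi / 8) \<subseteq> {z. Re z \<in> {a-1..b+1} \<and> \<bar>Im z\<bar> \<le> pi / 8}"
  proof
    fix z assume "z \<in> cball (complex_of_real x) (pi / 8)"
    then have z: "cmod (z - of_real x) \<le> pi / 8" by (simp add: dist_norm norm_minus_commute)
    have "pi / 8 \<le> 1" using pi_less_4 by simp
    then show "z \<in> {z. Re z \<in> {a-1..b+1} \<and> \<bar>Im z\<bar> \<le> pi / 8}"
      using z x abs_Re_le_cmod[of "z - of_real x"] abs_Im_le_cmod[of "z - of_real x"] by auto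
  qed
  have sub2: "cball (of_real x) (pi / 8) \<subseteq> {z. \<bar>Im z\<bar> < pi / 4}" 
  proof
    fix z assume "z \<in> cball (complex_of_real x) (pi / 8)"
    then have "\<bar>Im z\<bar> \<le> pi / 8" using sub by auto
    then show "z \<in> {z. \<bar>Im z\<bar> < pi / 4}" using pi_gt_zero by (simp; linarith)
  qed
  have "cmod ((deriv ^^ j) E (of_real x)) \<le> fact j * M / (pi / 8) ^ j"
  proof (rule Cauchy_inequality)
    show "E holomorphic_on ball (of_real x) (pi / 8)"
      by (rule holomorphic_on_subset[OF E]) (use sub2 ball_subset_cball in blast)
    show "continuous_on (cball (of_real x) (pi / 8)) E"
      by (rule holomorphic_on_imp_continuous_on[OF holomorphic_on_subset[OF E sub2]])
    fix z assume "cmod (complex_of_real x - z) = pi / 8"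
    then have "z \<in> cball (of_real x) (pi / 8)" by (simp add: dist_norm)
    then show "cmod (E z) \<le> M" using sub by (intro small) auto
  qed simp
  also have "\<dots> = fact j * (8/pi) ^ j * M" by (simp add: power_divide)
  also have "\<dots> \<le> fact k * (8/pi) ^ k * M"
  proof -
    have "1 \<le> 8 / pi" using pi_less_4 by (simp add: divide_simps)
    then have "(8/pi) ^ j \<le> (8/pi) ^ k" by (rule power_increasing[OF j])
    then show ?thesis using M j by (intro mult_mono) (auto intro: fact_mono)
  qed
  finally show "cmod ((deriv ^^ j) E (of_real x)) \<le> fact k * (8/pi) ^ k * M" .
qed

lemma derivative_eq_0_off_support:
  assumes "(G has_real_derivative D) (at x)" "\<And>x. x \<notin> {a..b} \<Longrightarrow> G x = 0" "x \<notin> {a..b}"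
  shows "D = 0"
proof -
  have "open (- {a..b})" by (simp add: open_Compl)
  then have "eventually (\<lambda>y. y \<in> - {a..b}) (nhds x)" using assms(3) by (intro eventually_nhds_in_open) auto
  then have "eventually (\<lambda>y. G y = 0) (nhds x)" by eventually_elim (use assms(2) in auto)
  then have "(G has_real_derivative 0) (at x)"
    using DERIV_cong_ev[of x x G "\<lambda>_. 0" 0 0] by simp
  then show ?thesis using assms(1) DERIV_unique by blast
qed

text \<open>Bounds on the interval suffice because the derivatives vanish off it, too.\<close>

lemma bounded_derivs_UNIV_of_support:
  assumes "0 \<le> M"
  shows "bounded_derivs k {a..b} M G \<Longrightarrow> (\<And>x. x \<notin> {a..b} \<Longrightarrow> G x = 0) \<Longrightarrow> bounded_derivs k UNIV M G"
proof (induction k arbitrary: G)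
  case 0
  then show ?case using assms by (metis abs_zero bounded_derivs.simps(1))
next
  case (Suc k)
  then obtain G' where G': "\<And>x. (G has_real_derivative G' x) (at x)" "bounded_derivs k {a..b} M G'" by auto
  have "G' x = 0" if "x \<notin> {a..b}" for x
    by (rule derivative_eq_0_off_support[OF G'(1) Suc.prems(2) that])
  then have "bounded_derivs k UNIV M G'" using Suc.IH G' by blast
  moreover have "\<bar>G x\<bar> \<le> M" for x using Suc.prems assms by (cases "x \<in> {a..b}") auto
  ultimately show ?case using G' by auto
qed

text \<open>Averaging over a window of length \<open>h\<close>, that is, taking a difference quotient of an antiderivative,
  raises the smoothness by one and widens the transition zone by \<open>h\<close>.  Starting from a trapezoid, \<open>k\<close> averagings
  are enough.  The values of the average are read off from the mean value theorem.\<close>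

lemma ex_smooth_cutoff:
  assumes "a < \<alpha>" "\<alpha> \<le> \<beta>" "\<beta> < b"
  shows "\<exists>\<omega> M. bounded_derivs k UNIV M \<omega> \<and> (\<forall>x\<in>{\<alpha>..\<beta>}. \<omega> x = 1) \<and> (\<forall>x. x \<notin> {a..b} \<longrightarrow> \<omega> x = 0)"
  using assms
proof (induction k arbitrary: a \<alpha> \<beta> b)
  case 0
  define \<omega> where "\<omega> = (\<lambda>x. max 0 (min 1 (min ((x - a) / (\<alpha> - a)) ((b - x) / (b - \<beta>)))))"
  have "continuous_on UNIV \<omega>" unfolding \<omega>_def using 0 by (intro continuous_intros) auto
  moreover have "\<bar>\<omega> x\<bar> \<le> 1" for x by (auto simp: \<omega>_def)
  moreover have "\<omega> x = 1" if "x \<in> {\<alpha>..\<beta>}" for x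
  proof -
    have "(x - a) / (\<alpha> - a) \<ge> 1" "(b - x) / (b - \<beta>) \<ge> 1" using 0 that by auto
    then show ?thesis by (auto simp: \<omega>_def)
  qed
  moreover have "\<omega> x = 0" if "x \<notin> {a..b}" for x
  proof (cases "x < a")
    case True
    then have "(x - a) / (\<alpha> - a) < 0" using 0 by (simp add: divide_neg_pos)
    then show ?thesis by (auto simp: \<omega>_def)
  next
    case False
    then have "(b - x) / (b - \<beta>) < 0" using 0 that by (simp add: divide_neg_pos)
    then show ?thesis by (auto simp: \<omega>_def)
  qed
  ultimately show ?case by (intro exI[of _ \<omega>] exI[of _ 1]) auto
next
  case (Suc k)
  \<comment> \<open>The induction hypothesis is used with the support shrunk and the plateau enlarged by the window.\<close>
  define h where "h = min (\<alpha> - a) (b - \<beta>) / 2"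
  have h: "h > 0" "a + h < \<alpha>" "\<beta> + h < b" using Suc.prems by (auto simp: h_def min_def field_simps)
  obtain \<omega> M where \<omega>: "bounded_derivs k UNIV M \<omega>" "\<And>x. x \<in> {\<alpha>..\<beta>+h} \<Longrightarrow> \<omega> x = 1" "\<And>x. x \<notin> {a+h..b} \<Longrightarrow> \<omega> x = 0"
    using Suc.IH[of "a + h" \<alpha> "\<beta> + h" b] h Suc.prems by auto
  obtain \<Phi> where "\<And>x. (\<Phi> has_vector_derivative \<omega> x) (at x)"
    using einterval_antiderivative[of "-\<infinity>" "\<infinity>" \<omega>] bounded_derivs_continuous[OF \<omega>(1)]
    by (auto simp: continuous_on_eq_continuous_at)
  then have \<Phi>: "(\<Phi> has_real_derivative \<omega> x) (at x)" for x
    by (simp add: has_real_derivative_iff_has_vector_derivative)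
  define \<psi> where "\<psi> = (\<lambda>x. (1 / h) * (\<Phi> (x + h) + (-1) * \<Phi> x))"
  have val: "\<exists>z. x < z \<and> z < x + h \<and> \<psi> x = \<omega> z" for x
  proof -
    obtain z where "x < z" "z < x + h" "\<Phi> (x + h) - \<Phi> x = (x + h - x) * \<omega> z"
      using MVT2[of x "x + h" \<Phi> \<omega>] \<Phi> h by auto
    then show ?thesis using h by (intro exI[of _ z]) (auto simp: \<psi>_def)
  qed
  have d: "(\<psi> has_real_derivative (1 / h) * (\<omega> (x + h) + (-1) * \<omega> x)) (at x)" for x
    unfolding \<psi>_def by (intro DERIV_cmult DERIV_add \<Phi> DERIV_shift[THEN iffD1])
  have bd: "bounded_derivs k UNIV (\<bar>1 / h\<bar> * (M + \<bar>-1\<bar> * M)) (\<lambda>x. (1 / h) * (\<omega> (x + h) + (-1) * \<omega> x))"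
    by (intro bounded_derivs_cmult bounded_derivs_add bounded_derivs_shift \<omega>(1))
  define N where "N = max M (\<bar>1 / h\<bar> * (M + \<bar>-1\<bar> * M))"
  have "\<bar>\<psi> x\<bar> \<le> N" for x using val[of x] bounded_derivs_bound[OF \<omega>(1)] by (auto simp: N_def le_max_iff_disj)
  moreover have "bounded_derivs k UNIV N (\<lambda>x. (1 / h) * (\<omega> (x + h) + (-1) * \<omega> x))"
    by (rule bounded_derivs_mono[OF bd]) (auto simp: N_def)
  ultimately have "bounded_derivs (Suc k) UNIV N \<psi>" using d by (intro bounded_derivs_SucI)
  moreover have "\<psi> x = 1" if "x \<in> {\<alpha>..\<beta>}" for x using val[of x] \<omega>(2) that by fastforce
  moreover have "\<psi> x = 0" if "x \<notin> {a..b}" for x using val[of x] \<omega>(3) that by fastforce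
  ultimately show ?case by blast
qed

text \<open>Integration by parts; there are no boundary terms since the function is continuous and vanishes off
  the interval.\<close>

lemma fourier_integral_decay:
  assumes ab: "a < b"
  shows "bounded_derivs k UNIV M G \<Longrightarrow> (\<And>x. x \<notin> {a..b} \<Longrightarrow> G x = 0) \<Longrightarrow>
    \<bar>\<xi>\<bar> ^ k * cmod (integral {a..b} (\<lambda>x. of_real (G x) * cis (- (x * \<xi>)))) \<le> (b - a) * M"
proof (induction k arbitrary: G)
  case 0
  have "cmod (integral {a..b} (\<lambda>x. of_real (G x) * cis (- (x * \<xi>)))) \<le> M * (b - a)"
    by (rule integral_bound) (use ab 0 in \<open>auto intro!: continuous_intros bounded_derivs_bound intro: continuous_on_subset simp: norm_mult\<close>)
  then show ?case by (simp add: mult.commute)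
next
  case (Suc k)
  then obtain G' where G': "\<And>x. (G has_real_derivative G' x) (at x)" "bounded_derivs k UNIV M G'" by auto
  have cont: "continuous_on UNIV G" using bounded_derivs_continuous[OF Suc.prems(1)] .
  have cl: "closed {x. G x = 0}" using closed_Collect_eq[OF cont continuous_on_const] .
  have "closure {..<a} \<subseteq> {x. G x = 0}" "closure {b<..} \<subseteq> {x. G x = 0}"
    using Suc.prems(2) by (intro closure_minimal cl; force)+
  then have Gab: "G a = 0" "G b = 0" by auto
  have off: "G' x = 0" if "x \<notin> {a..b}" for x
    by (rule derivative_eq_0_off_support[OF G'(1) Suc.prems(2) that])
  define J where "J = (\<lambda>G. integral {a..b} (\<lambda>x. of_real (G x) * cis (- (x * \<xi>))))"
  define c where "c = - (\<i> * of_real \<xi>)"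
  have cis: "cis (- (x * \<xi>)) = exp (c * of_real x)" for x
    by (simp add: cis_conv_exp c_def algebra_simps)
  have e: "((\<lambda>x. exp (c * of_real x)) has_vector_derivative c * exp (c * of_real x)) (at x within T)" for x T
    by (rule has_vector_derivative_at_within, rule has_vector_derivative_real_field) (auto intro!: derivative_eq_intros)
  have g: "((\<lambda>x. complex_of_real (G x)) has_vector_derivative of_real (G' x)) (at x within T)" for x T
    using G'(1) by (intro has_vector_derivative_of_real has_vector_derivative_at_within)
       (simp add: has_real_derivative_iff_has_vector_derivative)
  have "((\<lambda>x. of_real (G x) * (c * exp (c * of_real x)) + of_real (G' x) * exp (c * of_real x)) has_integral 
     of_real (G b) * exp (c * of_real b) - of_real (G a) * exp (c * of_real a)) {a..b}"
    by (rule fundamental_theorem_of_calculus) (use ab in \<open>auto intro!: has_vector_derivative_mult g e\<close>)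
  then have 0: "((\<lambda>x. of_real (G x) * (c * exp (c * of_real x)) + of_real (G' x) * exp (c * of_real x)) has_integral 0) {a..b}"
    using Gab by simp
  have 1: "((\<lambda>x. c * (of_real (G x) * exp (c * of_real x))) has_integral c * J G) {a..b}"
    unfolding J_def cis
    by (intro has_integral_mult_right integrable_integral integrable_continuous_real continuous_intros continuous_on_subset[OF cont]) auto
  have "((\<lambda>x. of_real (G' x) * exp (c * of_real x)) has_integral - (c * J G)) {a..b}"
    using has_integral_diff[OF 0 1] by (simp add: algebra_simps)
  then have "J G' = - (c * J G)" unfolding J_def cis by (rule integral_unique)
  then have "\<bar>\<xi>\<bar> ^ Suc k * cmod (J G) = \<bar>\<xi>\<bar> ^ k * cmod (J G')"
    by (simp add: norm_mult c_def)
  also have "\<dots> \<le> (b - a) * M" unfolding J_def by (rule Suc.IH[OF G'(2) off])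
  finally show ?case unfolding J_def .
qed

section \<open>Square-integrable functions and the Bessel inequality\<close>

text \<open>The squared \<open>L^2\<close> norm, with values in the extended reals so that no integrability has to be known
  before an estimate.\<close>

definition sq_integral :: "(real \<Rightarrow> 'a::real_normed_vector) \<Rightarrow> ennreal" where
  "sq_integral f = (\<integral>\<^sup>+ x. ennreal ((norm (f x))\<^sup>2) \<partial>lborel)"

lemma square_integrable_iff:
  fixes F :: "real \<Rightarrow> 'a::{real_normed_vector, second_countable_topology}"
  shows "square_integrable F \<longleftrightarrow> F \<in> borel_measurable borel \<and> sq_integral F < \<infinity>"
  unfolding square_integrable_def sq_integral_def
  by (auto simp: integrable_iff_bounded)

lemma square_integrable_measurable: "square_integrable F \<Longrightarrow> F \<in> borel_measurable borel"
  by (simp add: square_integrable_iff)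

lemma norm_add_power2_le: "(norm (x + y :: 'a::real_normed_vector))\<^sup>2 \<le> 2 * (norm x)\<^sup>2 + 2 * (norm y)\<^sup>2"
proof -
  have "(norm (x + y))\<^sup>2 \<le> (norm x + norm y)\<^sup>2" by (intro power_mono norm_triangle_ineq) simp
  also have "\<dots> \<le> 2 * (norm x)\<^sup>2 + 2 * (norm y)\<^sup>2"
    using zero_le_power2[of "norm x - norm y"] by (simp add: power2_eq_square algebra_simps)
  finally show ?thesis .
qed

lemma sq_integral_add_le:
  fixes f g :: "real \<Rightarrow> 'a::{real_normed_vector, second_countable_topology}"
  assumes [measurable]: "f \<in> borel_measurable borel" "g \<in> borel_measurable borel"
  shows "sq_integral (\<lambda>x. f x + g x) \<le> 2 * sq_integral f + 2 * sq_integral g"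
proof -
  have "sq_integral (\<lambda>x. f x + g x) \<le> (\<integral>\<^sup>+ x. 2 * ennreal ((norm (f x))\<^sup>2) + 2 * ennreal ((norm (g x))\<^sup>2) \<partial>lborel)"
    unfolding sq_integral_def
  proof (intro nn_integral_mono)
    fix x
    show "ennreal ((norm (f x + g x))\<^sup>2) \<le> 2 * ennreal ((norm (f x))\<^sup>2) + 2 * ennreal ((norm (g x))\<^sup>2)"
      using ennreal_leI[OF norm_add_power2_le[of "f x" "g x"]] by (simp add: ennreal_plus ennreal_mult)
  qed
  also have "\<dots> = 2 * sq_integral f + 2 * sq_integral g"
    unfolding sq_integral_def by (subst nn_integral_add) (auto simp: nn_integral_cmult)
  finally show ?thesis .
qed

lemma sq_integral_cmult_bound:
  fixes f :: "real \<Rightarrow> 'a::{real_normed_vector, second_countable_topology}"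
  assumes [measurable]: "f \<in> borel_measurable borel" and "\<And>x. norm (h x) \<le> c * norm (f x)" "0 \<le> c"
  shows "sq_integral h \<le> ennreal (c\<^sup>2) * sq_integral f"
proof -
  have "sq_integral h \<le> (\<integral>\<^sup>+ x. ennreal (c\<^sup>2) * ennreal ((norm (f x))\<^sup>2) \<partial>lborel)"
    unfolding sq_integral_def
  proof (intro nn_integral_mono)
    fix x show "ennreal ((norm (h x))\<^sup>2) \<le> ennreal (c\<^sup>2) * ennreal ((norm (f x))\<^sup>2)"
      using power_mono[OF assms(2)[of x], of 2] by (simp add: ennreal_mult[symmetric] power_mult_distrib ennreal_leI)
  qed
  then show ?thesis unfolding sq_integral_def by (simp add: nn_integral_cmult)
qed

lemma square_integrable_add:
  fixes f g :: "real \<Rightarrow> 'a::{real_normed_vector, second_countable_topology}"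
  assumes "square_integrable f" "square_integrable g"
  shows "square_integrable (\<lambda>x. f x + g x)"
proof -
  have [measurable]: "f \<in> borel_measurable borel" "g \<in> borel_measurable borel"
    using assms by (auto simp: square_integrable_iff)
  have "2 * sq_integral f + 2 * sq_integral g < \<infinity>"
    using assms by (auto simp: square_integrable_iff ennreal_mult_less_top)
  from le_less_trans[OF sq_integral_add_le this] show ?thesis
    by (simp add: square_integrable_iff)
qed

lemma square_integrable_bound:
  fixes f :: "real \<Rightarrow> 'a::{real_normed_vector, second_countable_topology}"
    and h :: "real \<Rightarrow> 'b::{real_normed_vector, second_countable_topology}"
  assumes "square_integrable f" "h \<in> borel_measurable borel" "\<And>x. norm (h x) \<le> c * norm (f x)" "0 \<le> c"
  shows "square_integrable h"
proof -
  have "sq_integral h \<le> ennreal (c\<^sup>2) * sq_integral f"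
    using assms by (intro sq_integral_cmult_bound) (auto simp: square_integrable_iff)
  also have "\<dots> < \<infinity>" using assms by (auto simp: square_integrable_iff ennreal_mult_less_top)
  finally show ?thesis using assms by (auto simp: square_integrable_iff)
qed

lemma cis_measurable [measurable]: "cis \<in> borel_measurable borel"
  by (intro borel_measurable_continuous_onI continuous_intros)

lemma cnj_measurable [measurable]: "cnj \<in> borel_measurable borel"
  by (intro borel_measurable_continuous_onI continuous_intros)

text \<open>The transform of an integrable function without the normalising factor \<open>1 / sqrt (2 \<pi>)\<close>, which makes it
  multiplicative for convolutions.\<close>

definition fourier_integral :: "(real \<Rightarrow> real) \<Rightarrow> real \<Rightarrow> complex" where
  "fourier_integral h \<xi> = (\<integral>x. of_real (h x) * cis (- (x * \<xi>)) \<partial>lborel)"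

lemma fourier_integral_measurable [measurable]:
  assumes [measurable]: "h \<in> borel_measurable borel"
  shows "fourier_integral h \<in> borel_measurable borel"
  unfolding fourier_integral_def by measurable

lemma integrable_times_cis:
  assumes "integrable lborel (h :: real \<Rightarrow> real)"
  shows "integrable lborel (\<lambda>x. of_real (h x) * cis (c * x))" "integrable lborel (\<lambda>x. of_real (h x) * cis (- (x * \<xi>)))"
proof -
  have [measurable]: "h \<in> borel_measurable borel" using assms by auto
  show "integrable lborel (\<lambda>x. of_real (h x) * cis (c * x))" "integrable lborel (\<lambda>x. of_real (h x) * cis (- (x * \<xi>)))"
    by (rule Bochner_Integration.integrable_bound[OF assms]; simp add: norm_mult)+
qed

lemma truncated_fourier_eq:
  "truncated_fourier F n \<xi> = of_real (1 / sqrt (2 * pi)) * fourier_integral (\<lambda>x. indicator {- real n..real n} x * F x) \<xi>"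
  unfolding truncated_fourier_def fourier_integral_def set_lebesgue_integral_def
  by (simp add: scaleR_conv_of_real mult.assoc)

lemma truncated_fourier_measurable [measurable]:
  assumes [measurable]: "F \<in> borel_measurable borel"
  shows "truncated_fourier F n \<in> borel_measurable borel"
  unfolding truncated_fourier_eq by measurable

lemma norm_fourier_integral_le:
  assumes "integrable lborel h"
  shows "cmod (fourier_integral h \<xi>) \<le> (\<integral>x. \<bar>h x\<bar> \<partial>lborel)"
  unfolding fourier_integral_def
  by (rule order_trans[OF integral_norm_bound]) (simp add: norm_mult)

lemma ennreal_norm_integral_le:
  fixes f :: "'b \<Rightarrow> 'a::{banach, second_countable_topology}"
  shows "ennreal (norm (\<integral>x. f x \<partial>M)) \<le> (\<integral>\<^sup>+ x. ennreal (norm (f x)) \<partial>M)"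
  by (cases "integrable M f") (auto intro: integral_norm_bound_ennreal simp: not_integrable_integral_eq)

text \<open>Domination by a product justifies the exchanges of a space integral with a frequency integral.\<close>

lemma integrable_pair_of_product_bound:
  fixes u :: "real \<times> real \<Rightarrow> 'a::{banach, second_countable_topology}"
  assumes f: "integrable lborel f" and g: "integrable lborel (g :: real \<Rightarrow> real)"
    and [measurable]: "u \<in> borel_measurable (lborel \<Otimes>\<^sub>M lborel)" and le: "\<And>x y. norm (u (x, y)) \<le> f x * g y"
  shows "integrable (lborel \<Otimes>\<^sub>M lborel) u"
proof (rule Bochner_Integration.integrable_bound)
  have [measurable]: "f \<in> borel_measurable borel" "g \<in> borel_measurable borel" using f g by auto
  show "integrable (lborel \<Otimes>\<^sub>M lborel) (\<lambda>(x, y). f x * g y)"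
    by (rule lborel_pair.Fubini_integrable) 
       (use f g in \<open>auto simp: abs_mult intro!: integrable_mult_right integrable_mult_left\<close>)
  show "AE p in lborel \<Otimes>\<^sub>M lborel. norm (u p) \<le> norm (case p of (x, y) \<Rightarrow> f x * g y)"
    using le by (auto intro!: AE_I2 order_trans[OF le])
qed (fact assms(3))

text \<open>Rescaling of the characteristic function of the standard normal distribution.\<close>

lemma fourier_integral_normal_density:
  assumes "n > 0"
  shows "(\<integral>\<xi>. of_real (normal_density 0 n \<xi>) * cis (z * \<xi>) \<partial>lborel) = of_real (exp (- (n * z)\<^sup>2 / 2))"
proof -
  have "(\<integral>\<xi>. of_real (normal_density 0 n \<xi>) * cis (z * \<xi>) \<partial>lborel)
    = \<bar>n\<bar> *\<^sub>R (\<integral>x. of_real (normal_density 0 n (0 + n * x)) * cis (z * (0 + n * x)) \<partial>lborel)"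
    by (rule lborel_integral_real_affine) (use assms in auto)
  also have "\<dots> = (\<integral>x. of_real (std_normal_density x) * cis (n * z * x) \<partial>lborel)"
  proof -
    have "n * normal_density 0 n (n * x) = std_normal_density x" for x
      using assms by (simp add: normal_density_def real_sqrt_mult power_mult_distrib)
    moreover have "\<bar>n\<bar> *\<^sub>R (of_real (normal_density 0 n (0 + n * x)) * cis (z * (0 + n * x)))
        = of_real (n * normal_density 0 n (n * x)) * cis (n * z * x)" for x
    proof -
      have "z * (0 + n * x) = n * z * x" by simp
      then show ?thesis using assms by (simp only: scaleR_conv_of_real of_real_mult mult.assoc abs_of_pos add_0)
    qed
    ultimately have "\<bar>n\<bar> *\<^sub>R (of_real (normal_density 0 n (0 + n * x)) * cis (z * (0 + n * x)))
        = of_real (std_normal_density x) * cis (n * z * x)" for x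
      by simp
    then show ?thesis by (simp only: integral_scaleR_right[symmetric])
  qed
  also have "\<dots> = char std_normal_distribution (n * z)"
    unfolding char_def by (subst integral_density) (auto simp: cis_conv_exp scaleR_conv_of_real)
  finally show ?thesis by (simp add: char_std_normal_distribution)
qed

lemma nn_integral_exp_convolution:
  assumes "n > 0"
  shows "(\<integral>\<^sup>+ y. ennreal (exp (- (n * (x - y))\<^sup>2 / 2)) \<partial>lborel) = ennreal (sqrt (2 * pi) / n)"
    "(\<integral>\<^sup>+ y. ennreal (exp (- (n * (y - x))\<^sup>2 / 2)) \<partial>lborel) = ennreal (sqrt (2 * pi) / n)"
proof -
  have eq: "exp (- (n * (y - x))\<^sup>2 / 2) = sqrt (2 * pi) / n * normal_density x (1 / n) y" for y
    using assms by (simp add: normal_density_def real_sqrt_divide real_sqrt_mult power_mult_distrib power_divide mult.commute)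
  have "(\<integral>\<^sup>+ y. ennreal (normal_density x (1 / n) y) \<partial>lborel) = 1"
    using assms by (subst nn_integral_eq_integral) auto
  then show *: "(\<integral>\<^sup>+ y. ennreal (exp (- (n * (y - x))\<^sup>2 / 2)) \<partial>lborel) = ennreal (sqrt (2 * pi) / n)"
  proof -
    have "(\<integral>\<^sup>+ y. ennreal (sqrt (2 * pi) / n * normal_density x (1 / n) y) \<partial>lborel)
       = ennreal (sqrt (2 * pi) / n) * (\<integral>\<^sup>+ y. ennreal (normal_density x (1 / n) y) \<partial>lborel)"
      using assms by (subst nn_integral_cmult[symmetric]) (auto simp: ennreal_mult[symmetric])
    then show ?thesis unfolding eq \<open>(\<integral>\<^sup>+ y. ennreal (normal_density x (1 / n) y) \<partial>lborel) = 1\<close> by simp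
  qed
  have "(n * (x - y))\<^sup>2 = (n * (y - x))\<^sup>2" for y by (simp add: power_mult_distrib power2_commute)
  then show "(\<integral>\<^sup>+ y. ennreal (exp (- (n * (x - y))\<^sup>2 / 2)) \<partial>lborel) = ennreal (sqrt (2 * pi) / n)" using * by simp
qed

text \<open>Writing \<open>|A|^2\<close> as \<open>A\<close> times its conjugate and exchanging integrals twice turns the Gaussian weight on
  the frequency side into a Gaussian kernel on the space side.\<close>

lemma weighted_fourier_integral_eq:
  assumes h: "integrable lborel h" and n: "n > 0"
  shows "(\<integral>\<xi>. of_real (normal_density 0 n \<xi>) * (fourier_integral h \<xi> * cnj (fourier_integral h \<xi>)) \<partial>lborel)
    = (\<integral>x. of_real (h x) * (\<integral>y. of_real (h y) * of_real (exp (- (n * (x - y))\<^sup>2 / 2)) \<partial>lborel) \<partial>lborel)"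
proof -
  have [measurable]: "h \<in> borel_measurable borel" using h by auto
  define A where "A = fourier_integral h"
  have A [measurable]: "A \<in> borel_measurable borel" unfolding A_def by measurable
  define B where "B = (\<integral>x. \<bar>h x\<bar> \<partial>lborel)"
  have AB: "cmod (A \<xi>) \<le> B" for \<xi> unfolding A_def B_def by (rule norm_fourier_integral_le[OF h])
  have B0: "0 \<le> B" unfolding B_def by simp
  have cnjA: "cnj (A \<xi>) = (\<integral>y. of_real (h y) * cis (y * \<xi>) \<partial>lborel)" for \<xi>
    unfolding A_def fourier_integral_def
    using Bochner_Integration.integral_cnj[of lborel "\<lambda>x. of_real (h x) * cis (- (x * \<xi>))"] by (simp add: cis_cnj)
  have "(\<integral>\<xi>. of_real (normal_density 0 n \<xi>) * (A \<xi> * cnj (A \<xi>)) \<partial>lborel)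
    = (\<integral>\<xi>. \<integral>x. of_real (normal_density 0 n \<xi>) * cnj (A \<xi>) * (of_real (h x) * cis (- (x * \<xi>))) \<partial>lborel \<partial>lborel)"
    by (subst integral_mult_right_zero) (simp add: A_def fourier_integral_def mult_ac)
  also have "\<dots> = (\<integral>x. \<integral>\<xi>. of_real (normal_density 0 n \<xi>) * cnj (A \<xi>) * (of_real (h x) * cis (- (x * \<xi>))) \<partial>lborel \<partial>lborel)"
  proof (rule lborel_pair.Fubini_integral)
    show "integrable (lborel \<Otimes>\<^sub>M lborel) (\<lambda>(x, \<xi>). of_real (normal_density 0 n \<xi>) * cnj (A \<xi>) * (of_real (h x) * cis (- (x * \<xi>))))"
    proof (rule integrable_pair_of_product_bound[of "\<lambda>x. \<bar>h x\<bar>" "\<lambda>\<xi>. B * normal_density 0 n \<xi>"])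
      fix x \<xi>
      have "normal_density 0 n \<xi> * cmod (A \<xi>) * \<bar>h x\<bar> \<le> normal_density 0 n \<xi> * B * \<bar>h x\<bar>"
        by (intro mult_right_mono mult_left_mono AB) auto
      then show "norm (case (x, \<xi>) of (x, \<xi>) \<Rightarrow> of_real (normal_density 0 n \<xi>) * cnj (A \<xi>) * (of_real (h x) * cis (- (x * \<xi>)))) \<le> \<bar>h x\<bar> * (B * normal_density 0 n \<xi>)"
        by (simp add: norm_mult mult_ac)
    qed (use h n in auto)
  qed
  also have "\<dots> = (\<integral>x. of_real (h x) * (\<integral>\<xi>. of_real (normal_density 0 n \<xi>) * cnj (A \<xi>) * cis (- (x * \<xi>)) \<partial>lborel) \<partial>lborel)"
    by (subst integral_mult_right_zero[symmetric]) (simp add: mult_ac)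
  also have "\<dots> = (\<integral>x. of_real (h x) * (\<integral>y. of_real (h y) * of_real (exp (- (n * (x - y))\<^sup>2 / 2)) \<partial>lborel) \<partial>lborel)"
  proof -
    have "(\<integral>\<xi>. of_real (normal_density 0 n \<xi>) * cnj (A \<xi>) * cis (- (x * \<xi>)) \<partial>lborel)
       = (\<integral>y. of_real (h y) * of_real (exp (- (n * (x - y))\<^sup>2 / 2)) \<partial>lborel)" for x
    proof -
      have "(\<integral>\<xi>. of_real (normal_density 0 n \<xi>) * cnj (A \<xi>) * cis (- (x * \<xi>)) \<partial>lborel)
         = (\<integral>\<xi>. \<integral>y. of_real (normal_density 0 n \<xi>) * cis (- (x * \<xi>)) * (of_real (h y) * cis (y * \<xi>)) \<partial>lborel \<partial>lborel)"
        by (subst integral_mult_right_zero) (simp add: cnjA mult_ac)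
      also have "\<dots> = (\<integral>y. \<integral>\<xi>. of_real (normal_density 0 n \<xi>) * cis (- (x * \<xi>)) * (of_real (h y) * cis (y * \<xi>)) \<partial>lborel \<partial>lborel)"
      proof (rule lborel_pair.Fubini_integral)
        show "integrable (lborel \<Otimes>\<^sub>M lborel) (\<lambda>(y, \<xi>). of_real (normal_density 0 n \<xi>) * cis (- (x * \<xi>)) * (of_real (h y) * cis (y * \<xi>)))"
          by (rule integrable_pair_of_product_bound[of "\<lambda>x. \<bar>h x\<bar>" "normal_density 0 n"])
            (use h n in \<open>auto simp: norm_mult\<close>)
      qed
      also have "\<dots> = (\<integral>y. of_real (h y) * (\<integral>\<xi>. of_real (normal_density 0 n \<xi>) * cis ((y - x) * \<xi>) \<partial>lborel) \<partial>lborel)"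
      proof -
        have "of_real (normal_density 0 n \<xi>) * cis (- (x * \<xi>)) * (of_real (h y) * cis (y * \<xi>))
          = of_real (h y) * (of_real (normal_density 0 n \<xi>) * cis ((y - x) * \<xi>))" for y \<xi>
        proof -
          have "cis ((y - x) * \<xi>) = cis (- (x * \<xi>)) * cis (y * \<xi>)" by (simp add: cis_mult algebra_simps)
          then show ?thesis by (simp only: mult_ac)
        qed
        then show ?thesis by (simp only: integral_mult_right_zero)
      qed
      also have "\<dots> = (\<integral>y. of_real (h y) * of_real (exp (- (n * (x - y))\<^sup>2 / 2)) \<partial>lborel)"
        unfolding fourier_integral_normal_density[OF n] 
        by (simp add: power_mult_distrib power2_commute)
      finally show ?thesis .
    qed
    then show ?thesis by simp
  qed
  finally show ?thesis by (simp add: A_def)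
qed

text \<open>By \<open>weighted_fourier_integral_eq\<close> and \<open>|h x h y| \<le> (h x)^2 / 2 + (h y)^2 / 2\<close> the Gaussian-weighted
  square integral of the transform is at most \<open>2 \<pi>\<close> times that of \<open>h\<close>, whatever the width of the weight.
  Letting the weight tend to 1, Fatou's lemma gives the claim.\<close>

lemma bessel_inequality:
  assumes h: "integrable lborel h"
  shows "sq_integral (fourier_integral h) \<le> ennreal (2 * pi) * sq_integral h"
proof -
  have [measurable]: "h \<in> borel_measurable borel" using h by auto
  define A where "A = fourier_integral h"
  have A [measurable]: "A \<in> borel_measurable borel" unfolding A_def by measurable
  define B where "B = (\<integral>x. \<bar>h x\<bar> \<partial>lborel)"
  have AB: "cmod (A \<xi>) \<le> B" for \<xi> unfolding A_def B_def by (rule norm_fourier_integral_le[OF h])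
  have B0: "0 \<le> B" unfolding B_def by simp
  have AB2: "(cmod (A \<xi>))\<^sup>2 \<le> B\<^sup>2" for \<xi> using AB B0 by (simp add: power_mono)
  have norm_bound: "(\<integral>\<^sup>+ \<xi>. ennreal (normal_density 0 n \<xi> * (cmod (A \<xi>))\<^sup>2) \<partial>lborel) \<le> ennreal (sqrt (2 * pi) / n) * sq_integral h"
    if n: "n > 0" for n
  proof -
    define K where "K = (\<lambda>x y. exp (- (n * (x - y))\<^sup>2 / 2))"
    have inner1: "(\<integral>\<^sup>+y. ennreal (a / 2 * K x y) \<partial>lborel) = ennreal (a / 2) * ennreal (sqrt (2 * pi) / n)" 
      and inner2: "(\<integral>\<^sup>+y. ennreal (a / 2 * K y x) \<partial>lborel) = ennreal (a / 2) * ennreal (sqrt (2 * pi) / n)"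
      if a: "0 \<le> a" for x a
    proof -
      have "ennreal (a / 2 * exp z) = ennreal (a / 2) * ennreal (exp z)" for z
        using a by (intro ennreal_mult) auto
      then have *: "ennreal (a / 2 * K x y) = ennreal (a / 2) * ennreal (K x y)" for x y unfolding K_def .
      have [measurable]: "K x \<in> borel_measurable borel" "(\<lambda>y. K y x) \<in> borel_measurable borel"
        unfolding K_def by measurable
      have "(\<integral>\<^sup>+y. ennreal (K x y) \<partial>lborel) = ennreal (sqrt (2 * pi) / n)" "(\<integral>\<^sup>+y. ennreal (K y x) \<partial>lborel) = ennreal (sqrt (2 * pi) / n)"
        unfolding K_def by (rule nn_integral_exp_convolution[OF n])+
      then show "(\<integral>\<^sup>+y. ennreal (a / 2 * K x y) \<partial>lborel) = ennreal (a / 2) * ennreal (sqrt (2 * pi) / n)" 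
        "(\<integral>\<^sup>+y. ennreal (a / 2 * K y x) \<partial>lborel) = ennreal (a / 2) * ennreal (sqrt (2 * pi) / n)"
        unfolding * by (subst nn_integral_cmult; simp)+
    qed
    have int: "integrable lborel (\<lambda>\<xi>. normal_density 0 n \<xi> * (cmod (A \<xi>))\<^sup>2)"
      by (rule Bochner_Integration.integrable_bound[of _ "\<lambda>\<xi>. B\<^sup>2 * normal_density 0 n \<xi>"])
        (use n AB2 in \<open>auto simp: abs_mult mult.commute intro!: AE_I2 mult_left_mono\<close>)
    have c: "of_real (normal_density 0 n \<xi> * (cmod (A \<xi>))\<^sup>2) = of_real (normal_density 0 n \<xi>) * (A \<xi> * cnj (A \<xi>))" for \<xi>
      by (simp only: of_real_mult complex_norm_square)
    have "(\<integral>\<^sup>+ \<xi>. ennreal (normal_density 0 n \<xi> * (cmod (A \<xi>))\<^sup>2) \<partial>lborel) = ennreal (\<integral> \<xi>. normal_density 0 n \<xi> * (cmod (A \<xi>))\<^sup>2 \<partial>lborel)"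
      by (rule nn_integral_eq_integral[OF int]) auto
    also have "(\<integral> \<xi>. normal_density 0 n \<xi> * (cmod (A \<xi>))\<^sup>2 \<partial>lborel) = cmod (complex_of_real (\<integral> \<xi>. normal_density 0 n \<xi> * (cmod (A \<xi>))\<^sup>2 \<partial>lborel))"
      by (simp add: norm_of_real integral_nonneg_AE)
    also have "complex_of_real (\<integral> \<xi>. normal_density 0 n \<xi> * (cmod (A \<xi>))\<^sup>2 \<partial>lborel)
       = (\<integral>x. complex_of_real (h x) * (\<integral>y. of_real (h y) * of_real (K x y) \<partial>lborel) \<partial>lborel)"
      by (simp only: integral_complex_of_real[symmetric] c weighted_fourier_integral_eq[OF h n, folded A_def] K_def)
    also have "ennreal (cmod \<dots>) \<le> (\<integral>\<^sup>+x. \<integral>\<^sup>+y. ennreal (\<bar>h x\<bar> * \<bar>h y\<bar> * K x y) \<partial>lborel \<partial>lborel)"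
    proof (rule order_trans[OF ennreal_norm_integral_le])
      have "ennreal (cmod (of_real (h x) * (\<integral>y. of_real (h y) * of_real (K x y) \<partial>lborel))) \<le> (\<integral>\<^sup>+y. ennreal (\<bar>h x\<bar> * \<bar>h y\<bar> * K x y) \<partial>lborel)" for x
      proof -
        have "ennreal (cmod (of_real (h x) * (\<integral>y. of_real (h y) * of_real (K x y) \<partial>lborel)))
           = ennreal \<bar>h x\<bar> * ennreal (cmod (\<integral>y. of_real (h y) * of_real (K x y) \<partial>lborel))"
          by (simp add: norm_mult ennreal_mult)
        also have "\<dots> \<le> ennreal \<bar>h x\<bar> * (\<integral>\<^sup>+y. ennreal (cmod (of_real (h y) * of_real (K x y))) \<partial>lborel)"
          by (intro mult_left_mono ennreal_norm_integral_le) auto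
        also have "\<dots> = (\<integral>\<^sup>+y. ennreal (\<bar>h x\<bar> * \<bar>h y\<bar> * K x y) \<partial>lborel)"
          by (subst nn_integral_cmult[symmetric]) (auto simp: norm_mult K_def ennreal_mult[symmetric] mult.assoc)
        finally show ?thesis .
      qed
      then show "(\<integral>\<^sup>+x. ennreal (cmod (of_real (h x) * (\<integral>y. of_real (h y) * of_real (K x y) \<partial>lborel))) \<partial>lborel) \<le> (\<integral>\<^sup>+x. \<integral>\<^sup>+y. ennreal (\<bar>h x\<bar> * \<bar>h y\<bar> * K x y) \<partial>lborel \<partial>lborel)"
        by (intro nn_integral_mono)
    qed
    also have "\<dots> \<le> (\<integral>\<^sup>+x. \<integral>\<^sup>+y. ennreal ((h x)\<^sup>2 / 2 * K x y) + ennreal ((h y)\<^sup>2 / 2 * K x y) \<partial>lborel \<partial>lborel)"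
    proof (intro nn_integral_mono)
      fix x y
      have "\<bar>h x\<bar> * \<bar>h y\<bar> \<le> (h x)\<^sup>2 / 2 + (h y)\<^sup>2 / 2"
        using zero_le_power2[of "\<bar>h x\<bar> - \<bar>h y\<bar>"] by (simp add: power2_eq_square algebra_simps)
      then have "\<bar>h x\<bar> * \<bar>h y\<bar> * K x y \<le> (h x)\<^sup>2 / 2 * K x y + (h y)\<^sup>2 / 2 * K x y"
        using mult_right_mono[of _ _ "K x y"] by (fastforce simp: K_def distrib_right)
      then show "ennreal (\<bar>h x\<bar> * \<bar>h y\<bar> * K x y) \<le> ennreal ((h x)\<^sup>2 / 2 * K x y) + ennreal ((h y)\<^sup>2 / 2 * K x y)"
        by (simp add: ennreal_plus[symmetric] K_def ennreal_leI del: ennreal_plus)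
    qed
    also have "\<dots> = (\<integral>\<^sup>+x. \<integral>\<^sup>+y. ennreal ((h x)\<^sup>2 / 2 * K x y) \<partial>lborel \<partial>lborel) + (\<integral>\<^sup>+x. \<integral>\<^sup>+y. ennreal ((h y)\<^sup>2 / 2 * K x y) \<partial>lborel \<partial>lborel)"
      by (subst nn_integral_add[symmetric]; (subst nn_integral_add)?; simp add: K_def)
    also have "(\<integral>\<^sup>+x. \<integral>\<^sup>+y. ennreal ((h y)\<^sup>2 / 2 * K x y) \<partial>lborel \<partial>lborel) = (\<integral>\<^sup>+y. \<integral>\<^sup>+x. ennreal ((h y)\<^sup>2 / 2 * K x y) \<partial>lborel \<partial>lborel)"
      by (rule lborel_pair.Fubini') (simp add: K_def)
    also have "(\<integral>\<^sup>+x. \<integral>\<^sup>+y. ennreal ((h x)\<^sup>2 / 2 * K x y) \<partial>lborel \<partial>lborel) = (\<integral>\<^sup>+x. ennreal ((h x)\<^sup>2 / 2) * ennreal (sqrt (2 * pi) / n) \<partial>lborel)"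
      by (simp only: inner1 zero_le_power2)
    also have "(\<integral>\<^sup>+y. \<integral>\<^sup>+x. ennreal ((h y)\<^sup>2 / 2 * K x y) \<partial>lborel \<partial>lborel) = (\<integral>\<^sup>+x. ennreal ((h x)\<^sup>2 / 2) * ennreal (sqrt (2 * pi) / n) \<partial>lborel)"
      by (simp only: inner2 zero_le_power2)
    also have "(\<integral>\<^sup>+x. ennreal ((h x)\<^sup>2 / 2) * ennreal (sqrt (2 * pi) / n) \<partial>lborel) + (\<integral>\<^sup>+x. ennreal ((h x)\<^sup>2 / 2) * ennreal (sqrt (2 * pi) / n) \<partial>lborel)
       = (\<integral>\<^sup>+x. ennreal (sqrt (2 * pi) / n) * ennreal ((h x)\<^sup>2) \<partial>lborel)"
      by (subst nn_integral_add[symmetric]) (use n in \<open>auto simp: ennreal_mult[symmetric] ennreal_plus[symmetric] simp del: ennreal_plus intro!: nn_integral_cong\<close>)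
    also have "\<dots> = ennreal (sqrt (2 * pi) / n) * sq_integral h"
      unfolding sq_integral_def by (subst nn_integral_cmult) auto
    finally show ?thesis .
  qed
  have bound: "(\<integral>\<^sup>+ \<xi>. ennreal (exp (- (\<xi>\<^sup>2 / (2 * (real (Suc n))\<^sup>2))) * (cmod (A \<xi>))\<^sup>2) \<partial>lborel) \<le> ennreal (2 * pi) * sq_integral h" for n
  proof -
    define N where "N = real (Suc n)"
    have N: "N > 0" by (simp add: N_def)
    have eq: "exp (- (\<xi>\<^sup>2 / (2 * N\<^sup>2))) = sqrt (2 * pi) * N * normal_density 0 N \<xi>" for \<xi>
      using N by (simp add: normal_density_def real_sqrt_mult)
    have "(\<integral>\<^sup>+ \<xi>. ennreal (exp (- (\<xi>\<^sup>2 / (2 * N\<^sup>2))) * (cmod (A \<xi>))\<^sup>2) \<partial>lborel)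
       = ennreal (sqrt (2 * pi) * N) * (\<integral>\<^sup>+ \<xi>. ennreal (normal_density 0 N \<xi> * (cmod (A \<xi>))\<^sup>2) \<partial>lborel)"
      unfolding eq using N by (subst nn_integral_cmult[symmetric]) (auto simp: ennreal_mult[symmetric] mult.assoc)
    also have "\<dots> \<le> ennreal (sqrt (2 * pi) * N) * (ennreal (sqrt (2 * pi) / N) * sq_integral h)"
      by (intro mult_left_mono norm_bound N) auto
    also have "\<dots> = ennreal (2 * pi) * sq_integral h"
      using N by (simp add: mult.assoc[symmetric] ennreal_mult[symmetric])
    finally show ?thesis by (simp add: N_def)
  qed
  have lim: "(\<lambda>n. ennreal (exp (- (\<xi>\<^sup>2 / (2 * (real (Suc n))\<^sup>2))) * (cmod (A \<xi>))\<^sup>2)) \<longlonglongrightarrow> ennreal ((cmod (A \<xi>))\<^sup>2)" for \<xi>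
  proof (rule tendsto_ennrealI)
    have "filterlim (\<lambda>n. 2 * (real (Suc n))\<^sup>2) at_top sequentially" by real_asymp
    then have "(\<lambda>n. \<xi>\<^sup>2 / (2 * (real (Suc n))\<^sup>2)) \<longlonglongrightarrow> 0"
      by (rule real_tendsto_divide_at_top[OF tendsto_const])
    then have "(\<lambda>n. exp (- (\<xi>\<^sup>2 / (2 * (real (Suc n))\<^sup>2))) * (cmod (A \<xi>))\<^sup>2) \<longlonglongrightarrow> exp (- 0) * (cmod (A \<xi>))\<^sup>2"
      by (intro tendsto_intros)
    then show "(\<lambda>n. exp (- (\<xi>\<^sup>2 / (2 * (real (Suc n))\<^sup>2))) * (cmod (A \<xi>))\<^sup>2) \<longlonglongrightarrow> (cmod (A \<xi>))\<^sup>2" by simp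
  qed
  have "sq_integral A = (\<integral>\<^sup>+ \<xi>. liminf (\<lambda>n. ennreal (exp (- (\<xi>\<^sup>2 / (2 * (real (Suc n))\<^sup>2))) * (cmod (A \<xi>))\<^sup>2)) \<partial>lborel)"
    unfolding sq_integral_def using lim by (intro nn_integral_cong lim_imp_Liminf[symmetric]) auto
  also have "\<dots> \<le> liminf (\<lambda>n. \<integral>\<^sup>+ \<xi>. ennreal (exp (- (\<xi>\<^sup>2 / (2 * (real (Suc n))\<^sup>2))) * (cmod (A \<xi>))\<^sup>2) \<partial>lborel)"
    by (rule nn_integral_liminf) auto
  also have "\<dots> \<le> ennreal (2 * pi) * sq_integral h"
    using bound by (intro Liminf_le) (auto intro!: always_eventually)
  finally show ?thesis by (simp add: A_def)
qed

section \<open>The Fourier-Plancherel transform as a limit in the mean\<close>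

lemma square_integrable_imp_truncation_integrable:
  assumes "square_integrable (F :: real \<Rightarrow> real)"
  shows "integrable lborel (\<lambda>x. indicator {a..b} x * F x)"
proof (rule Bochner_Integration.integrable_bound)
  have [measurable]: "F \<in> borel_measurable borel" using assms by (simp add: square_integrable_iff)
  have "integrable lborel (\<lambda>x. (norm (F x))\<^sup>2)" using assms by (simp add: square_integrable_def)
  then show "integrable lborel (\<lambda>x. indicator {a..b} x + (norm (F x))\<^sup>2)"
    by (intro Bochner_Integration.integrable_add) (auto simp: integrable_indicator_iff emeasure_lborel_Icc_eq)
  show "(\<lambda>x. indicator {a..b} x * F x) \<in> borel_measurable lborel" by measurable
  have "\<bar>F x\<bar> \<le> 1 + (F x)\<^sup>2" for x
    using zero_le_power2[of "\<bar>F x\<bar> - 1"] by (simp add: power2_eq_square algebra_simps) 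
  then show "AE x in lborel. norm (indicator {a..b} x * F x) \<le> norm (indicator {a..b} x + (norm (F x))\<^sup>2)"
    by (auto simp: indicator_def intro!: AE_I2)
qed

lemma is_fourier_transform_altdef:
  "is_fourier_transform F g \<longleftrightarrow> square_integrable F \<and> square_integrable g \<and>
     (\<lambda>n. sq_integral (\<lambda>\<xi>. g \<xi> - truncated_fourier F n \<xi>)) \<longlonglongrightarrow> 0"
  by (simp add: is_fourier_transform_def sq_integral_def)

lemma is_fourier_transform_measurable:
  assumes "is_fourier_transform F g"
  shows "F \<in> borel_measurable borel" "g \<in> borel_measurable borel"
  using assms by (auto simp: is_fourier_transform_def square_integrable_iff)

text \<open>Transforms are only fixed up to null sets, so this is what allows computing Sobolev norms from any
  concrete transform (\<open>sobolev_line_of_transform\<close>).\<close>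

lemma is_fourier_transform_unique:
  assumes g: "is_fourier_transform F g" and h: "is_fourier_transform F h"
  shows "AE \<xi> in lborel. g \<xi> = h \<xi>"
proof -
  note [measurable] = is_fourier_transform_measurable[OF g] is_fourier_transform_measurable[OF h]
  have "sq_integral (\<lambda>\<xi>. g \<xi> - h \<xi>) \<le> 0"
  proof (rule LIMSEQ_le_const)
    have "(\<lambda>n. 2 * sq_integral (\<lambda>\<xi>. g \<xi> - truncated_fourier F n \<xi>) + 2 * sq_integral (\<lambda>\<xi>. h \<xi> - truncated_fourier F n \<xi>)) \<longlonglongrightarrow> 2 * 0 + 2 * 0"
      using g h by (intro tendsto_add ennreal_tendsto_cmult) (auto simp: is_fourier_transform_altdef)
    then show "(\<lambda>n. 2 * sq_integral (\<lambda>\<xi>. g \<xi> - truncated_fourier F n \<xi>) + 2 * sq_integral (\<lambda>\<xi>. h \<xi> - truncated_fourier F n \<xi>)) \<longlonglongrightarrow> 0"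
      by simp
    have "sq_integral (\<lambda>\<xi>. g \<xi> - h \<xi>) \<le> 2 * sq_integral (\<lambda>\<xi>. g \<xi> - truncated_fourier F n \<xi>) + 2 * sq_integral (\<lambda>\<xi>. h \<xi> - truncated_fourier F n \<xi>)" for n
    proof -
      have "sq_integral (\<lambda>\<xi>. (g \<xi> - truncated_fourier F n \<xi>) + (truncated_fourier F n \<xi> - h \<xi>))
         \<le> 2 * sq_integral (\<lambda>\<xi>. g \<xi> - truncated_fourier F n \<xi>) + 2 * sq_integral (\<lambda>\<xi>. truncated_fourier F n \<xi> - h \<xi>)"
        by (rule sq_integral_add_le) measurable
      then show ?thesis by (simp add: sq_integral_def norm_minus_commute)
    qed
    then show "\<exists>N. \<forall>n\<ge>N. sq_integral (\<lambda>\<xi>. g \<xi> - h \<xi>) \<le> 2 * sq_integral (\<lambda>\<xi>. g \<xi> - truncated_fourier F n \<xi>) + 2 * sq_integral (\<lambda>\<xi>. h \<xi> - truncated_fourier F n \<xi>)"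
      by blast
  qed
  then have "(\<integral>\<^sup>+ \<xi>. ennreal ((norm (g \<xi> - h \<xi>))\<^sup>2) \<partial>lborel) = 0" by (simp add: sq_integral_def)
  then have "AE \<xi> in lborel. ennreal ((norm (g \<xi> - h \<xi>))\<^sup>2) = 0"
    by (subst (asm) nn_integral_0_iff_AE) auto
  then show ?thesis by eventually_elim (simp add: ennreal_eq_0_iff)
qed

lemma is_fourier_transform_add_cmult:
  assumes g: "is_fourier_transform F g" and h: "is_fourier_transform G h"
  shows "is_fourier_transform (\<lambda>x. F x + c * G x) (\<lambda>\<xi>. g \<xi> + of_real c * h \<xi>)"
proof -
  note [measurable] = is_fourier_transform_measurable[OF g] is_fourier_transform_measurable[OF h]
  have sq: "square_integrable F" "square_integrable G" "square_integrable g" "square_integrable h"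
    using g h by (auto simp: is_fourier_transform_def)
  have T: "truncated_fourier (\<lambda>x. F x + c * G x) n \<xi> = truncated_fourier F n \<xi> + of_real c * truncated_fourier G n \<xi>" for n \<xi>
  proof -
    let ?i = "\<lambda>x. indicator {- real n..real n} x :: real"
    have "of_real (?i x * (F x + c * G x)) * cis (- (x * \<xi>))
        = of_real (?i x * F x) * cis (- (x * \<xi>)) + of_real c * (of_real (?i x * G x) * cis (- (x * \<xi>)))" for x
      by (simp add: algebra_simps)
    then have "fourier_integral (\<lambda>x. ?i x * (F x + c * G x)) \<xi>
       = fourier_integral (\<lambda>x. ?i x * F x) \<xi> + of_real c * fourier_integral (\<lambda>x. ?i x * G x) \<xi>"
      unfolding fourier_integral_def integral_mult_right_zero[symmetric]
      by (subst Bochner_Integration.integral_add[symmetric])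
        (auto intro!: integrable_times_cis[OF square_integrable_imp_truncation_integrable] integrable_mult_right sq simp del: of_real_mult)
    then show ?thesis by (simp add: truncated_fourier_eq algebra_simps)
  qed
  have 1: "square_integrable (\<lambda>x. F x + c * G x)"
    by (intro square_integrable_add sq square_integrable_bound[OF sq(2), of _ "\<bar>c\<bar>"]) (auto simp: abs_mult)
  have 2: "square_integrable (\<lambda>\<xi>. g \<xi> + of_real c * h \<xi>)"
    by (intro square_integrable_add sq square_integrable_bound[OF sq(4), of _ "\<bar>c\<bar>"]) (auto simp: norm_mult)
  have "(\<lambda>n. sq_integral (\<lambda>\<xi>. g \<xi> + of_real c * h \<xi> - truncated_fourier (\<lambda>x. F x + c * G x) n \<xi>)) \<longlonglongrightarrow> 0"
  proof (rule tendsto_sandwich[OF _ _ tendsto_const])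
    show "\<forall>\<^sub>F n in sequentially. sq_integral (\<lambda>\<xi>. g \<xi> + of_real c * h \<xi> - truncated_fourier (\<lambda>x. F x + c * G x) n \<xi>)
       \<le> 2 * sq_integral (\<lambda>\<xi>. g \<xi> - truncated_fourier F n \<xi>) + 2 * (ennreal (\<bar>c\<bar>\<^sup>2) * sq_integral (\<lambda>\<xi>. h \<xi> - truncated_fourier G n \<xi>))"
    proof (rule always_eventually, rule allI)
      fix n
      have "sq_integral (\<lambda>\<xi>. g \<xi> + of_real c * h \<xi> - truncated_fourier (\<lambda>x. F x + c * G x) n \<xi>)
        = sq_integral (\<lambda>\<xi>. (g \<xi> - truncated_fourier F n \<xi>) + of_real c * (h \<xi> - truncated_fourier G n \<xi>))"
        unfolding T by (simp add: algebra_simps)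
      also have "\<dots> \<le> 2 * sq_integral (\<lambda>\<xi>. g \<xi> - truncated_fourier F n \<xi>) + 2 * sq_integral (\<lambda>\<xi>. of_real c * (h \<xi> - truncated_fourier G n \<xi>))"
        by (rule sq_integral_add_le) measurable
      also have "sq_integral (\<lambda>\<xi>. of_real c * (h \<xi> - truncated_fourier G n \<xi>)) \<le> ennreal (\<bar>c\<bar>\<^sup>2) * sq_integral (\<lambda>\<xi>. h \<xi> - truncated_fourier G n \<xi>)"
        by (rule sq_integral_cmult_bound) (auto simp: norm_mult)
      finally show "sq_integral (\<lambda>\<xi>. g \<xi> + of_real c * h \<xi> - truncated_fourier (\<lambda>x. F x + c * G x) n \<xi>)
       \<le> 2 * sq_integral (\<lambda>\<xi>. g \<xi> - truncated_fourier F n \<xi>) + 2 * (ennreal (\<bar>c\<bar>\<^sup>2) * sq_integral (\<lambda>\<xi>. h \<xi> - truncated_fourier G n \<xi>))"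
        by (simp add: add_left_mono mult_left_mono)
    qed
    have "(\<lambda>n. 2 * sq_integral (\<lambda>\<xi>. g \<xi> - truncated_fourier F n \<xi>) + 2 * (ennreal (\<bar>c\<bar>\<^sup>2) * sq_integral (\<lambda>\<xi>. h \<xi> - truncated_fourier G n \<xi>))) \<longlonglongrightarrow> 2 * 0 + 2 * (ennreal (\<bar>c\<bar>\<^sup>2) * 0)"
      using g h by (intro tendsto_add ennreal_tendsto_cmult) (auto simp: is_fourier_transform_altdef)
    then show "(\<lambda>n. 2 * sq_integral (\<lambda>\<xi>. g \<xi> - truncated_fourier F n \<xi>) + 2 * (ennreal (\<bar>c\<bar>\<^sup>2) * sq_integral (\<lambda>\<xi>. h \<xi> - truncated_fourier G n \<xi>))) \<longlonglongrightarrow> 0" by simp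
  qed auto
  then show ?thesis using 1 2 by (simp add: is_fourier_transform_altdef)
qed

text \<open>Norms may be computed with any transform of \<open>F\<close>, not just the chosen one.\<close>

lemma sobolev_line_of_transform:
  assumes F: "is_fourier_transform F g" and int: "integrable lborel (\<lambda>\<xi>. (1 + \<xi>\<^sup>2) powr s * (cmod (g \<xi>))\<^sup>2)"
  shows "F \<in> sobolev_space_line s"
    and "sobolev_norm_line s F = sqrt (\<integral>\<xi>. (1 + \<xi>\<^sup>2) powr s * (cmod (g \<xi>))\<^sup>2 \<partial>lborel)"
proof -
  have FT: "is_fourier_transform F (fourier_transform F)"
    unfolding fourier_transform_def by (rule someI[of "is_fourier_transform F", OF F])
  note [measurable] = is_fourier_transform_measurable[OF F] is_fourier_transform_measurable[OF FT]
  have "AE \<xi> in lborel. fourier_transform F \<xi> = g \<xi>" by (rule is_fourier_transform_unique[OF FT F])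
  then have AE: "AE \<xi> in lborel. (1 + \<xi>\<^sup>2) powr s * (cmod (fourier_transform F \<xi>))\<^sup>2 = (1 + \<xi>\<^sup>2) powr s * (cmod (g \<xi>))\<^sup>2"
    by eventually_elim simp
  have "integrable lborel (\<lambda>\<xi>. (1 + \<xi>\<^sup>2) powr s * (cmod (fourier_transform F \<xi>))\<^sup>2)"
    using int by (subst integrable_cong_AE[OF _ _ AE]) auto
  then show "F \<in> sobolev_space_line s" using FT by (simp add: sobolev_space_line_def)
  show "sobolev_norm_line s F = sqrt (\<integral>\<xi>. (1 + \<xi>\<^sup>2) powr s * (cmod (g \<xi>))\<^sup>2 \<partial>lborel)"
    unfolding sobolev_norm_line_def by (subst integral_cong_AE[OF _ _ AE]) auto
qed

text \<open>The truncations are eventually constant.  Square integrability of the transform comes from the Bessel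
  inequality.\<close>

lemma is_fourier_transform_compact_support:
  assumes F: "square_integrable F" and supp: "\<And>x. x \<notin> {a..b} \<Longrightarrow> F x = 0"
  shows "is_fourier_transform F (\<lambda>\<xi>. of_real (1 / sqrt (2 * pi)) * fourier_integral F \<xi>)"
proof -
  have [measurable]: "F \<in> borel_measurable borel" using F by (simp add: square_integrable_iff)
  have "(\<lambda>x. indicator {a..b} x * F x) = F" using supp by (auto simp: indicator_def fun_eq_iff)
  then have int: "integrable lborel F" using square_integrable_imp_truncation_integrable[OF F, of a b] by simp
  have "sq_integral (fourier_integral F) < \<infinity>"
    by (rule le_less_trans[OF bessel_inequality[OF int]]) (use F in \<open>auto simp: square_integrable_iff ennreal_mult_less_top\<close>)
  then have "square_integrable (fourier_integral F)" by (simp add: square_integrable_iff)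
  then have sq: "square_integrable (\<lambda>\<xi>. of_real (1 / sqrt (2 * pi)) * fourier_integral F \<xi>)"
    by (rule square_integrable_bound[where c = "1 / sqrt (2 * pi)"]) (auto simp: norm_mult norm_divide)
  obtain N :: nat where N: "max \<bar>a\<bar> \<bar>b\<bar> \<le> real N" using real_arch_simple by blast
  have "truncated_fourier F n \<xi> = of_real (1 / sqrt (2 * pi)) * fourier_integral F \<xi>" if "n \<ge> N" for n \<xi>
  proof -
    have "x \<in> {- real n..real n}" if "x \<in> {a..b}" for x
      using that N \<open>n \<ge> N\<close> by auto
    then have "(\<lambda>x. indicator {- real n..real n} x * F x) = F" using supp by (auto simp: indicator_def fun_eq_iff)
    then show ?thesis by (simp add: truncated_fourier_eq)
  qed
  then have "eventually (\<lambda>n. sq_integral (\<lambda>\<xi>. of_real (1 / sqrt (2 * pi)) * fourier_integral F \<xi> - truncated_fourier F n \<xi>) = 0) sequentially"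
    unfolding eventually_sequentially sq_integral_def by (intro exI[of _ N]) auto
  then show ?thesis using F sq by (simp add: is_fourier_transform_altdef tendsto_eventually)
qed

definition line_convolution :: "(real \<Rightarrow> real) \<Rightarrow> (real \<Rightarrow> real) \<Rightarrow> real \<Rightarrow> real" where
  "line_convolution F \<phi> y = (\<integral>x. F (y - x) * \<phi> x \<partial>lborel)"

lemma line_convolution_measurable [measurable]:
  assumes [measurable]: "F \<in> borel_measurable borel" "\<phi> \<in> borel_measurable borel"
  shows "line_convolution F \<phi> \<in> borel_measurable borel"
  unfolding line_convolution_def by measurable

lemma nn_integral_shift:
  fixes f :: "real \<Rightarrow> ennreal"
  assumes [measurable]: "f \<in> borel_measurable borel"
  shows "(\<integral>\<^sup>+ y. f (y - x) \<partial>lborel) = (\<integral>\<^sup>+ y. f y \<partial>lborel)"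
  using nn_integral_real_affine[of f 1 "- x"] by simp

text \<open>Cauchy-Schwarz with respect to the weight \<open>|\<phi>|\<close>, followed by Tonelli and translation invariance.\<close>

lemma young_inequality:
  assumes F: "F \<in> borel_measurable borel" and \<phi>: "integrable lborel \<phi>"
  shows "sq_integral (line_convolution F \<phi>) \<le> ennreal ((\<integral>x. \<bar>\<phi> x\<bar> \<partial>lborel)\<^sup>2) * sq_integral F"
proof -
  have [measurable]: "F \<in> borel_measurable borel" "\<phi> \<in> borel_measurable borel" using F \<phi> by auto
  define L where "L = (\<integral>x. \<bar>\<phi> x\<bar> \<partial>lborel)"
  have L: "(\<integral>\<^sup>+ x. ennreal \<bar>\<phi> x\<bar> \<partial>lborel) = ennreal L" unfolding L_def using \<phi> by (subst nn_integral_eq_integral) auto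
  have "ennreal ((norm (line_convolution F \<phi> y))\<^sup>2) \<le> ennreal L * (\<integral>\<^sup>+ x. ennreal ((F (y - x))\<^sup>2 * \<bar>\<phi> x\<bar>) \<partial>lborel)" for y
  proof -
    have "ennreal ((norm (line_convolution F \<phi> y))\<^sup>2) = (ennreal (norm (line_convolution F \<phi> y)))\<^sup>2"
      by (simp add: ennreal_power)
    also have "\<dots> \<le> (\<integral>\<^sup>+ x. ennreal (norm (F (y - x) * \<phi> x)) \<partial>lborel)\<^sup>2"
      unfolding line_convolution_def by (intro power_mono ennreal_norm_integral_le) auto
    also have "(\<lambda>x. ennreal (norm (F (y - x) * \<phi> x))) = (\<lambda>x. ennreal (\<bar>F (y - x)\<bar> * sqrt \<bar>\<phi> x\<bar>) * ennreal (sqrt \<bar>\<phi> x\<bar>))"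
      by (auto simp: fun_eq_iff ennreal_mult[symmetric] abs_mult mult.assoc)
    also have "(\<integral>\<^sup>+ x. ennreal (\<bar>F (y - x)\<bar> * sqrt \<bar>\<phi> x\<bar>) * ennreal (sqrt \<bar>\<phi> x\<bar>) \<partial>lborel)\<^sup>2
        \<le> (\<integral>\<^sup>+ x. (ennreal (\<bar>F (y - x)\<bar> * sqrt \<bar>\<phi> x\<bar>))\<^sup>2 \<partial>lborel) * (\<integral>\<^sup>+ x. (ennreal (sqrt \<bar>\<phi> x\<bar>))\<^sup>2 \<partial>lborel)"
      by (rule Cauchy_Schwarz_nn_integral) auto
    also have "\<dots> = (\<integral>\<^sup>+ x. ennreal ((F (y - x))\<^sup>2 * \<bar>\<phi> x\<bar>) \<partial>lborel) * ennreal L"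
      by (simp add: ennreal_power power_mult_distrib L)
    finally show ?thesis by (simp add: mult.commute)
  qed
  then have "sq_integral (line_convolution F \<phi>) \<le> (\<integral>\<^sup>+ y. ennreal L * (\<integral>\<^sup>+ x. ennreal ((F (y - x))\<^sup>2 * \<bar>\<phi> x\<bar>) \<partial>lborel) \<partial>lborel)"
    unfolding sq_integral_def by (intro nn_integral_mono)
  also have "\<dots> = ennreal L * (\<integral>\<^sup>+ y. \<integral>\<^sup>+ x. ennreal ((F (y - x))\<^sup>2 * \<bar>\<phi> x\<bar>) \<partial>lborel \<partial>lborel)"
    by (rule nn_integral_cmult) measurable
  also have "(\<integral>\<^sup>+ y. \<integral>\<^sup>+ x. ennreal ((F (y - x))\<^sup>2 * \<bar>\<phi> x\<bar>) \<partial>lborel \<partial>lborel) = (\<integral>\<^sup>+ x. \<integral>\<^sup>+ y. ennreal ((F (y - x))\<^sup>2 * \<bar>\<phi> x\<bar>) \<partial>lborel \<partial>lborel)"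
    by (rule lborel_pair.Fubini') measurable
  also have "\<dots> = (\<integral>\<^sup>+ x. ennreal \<bar>\<phi> x\<bar> * sq_integral F \<partial>lborel)"
  proof (rule nn_integral_cong)
    fix x
    have "(\<integral>\<^sup>+ y. ennreal ((F (y - x))\<^sup>2 * \<bar>\<phi> x\<bar>) \<partial>lborel) = ennreal \<bar>\<phi> x\<bar> * (\<integral>\<^sup>+ y. ennreal ((F (y - x))\<^sup>2) \<partial>lborel)"
      by (subst nn_integral_cmult[symmetric]) (auto simp: ennreal_mult mult.commute)
    also have "(\<integral>\<^sup>+ y. ennreal ((F (y - x))\<^sup>2) \<partial>lborel) = sq_integral F"
      unfolding sq_integral_def by (subst nn_integral_shift[of "\<lambda>y. ennreal ((F y)\<^sup>2)"]) auto
    finally show "(\<integral>\<^sup>+ y. ennreal ((F (y - x))\<^sup>2 * \<bar>\<phi> x\<bar>) \<partial>lborel) = ennreal \<bar>\<phi> x\<bar> * sq_integral F" .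
  qed
  also have "\<dots> = ennreal L * sq_integral F" by (subst nn_integral_multc) (auto simp: L)
  finally show ?thesis
    unfolding L_def[symmetric] power2_eq_square by (simp add: L_def ennreal_mult mult.assoc)
qed

lemma fourier_integral_convolution:
  assumes F: "integrable lborel F" and \<phi>: "integrable lborel \<phi>"
  shows "integrable lborel (line_convolution F \<phi>)"
    and "fourier_integral (line_convolution F \<phi>) \<xi> = fourier_integral \<phi> \<xi> * fourier_integral F \<xi>"
proof -
  have [measurable]: "F \<in> borel_measurable borel" "\<phi> \<in> borel_measurable borel" using F \<phi> by auto
  have F_shift: "integrable lborel (\<lambda>y. F (y - x))" "(\<integral>y. \<bar>F (y - x)\<bar> \<partial>lborel) = (\<integral>y. \<bar>F y\<bar> \<partial>lborel)" for x
    using lborel_integrable_real_affine[OF F, of 1 "-x"] lborel_integral_real_affine[of 1 "\<lambda>y. \<bar>F y\<bar>" "-x"] by auto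
  have int: "integrable (lborel \<Otimes>\<^sub>M lborel) (\<lambda>(x, y). F (y - x) * \<phi> x)"
  proof (rule lborel_pair.Fubini_integrable)
    show "integrable lborel (\<lambda>x. \<integral>y. norm (case (x, y) of (x, y) \<Rightarrow> F (y - x) * \<phi> x) \<partial>lborel)"
      using \<phi> by (simp add: abs_mult F_shift)
    show "AE x in lborel. integrable lborel (\<lambda>y. case (x, y) of (x, y) \<Rightarrow> F (y - x) * \<phi> x)"
      using F_shift by (intro AE_I2) (auto intro: integrable_mult_left)
  qed measurable
  show "integrable lborel (line_convolution F \<phi>)"
    using lborel_pair.integrable_snd[OF int] by (simp add: line_convolution_def[abs_def])
  have int2: "integrable (lborel \<Otimes>\<^sub>M lborel) (\<lambda>(x, y). of_real (F (y - x) * \<phi> x) * cis (- (y * \<xi>)))"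
    by (rule Bochner_Integration.integrable_bound[OF int]) (auto simp: norm_mult intro!: AE_I2)
  have "fourier_integral (line_convolution F \<phi>) \<xi> = (\<integral>y. \<integral>x. of_real (F (y - x) * \<phi> x) * cis (- (y * \<xi>)) \<partial>lborel \<partial>lborel)"
    unfolding fourier_integral_def line_convolution_def
    by (simp only: integral_complex_of_real[symmetric] integral_mult_left_zero[symmetric])
  also have "\<dots> = (\<integral>x. \<integral>y. of_real (F (y - x) * \<phi> x) * cis (- (y * \<xi>)) \<partial>lborel \<partial>lborel)"
    by (rule lborel_pair.Fubini_integral[OF int2])
  also have "\<dots> = (\<integral>x. of_real (\<phi> x) * cis (- (x * \<xi>)) * fourier_integral F \<xi> \<partial>lborel)"
  proof (rule Bochner_Integration.integral_cong[OF refl])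
    fix x
    have "of_real (F (y - x) * \<phi> x) * cis (- (y * \<xi>)) = of_real (\<phi> x) * cis (- (x * \<xi>)) * (of_real (F (y - x)) * cis (- ((y - x) * \<xi>)))" for y
    proof -
      have "cis (- (y * \<xi>)) = cis (- (x * \<xi>)) * cis (- ((y - x) * \<xi>))" by (simp add: cis_mult algebra_simps)
      then show ?thesis by (simp only: of_real_mult mult_ac)
    qed
    then have "(\<integral>y. of_real (F (y - x) * \<phi> x) * cis (- (y * \<xi>)) \<partial>lborel)
      = of_real (\<phi> x) * cis (- (x * \<xi>)) * (\<integral>y. of_real (F (y - x)) * cis (- ((y - x) * \<xi>)) \<partial>lborel)"
      by (simp only: integral_mult_right_zero)
    also have "(\<integral>y. of_real (F (y - x)) * cis (- ((y - x) * \<xi>)) \<partial>lborel) = fourier_integral F \<xi>"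
      unfolding fourier_integral_def
      using lborel_integral_real_affine[of 1 "\<lambda>y. of_real (F y) * cis (- (y * \<xi>))" "-x"] by simp
    finally show "(\<integral>y. of_real (F (y - x) * \<phi> x) * cis (- (y * \<xi>)) \<partial>lborel) = of_real (\<phi> x) * cis (- (x * \<xi>)) * fourier_integral F \<xi>" .
  qed
  also have "\<dots> = fourier_integral \<phi> \<xi> * fourier_integral F \<xi>"
    unfolding fourier_integral_def[of \<phi>] by (rule integral_mult_left_zero)
  finally show "fourier_integral (line_convolution F \<phi>) \<xi> = fourier_integral \<phi> \<xi> * fourier_integral F \<xi>" .
qed

lemma integrable_convolution_integrand:
  assumes "square_integrable F" "square_integrable (\<phi> :: real \<Rightarrow> real)"
  shows "integrable lborel (\<lambda>x. F (y - x) * \<phi> x)"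
proof (rule Bochner_Integration.integrable_bound)
  have [measurable]: "F \<in> borel_measurable borel" "\<phi> \<in> borel_measurable borel"
    using assms by (auto simp: square_integrable_iff)
  have "integrable lborel (\<lambda>x. (norm (F x))\<^sup>2)" "integrable lborel (\<lambda>x. (norm (\<phi> x))\<^sup>2)"
    using assms by (auto simp: square_integrable_def)
  from lborel_integrable_real_affine[OF this(1), of "-1" y] this(2)
  show "integrable lborel (\<lambda>x. (F (y - x))\<^sup>2 + (\<phi> x)\<^sup>2)" by simp
  show "(\<lambda>x. F (y - x) * \<phi> x) \<in> borel_measurable lborel" by measurable
  have "\<bar>u * v\<bar> \<le> u\<^sup>2 + v\<^sup>2" for u v :: real
  proof -
    have "0 \<le> \<bar>u\<bar>\<^sup>2 + \<bar>v\<bar>\<^sup>2 - 2 * (\<bar>u\<bar> * \<bar>v\<bar>)"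
      using zero_le_power2[of "\<bar>u\<bar> - \<bar>v\<bar>"] by (simp add: power2_diff)
    moreover have "0 \<le> \<bar>u\<bar> * \<bar>v\<bar>" by simp
    ultimately show ?thesis unfolding abs_mult by (simp only: power2_abs)
  qed
  then show "AE x in lborel. norm (F (y - x) * \<phi> x) \<le> norm ((F (y - x))\<^sup>2 + (\<phi> x)\<^sup>2)"
    by (auto intro!: AE_I2 order_trans[OF _ abs_ge_self])
qed

lemma sq_integral_tail_tendsto_0:
  assumes "square_integrable (F :: real \<Rightarrow> real)"
  shows "(\<lambda>n. sq_integral (\<lambda>x. F x - indicator {- real n..real n} x * F x)) \<longlonglongrightarrow> 0"
proof -
  have [measurable]: "F \<in> borel_measurable borel" using assms by (simp add: square_integrable_iff)
  have "(\<lambda>n. \<integral>\<^sup>+ x. ennreal ((norm (F x - indicator {- real n..real n} x * F x))\<^sup>2) \<partial>lborel) \<longlonglongrightarrow> (\<integral>\<^sup>+ x. 0 \<partial>(lborel :: real measure))"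
  proof (rule nn_integral_dominated_convergence[where w = "\<lambda>x. ennreal ((norm (F x))\<^sup>2)"])
    show "AE x in lborel. ennreal ((norm (F x - indicator {- real j..real j} x * F x))\<^sup>2) \<le> ennreal ((norm (F x))\<^sup>2)" for j
      by (auto simp: indicator_def intro!: AE_I2)
    show "(\<integral>\<^sup>+ x. ennreal ((norm (F x))\<^sup>2) \<partial>lborel) < \<infinity>" using assms by (simp add: square_integrable_iff sq_integral_def)
    show "AE x in lborel. (\<lambda>n. ennreal ((norm (F x - indicator {- real n..real n} x * F x))\<^sup>2)) \<longlonglongrightarrow> 0"
    proof (rule AE_I2)
      fix x :: real
      obtain N :: nat where N: "\<bar>x\<bar> \<le> real N" using real_arch_simple by blast
      have "eventually (\<lambda>n. ennreal ((norm (F x - indicator {- real n..real n} x * F x))\<^sup>2) = 0) sequentially"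
        unfolding eventually_sequentially using N by (intro exI[of _ N]) (auto simp: indicator_def)
      then show "(\<lambda>n. ennreal ((norm (F x - indicator {- real n..real n} x * F x))\<^sup>2)) \<longlonglongrightarrow> 0"
        by (rule tendsto_eventually)
    qed
  qed auto
  then show ?thesis by (simp add: sq_integral_def)
qed

text \<open>The transform of the truncated \<open>F\<close> convolved with \<open>\<phi>\<close> is an ordinary product, but the definition asks for
  truncations of the convolution itself.  The two differ by the transform of a function \<open>D\<close> that combines the
  tails of \<open>F\<close> and of the convolution; by Young's inequality \<open>D\<close> tends to 0 in \<open>L^2\<close>, and by the
  Bessel inequality so does its transform.\<close>

theorem is_fourier_transform_convolution:
  assumes F: "is_fourier_transform F g" and \<phi>: "integrable lborel \<phi>" "square_integrable \<phi>"
  shows "is_fourier_transform (line_convolution F \<phi>) (\<lambda>\<xi>. fourier_integral \<phi> \<xi> * g \<xi>)"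
proof -
  note [measurable] = is_fourier_transform_measurable[OF F] square_integrable_measurable[OF \<phi>(2)]
  have sqF: "square_integrable F" and sqg: "square_integrable g" using F by (auto simp: is_fourier_transform_def)
  define L where "L = (\<integral>x. \<bar>\<phi> x\<bar> \<partial>lborel)"
  have L0: "0 \<le> L" unfolding L_def by simp
  define H where "H = line_convolution F \<phi>"
  have [measurable]: "H \<in> borel_measurable borel" unfolding H_def by measurable
  have "sq_integral H < \<infinity>"
    unfolding H_def using sqF
    by (intro le_less_trans[OF young_inequality[OF _ \<phi>(1)]]) (auto simp: square_integrable_iff ennreal_mult_less_top)
  then have sqH: "square_integrable H" by (simp add: square_integrable_iff)
  have mL: "cmod (fourier_integral \<phi> \<xi>) \<le> L" for \<xi> unfolding L_def by (rule norm_fourier_integral_le[OF \<phi>(1)])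
  have sqmg: "square_integrable (\<lambda>\<xi>. fourier_integral \<phi> \<xi> * g \<xi>)"
    by (rule square_integrable_bound[OF sqg _ _ L0]) (auto simp: norm_mult intro!: mult_right_mono mL)
  define ind where "ind = (\<lambda>n x. indicator {- real n..real n} x :: real)"
  have [measurable]: "ind n \<in> borel_measurable borel" for n unfolding ind_def by measurable
  define R where "R = (\<lambda>n. 2 * (ennreal (L\<^sup>2) * sq_integral (\<lambda>\<xi>. g \<xi> - truncated_fourier F n \<xi>))
      + 2 * (2 * (ennreal (L\<^sup>2) * sq_integral (\<lambda>x. F x - ind n x * F x)) + 2 * sq_integral (\<lambda>x. H x - ind n x * H x)))"
  have bound: "sq_integral (\<lambda>\<xi>. fourier_integral \<phi> \<xi> * g \<xi> - truncated_fourier H n \<xi>) \<le> R n" for n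
  proof -
    define Fn where "Fn = (\<lambda>x. ind n x * F x)"
    define Hn where "Hn = (\<lambda>x. ind n x * H x)"
    define P where "P = line_convolution Fn \<phi>"
    have [measurable]: "Fn \<in> borel_measurable borel" "Hn \<in> borel_measurable borel" unfolding Fn_def Hn_def by measurable
    have [measurable]: "P \<in> borel_measurable borel" unfolding P_def by measurable
    have int: "integrable lborel Fn" "integrable lborel Hn"
      unfolding Fn_def Hn_def ind_def by (intro square_integrable_imp_truncation_integrable sqF sqH)+
    have sqFn: "square_integrable Fn"
      by (rule square_integrable_bound[OF sqF, of _ 1]) (auto simp: Fn_def ind_def indicator_def)
    note P = fourier_integral_convolution[OF int(1) \<phi>(1), folded P_def]
    define D where "D = (\<lambda>x. P x - Hn x)"
    have [measurable]: "D \<in> borel_measurable borel" unfolding D_def by measurable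
    have intD: "integrable lborel D" unfolding D_def using P int by auto
    have "fourier_integral D \<xi> = fourier_integral P \<xi> - fourier_integral Hn \<xi>" for \<xi>
      unfolding fourier_integral_def D_def
      by (subst Bochner_Integration.integral_diff[symmetric]) (use P int in \<open>auto intro!: integrable_times_cis simp: algebra_simps\<close>)
    note FD = this
    have TD: "fourier_integral \<phi> \<xi> * truncated_fourier F n \<xi> - truncated_fourier H n \<xi> = of_real (1 / sqrt (2 * pi)) * fourier_integral D \<xi>" for \<xi>
    proof -
      have "truncated_fourier F n \<xi> = of_real (1 / sqrt (2 * pi)) * fourier_integral Fn \<xi>"
        "truncated_fourier H n \<xi> = of_real (1 / sqrt (2 * pi)) * fourier_integral Hn \<xi>"
        unfolding truncated_fourier_eq Fn_def Hn_def ind_def by auto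
      moreover note FD[of \<xi>]
      ultimately show ?thesis using P(2)[of \<xi>] by (simp only: right_diff_distrib mult.left_commute)
    qed
    have "sq_integral (\<lambda>\<xi>. of_real (1 / sqrt (2 * pi)) * fourier_integral D \<xi>) \<le> ennreal ((1 / sqrt (2 * pi))\<^sup>2) * sq_integral (fourier_integral D)"
      by (rule sq_integral_cmult_bound) (auto simp: norm_mult norm_divide)
    also have "\<dots> \<le> ennreal ((1 / sqrt (2 * pi))\<^sup>2) * (ennreal (2 * pi) * sq_integral D)"
      by (intro mult_left_mono bessel_inequality intD) auto
    also have "\<dots> = sq_integral D"
      by (simp add: mult.assoc[symmetric] ennreal_mult[symmetric] power_divide)
    finally have 1: "sq_integral (\<lambda>\<xi>. of_real (1 / sqrt (2 * pi)) * fourier_integral D \<xi>) \<le> sq_integral D" .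
    have D_split: "D = (\<lambda>x. - line_convolution (\<lambda>x. F x - Fn x) \<phi> x + (H x - Hn x))"
    proof
      fix x
      have "line_convolution (\<lambda>x. F x - Fn x) \<phi> x = H x - P x"
        unfolding line_convolution_def H_def P_def left_diff_distrib
        by (intro Bochner_Integration.integral_diff integrable_convolution_integrand sqF sqFn \<phi>)
      then show "D x = - line_convolution (\<lambda>x. F x - Fn x) \<phi> x + (H x - Hn x)" by (simp add: D_def)
    qed
    have "sq_integral D \<le> 2 * sq_integral (\<lambda>x. - line_convolution (\<lambda>x. F x - Fn x) \<phi> x) + 2 * sq_integral (\<lambda>x. H x - Hn x)"
      unfolding D_split by (rule sq_integral_add_le) measurable
    also have "sq_integral (\<lambda>x. - line_convolution (\<lambda>x. F x - Fn x) \<phi> x) = sq_integral (line_convolution (\<lambda>x. F x - Fn x) \<phi>)"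
      by (simp add: sq_integral_def)
    also have "\<dots> \<le> ennreal (L\<^sup>2) * sq_integral (\<lambda>x. F x - Fn x)"
      unfolding L_def by (rule young_inequality[OF _ \<phi>(1)]) measurable
    finally have 2: "sq_integral D \<le> 2 * (ennreal (L\<^sup>2) * sq_integral (\<lambda>x. F x - Fn x)) + 2 * sq_integral (\<lambda>x. H x - Hn x)"
      by (simp add: add_right_mono mult_left_mono)
    have "sq_integral (\<lambda>\<xi>. fourier_integral \<phi> \<xi> * g \<xi> - truncated_fourier H n \<xi>)
       = sq_integral (\<lambda>\<xi>. fourier_integral \<phi> \<xi> * (g \<xi> - truncated_fourier F n \<xi>) + of_real (1 / sqrt (2 * pi)) * fourier_integral D \<xi>)"
      unfolding TD[symmetric] by (simp add: algebra_simps)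
    also have "\<dots> \<le> 2 * sq_integral (\<lambda>\<xi>. fourier_integral \<phi> \<xi> * (g \<xi> - truncated_fourier F n \<xi>)) + 2 * sq_integral (\<lambda>\<xi>. of_real (1 / sqrt (2 * pi)) * fourier_integral D \<xi>)"
      by (rule sq_integral_add_le) measurable
    also have "\<dots> \<le> R n"
      unfolding R_def Fn_def[symmetric] Hn_def[symmetric]
      by (intro add_mono mult_left_mono sq_integral_cmult_bound order_trans[OF 1 2[unfolded Fn_def Hn_def]] L0) (auto simp: norm_mult intro!: mult_right_mono mL)
    finally show ?thesis .
  qed
  have "R \<longlonglongrightarrow> 2 * (ennreal (L\<^sup>2) * 0) + 2 * (2 * (ennreal (L\<^sup>2) * 0) + 2 * 0)"
    unfolding R_def ind_def using F
    by (intro tendsto_add ennreal_tendsto_cmult sq_integral_tail_tendsto_0 sqF sqH) (auto simp: is_fourier_transform_altdef)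
  then have "R \<longlonglongrightarrow> 0" by simp
  then have "(\<lambda>n. sq_integral (\<lambda>\<xi>. fourier_integral \<phi> \<xi> * g \<xi> - truncated_fourier H n \<xi>)) \<longlonglongrightarrow> 0"
    by (rule tendsto_sandwich[OF _ _ tendsto_const, rotated 2]) (auto intro!: always_eventually bound)
  then show ?thesis using sqH sqmg by (simp add: is_fourier_transform_altdef H_def)
qed

section \<open>A kernel of Jackson type with compactly supported transform\<close>

lemma fourier_integral_box:
  "fourier_integral (\<lambda>x. indicator {-1..1} x / 2) \<xi> = of_real (sinc \<xi>)"
proof -
  have "fourier_integral (\<lambda>x. indicator {-1..1} x / 2) \<xi> = (1 / 2) * (\<integral>x. indicator {-1..1} x *\<^sub>R cis (- (x * \<xi>)) \<partial>lborel)"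
    unfolding fourier_integral_def 
    by (subst integral_mult_right_zero[symmetric]) (auto simp: scaleR_conv_of_real intro!: Bochner_Integration.integral_cong)
  also have "(\<integral>x. indicator {-1..1} x *\<^sub>R cis (- (x * \<xi>)) \<partial>lborel) = 2 * of_real (sinc \<xi>)"
  proof (cases "\<xi> = 0")
    case True
    then show ?thesis by (simp add: scaleR_conv_of_real)
  next
    case False
    define c where "c = - (\<i> * of_real \<xi>)"
    have c: "c \<noteq> 0" using False by (simp add: c_def)
    have cis: "cis (- (x * \<xi>)) = exp (c * of_real x)" for x
      by (simp add: cis_conv_exp c_def algebra_simps)
    have "(\<integral>x. indicator {-1..1} x *\<^sub>R exp (c * of_real x) \<partial>lborel) = exp (c * of_real 1) / c - exp (c * of_real (-1)) / c"
    proof (rule integral_FTC_atLeastAtMost)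
      fix x :: real
      have "((\<lambda>z. exp (c * z) / c) has_field_derivative exp (c * of_real x)) (at (of_real x))"
        using c by (auto intro!: derivative_eq_intros)
      then show "((\<lambda>x. exp (c * of_real x) / c) has_vector_derivative exp (c * of_real x)) (at x within {-1..1})"
        by (rule has_vector_derivative_at_within[OF has_vector_derivative_real_field])
    qed (auto intro!: continuous_intros)
    also have "\<dots> = (cis (- \<xi>) - cis \<xi>) / c"
      by (simp add: cis_conv_exp c_def diff_divide_distrib)
    also have "\<dots> = 2 * of_real (sinc \<xi>)"
      using False by (simp add: complex_eq_iff c_def Re_divide Im_divide power2_eq_square field_simps)
    finally show ?thesis unfolding cis .
  qed
  finally show ?thesis by simp
qed

lemma integrable_bounded_compact_support:
  fixes b :: "real \<Rightarrow> real"
  assumes "b \<in> borel_measurable borel" "\<And>x. \<bar>b x\<bar> \<le> C" "\<And>x. x \<notin> {-R..R} \<Longrightarrow> b x = 0"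
  shows "integrable lborel b"
proof (rule Bochner_Integration.integrable_bound)
  show "integrable lborel (\<lambda>x. C * indicator {-R..R} x :: real)"
    by (intro integrable_mult_right) (auto simp: integrable_indicator_iff emeasure_lborel_Icc_eq)
  show "AE x in lborel. norm (b x) \<le> norm (C * indicator {-R..R} x :: real)"
    using assms(2,3) by (intro AE_I2) (auto simp: indicator_def intro: order_trans[OF _ abs_ge_self])
qed (use assms in auto)

text \<open>The spline is the iterated convolution of the normalised indicator of \<open>[-1, 1]\<close>, whose transform is
  \<open>sinc\<close>.\<close>

lemma ex_spline_with_transform_sinc_power:
  "\<exists>b. b \<in> borel_measurable borel \<and> (\<forall>x. \<bar>b x\<bar> \<le> 1) \<and> (\<forall>x. x \<notin> {- real (Suc n)..real (Suc n)} \<longrightarrow> b x = 0)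
     \<and> (\<forall>\<xi>. fourier_integral b \<xi> = of_real (sinc \<xi> ^ Suc n))"
proof (induction n)
  case 0
  show ?case
  proof (intro exI[of _ "\<lambda>x. indicator {-1..1} x / 2"] conjI allI impI)
    show "fourier_integral (\<lambda>x. indicator {-1..1} x / 2) \<xi> = of_real (sinc \<xi> ^ Suc 0)" for \<xi>
      unfolding power_Suc0_right by (rule fourier_integral_box)
  qed (auto simp: indicator_def)
next
  case (Suc n)
  define N where "N = real (Suc n)"
  obtain b where [measurable]: "b \<in> borel_measurable borel" and b: "\<And>x. \<bar>b x\<bar> \<le> 1" "\<And>x. x \<notin> {-N..N} \<Longrightarrow> b x = 0"
    "\<And>\<xi>. fourier_integral b \<xi> = of_real (sinc \<xi> ^ Suc n)" using Suc unfolding N_def by blast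
  define b1 :: "real \<Rightarrow> real" where "b1 = (\<lambda>x. indicator {-1..1} x / 2)"
  have [measurable]: "b1 \<in> borel_measurable borel" unfolding b1_def by measurable
  have intb: "integrable lborel b" by (rule integrable_bounded_compact_support[of _ 1 N]) (use b in auto)
  have intb1: "integrable lborel b1" by (rule integrable_bounded_compact_support[of _ 1 1]) (auto simp: b1_def indicator_def)
  have "\<bar>line_convolution b b1 y\<bar> \<le> 1" for y
  proof -
    have "\<bar>line_convolution b b1 y\<bar> \<le> (\<integral>x. \<bar>b (y - x) * b1 x\<bar> \<partial>lborel)"
      unfolding line_convolution_def by (rule integral_abs_bound)
    also have "\<dots> \<le> (\<integral>x. b1 x \<partial>lborel)"
    proof (rule integral_mono)
      have b1n: "b1 x \<ge> 0" for x by (simp add: b1_def)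
      show le: "\<bar>b (y - x) * b1 x\<bar> \<le> b1 x" for x
        using mult_right_mono[OF b(1)[of "y - x"] b1n[of x]] b1n[of x] by (simp add: abs_mult)
      show "integrable lborel (\<lambda>x. \<bar>b (y - x) * b1 x\<bar>)"
        by (rule Bochner_Integration.integrable_bound[OF intb1]) (use le b1n in auto)
    qed (rule intb1)
    also have "(\<integral>x. b1 x \<partial>lborel) = 1" unfolding b1_def by simp
    finally show ?thesis .
  qed
  moreover have "line_convolution b b1 y = 0" if "y \<notin> {- real (Suc (Suc n))..real (Suc (Suc n))}" for y
  proof -
    have "b (y - x) * b1 x = 0" for x
      using that b(2)[of "y - x"] by (cases "x \<in> {-1..1}") (auto simp: N_def b1_def indicator_def)
    then have "(\<lambda>x. b (y - x) * b1 x) = (\<lambda>_. 0)" by (rule ext)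
    then show ?thesis unfolding line_convolution_def by simp
  qed
  moreover have "fourier_integral (line_convolution b b1) \<xi> = of_real (sinc \<xi> ^ Suc (Suc n))" for \<xi>
    using fourier_integral_box[of \<xi>, folded b1_def] by (simp add: fourier_integral_convolution[OF intb intb1] b)
  ultimately show ?case by (intro exI[of _ "line_convolution b b1"]) auto
qed

lemma integrable_inverse_one_plus_square: "integrable lborel (\<lambda>x::real. 1 / (1 + x\<^sup>2))"
  using integrable_inverse_1_plus_square 
  by (simp add: set_integrable_def inverse_eq_divide)

lemma sinc_power_bound:
  assumes "k + 2 \<le> n"
  shows "(1 + \<bar>x\<bar> ^ k) * \<bar>sinc x ^ n\<bar> \<le> 4 / (1 + x\<^sup>2)"
proof -
  have s1: "\<bar>sinc x\<bar> \<le> 1"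
    using abs_sin_x_le_abs_x[of x] by (cases "x = 0") (auto simp: divide_simps)
  show ?thesis
  proof (cases "\<bar>x\<bar> \<le> 1")
    case True
    have "(1 + \<bar>x\<bar> ^ k) * \<bar>sinc x ^ n\<bar> \<le> (1 + 1) * 1"
      using True s1 by (intro mult_mono add_mono) (auto simp: power_abs power_le_one)
    also have "\<dots> \<le> 4 / (1 + x\<^sup>2)" using True abs_square_le_1[of x] by (simp add: divide_simps add_pos_nonneg)
    finally show ?thesis .
  next
    case False
    then have x: "\<bar>x\<bar> \<ge> 1" "x \<noteq> 0" by auto
    have "\<bar>sinc x\<bar> \<le> 1 / \<bar>x\<bar>" using x by (simp add: divide_right_mono)
    then have "\<bar>sinc x ^ n\<bar> \<le> (1 / \<bar>x\<bar>) ^ n" unfolding power_abs by (intro power_mono) auto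
    also have "\<dots> \<le> (1 / \<bar>x\<bar>) ^ (k + 2)" using x assms by (intro power_decreasing) auto
    also have "\<dots> = 1 / (\<bar>x\<bar> ^ k * x\<^sup>2)" by (simp add: power_add power_divide power2_eq_square)
    finally have le: "\<bar>sinc x ^ n\<bar> \<le> 1 / (\<bar>x\<bar> ^ k * x\<^sup>2)" .
    have xk: "1 \<le> \<bar>x\<bar> ^ k" using x by simp
    have x2: "1 \<le> x\<^sup>2" using x by (simp add: one_le_power abs_le_square_iff[of 1 x, simplified])
    have "(1 + \<bar>x\<bar> ^ k) * \<bar>sinc x ^ n\<bar> \<le> (2 * \<bar>x\<bar> ^ k) * (1 / (\<bar>x\<bar> ^ k * x\<^sup>2))"
      using le xk by (intro mult_mono) auto
    also have "\<dots> = 2 / x\<^sup>2" using x by simp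
    also have "\<dots> \<le> 4 / (1 + x\<^sup>2)" using x2 by (simp add: divide_simps add_pos_nonneg)
    finally show ?thesis .
  qed
qed

lemma cmod_one_minus_cis_le: "cmod (1 - cis t) \<le> \<bar>t\<bar>" "cmod (1 - cis t) \<le> 2"
proof -
  show "cmod (1 - cis t) \<le> 2" using norm_triangle_ineq4[of 1 "cis t"] by simp
  have "(cmod (1 - cis t))\<^sup>2 = (1 - cos t)\<^sup>2 + (sin t)\<^sup>2" by (subst cmod_power2) simp
  also have "\<dots> = (2 * sin (t / 2))\<^sup>2"
  proof -
    have "(1 - cos t)\<^sup>2 = 1 - 2 * cos t + (cos t)\<^sup>2" by (simp only: power2_diff) simp
    moreover have "cos t = 1 - 2 * (sin (t / 2))\<^sup>2" using cos_double_sin[of "t / 2"] by (simp only: field_sum_of_halves mult_2)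
    moreover have "(2 * sin (t / 2))\<^sup>2 = 4 * (sin (t / 2))\<^sup>2" by (simp add: power_mult_distrib)
    ultimately show ?thesis using sin_cos_squared_add[of t] by linarith
  qed
  also have "\<dots> \<le> \<bar>t\<bar>\<^sup>2"
  proof -
    have "\<bar>2 * sin (t / 2)\<bar> \<le> \<bar>t\<bar>" using abs_sin_x_le_abs_x[of "t / 2"] by (simp add: abs_mult)
    from power_mono[OF this, of 2] show ?thesis by (simp only: power2_abs abs_ge_zero)
  qed
  finally show "cmod (1 - cis t) \<le> \<bar>t\<bar>" by (rule power2_le_imp_le) simp
qed

lemma square_integrable_of_bounded:
  fixes f :: "real \<Rightarrow> real"
  assumes f: "integrable lborel f" and B: "\<And>x. \<bar>f x\<bar> \<le> B"
  shows "square_integrable f"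
  unfolding square_integrable_def
proof
  show m: "f \<in> borel_measurable lborel" using f by auto
  then have [measurable]: "f \<in> borel_measurable borel" by simp
  show "integrable lborel (\<lambda>x. (norm (f x))\<^sup>2)"
  proof (rule Bochner_Integration.integrable_bound)
    show "integrable lborel (\<lambda>x. B * f x)" using f by simp
    have "\<bar>f x\<bar> * \<bar>f x\<bar> \<le> \<bar>B\<bar> * \<bar>f x\<bar>" for x
      using B[of x] by (intro mult_right_mono) auto
    then show "AE x in lborel. norm ((norm (f x))\<^sup>2) \<le> norm (B * f x)"
      by (intro AE_I2) (simp add: power2_eq_square abs_mult)
  qed measurable
qed

lemma fourier_integral_dilate:
  assumes "a > 0"
  shows "fourier_integral (\<lambda>x. f (x / a)) \<xi> = of_real a * fourier_integral f (a * \<xi>)"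
proof -
  have "fourier_integral (\<lambda>x. f (x / a)) \<xi> = \<bar>a\<bar> *\<^sub>R (\<integral>x. of_real (f ((0 + a * x) / a)) * cis (- ((0 + a * x) * \<xi>)) \<partial>lborel)"
    unfolding fourier_integral_def by (rule lborel_integral_real_affine) (use assms in auto)
  then show ?thesis using assms by (simp add: fourier_integral_def scaleR_conv_of_real mult_ac)
qed

lemma integral_sinc_power_pos: "0 < (\<integral>x. sinc x ^ (2 * p + 2) \<partial>lborel)"
proof -
  define \<psi> where "\<psi> = (\<lambda>x. sinc x ^ (2 * p + 2))"
  have [measurable]: "\<psi> \<in> borel_measurable borel" unfolding \<psi>_def by measurable
  have nn: "\<psi> x \<ge> 0" for x unfolding \<psi>_def by (rule zero_le_even_power) simp
  have int: "integrable lborel \<psi>"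
  proof (rule Bochner_Integration.integrable_bound)
    show "integrable lborel (\<lambda>x::real. 4 * (1 / (1 + x\<^sup>2)))"
      by (intro integrable_mult_right integrable_inverse_one_plus_square)
    show "AE x in lborel. norm (\<psi> x) \<le> norm (4 * (1 / (1 + x\<^sup>2)))"
    proof (rule AE_I2)
      fix x :: real
      have "\<bar>\<psi> x\<bar> \<le> (1 + \<bar>x\<bar> ^ (2 * p)) * \<bar>\<psi> x\<bar>" by (simp add: distrib_right)
      also have "\<dots> \<le> 4 / (1 + x\<^sup>2)" unfolding \<psi>_def by (rule sinc_power_bound) simp
      finally show "norm (\<psi> x) \<le> norm (4 * (1 / (1 + x\<^sup>2)))" by simp
    qed
  qed measurable
  have "integral\<^sup>L lborel \<psi> \<noteq> 0"
  proof
    assume "integral\<^sup>L lborel \<psi> = 0"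
    then have "AE x in lborel. \<psi> x = 0" using integral_nonneg_eq_0_iff_AE[OF int] nn by simp
    then have "emeasure lborel {x. \<psi> x \<noteq> 0} = 0" by (subst (asm) AE_iff_measurable) auto
    moreover have "{0<..<1} \<subseteq> {x. \<psi> x \<noteq> 0}"
    proof
      fix x :: real assume "x \<in> {0<..<1}"
      then have "sin x > 0" "x \<noteq> 0" using pi_gt3 by (auto intro!: sin_gt_zero)
      then show "x \<in> {x. \<psi> x \<noteq> 0}" by (simp add: \<psi>_def)
    qed
    then have "emeasure lborel {0<..<1::real} \<le> emeasure lborel {x. \<psi> x \<noteq> 0}" by (rule emeasure_mono) measurable
    ultimately show False by simp
  qed
  moreover have "integral\<^sup>L lborel \<psi> \<ge> 0" using nn by simp
  ultimately show ?thesis unfolding \<psi>_def by linarith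
qed

text \<open>The coefficients are those by which the Jackson kernel combines its dilates.\<close>

lemma one_minus_power_eq:
  fixes w :: complex
  shows "(1 - w) ^ k = 1 - (\<Sum>j=1..k. of_real ((-1) ^ Suc j * real (k choose j)) * w ^ j)"
proof -
  have "(1 - w) ^ k = (\<Sum>j\<le>k. of_nat (k choose j) * (- w) ^ j * 1 ^ (k - j))"
    using binomial_ring[of "-w" 1 k] by simp
  also have "\<dots> = (\<Sum>j\<le>k. of_real ((-1) ^ j * real (k choose j)) * w ^ j)"
    by (intro sum.cong refl) (simp add: power_minus[of w])
  also have "{..k} = insert 0 {1..k}" by auto
  also have "(\<Sum>j\<in>insert 0 {1..k}. of_real ((-1) ^ j * real (k choose j)) * w ^ j)
     = 1 + (\<Sum>j=1..k. of_real ((-1) ^ j * real (k choose j)) * w ^ j)" by simp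
  also have "\<dots> = 1 - (\<Sum>j=1..k. of_real ((-1) ^ Suc j * real (k choose j)) * w ^ j)"
    by (simp add: sum_negf)
  finally show ?thesis .
qed

text \<open>Let \<open>\<psi>\<close> be an even power of \<open>sinc\<close> that is integrable against \<open>|x|^k\<close>, with integral \<open>\<kappa>\<close>.
  The kernel \<open>\<phi>\<close> combines the dilates \<open>\<psi>(x / j) / j\<close> with signed binomial coefficients, so that
  \<open>\<kappa> (1 - \<phi>^(\<xi>)) = \<integral> \<psi>(x) (1 - e^{-i x \<xi>})^k dx\<close>.  The integrand is at most \<open>2^k \<psi>(x)\<close> and at
  most \<open>\<psi>(x) |x \<xi>|^k\<close>, which gives the two bounds on the multiplier.  Since \<open>\<psi>\<close> is the transform of
  a spline, \<open>\<phi>\<close> is a Fourier integral of a bounded function \<open>\<beta>\<close> with compact support; this makes convolutions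
  with \<open>\<phi>\<close> extend to entire functions.\<close>

lemma jackson_kernel:
  fixes k :: nat
  obtains C R :: real and \<phi> \<beta> :: "real \<Rightarrow> real"
  where "0 < C" "0 < R" "integrable lborel \<phi>" "square_integrable \<phi>"
    "\<beta> \<in> borel_measurable borel" "\<And>\<zeta>. \<bar>\<beta> \<zeta>\<bar> \<le> C" "\<And>\<zeta>. \<zeta> \<notin> {-R..R} \<Longrightarrow> \<beta> \<zeta> = 0"
    "\<And>x. of_real (\<phi> x) = (\<integral>\<zeta>. of_real (\<beta> \<zeta>) * cis (\<zeta> * x) \<partial>lborel)"
    "\<And>\<xi>. cmod (1 - fourier_integral \<phi> \<xi>) \<le> C" "\<And>\<xi>. cmod (1 - fourier_integral \<phi> \<xi>) \<le> C * \<bar>\<xi>\<bar> ^ k"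
proof -
  \<comment> \<open>Even, so that the power of \<open>sinc\<close> is nonnegative, and at least \<open>k + 2\<close>.\<close>
  define n where "n = Suc (2 * k + 1)"
  define \<psi> where "\<psi> = (\<lambda>x. sinc x ^ n)"
  define \<kappa> where "\<kappa> = (\<integral>x. \<psi> x \<partial>lborel)"
  define M where "M = (\<integral>x. \<psi> x * \<bar>x\<bar> ^ k \<partial>lborel)"
  define c where "c = (\<lambda>j. (-1) ^ Suc j * real (k choose j))"
  have n: "n = 2 * k + 2" by (simp add: n_def)
  have [measurable]: "\<psi> \<in> borel_measurable borel" unfolding \<psi>_def by measurable
  have nn: "\<psi> x \<ge> 0" for x unfolding \<psi>_def n by (rule zero_le_even_power) simp
  have \<kappa>: "\<kappa> > 0" unfolding \<kappa>_def \<psi>_def n by (rule integral_sinc_power_pos)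
  have \<psi>_bound: "\<psi> x * (1 + \<bar>x\<bar> ^ k) \<le> 4 / (1 + x\<^sup>2)" for x
  proof -
    have "\<bar>sinc x ^ n\<bar> = \<psi> x" using abs_of_nonneg[OF nn[of x]] unfolding \<psi>_def .
    moreover have "k + 2 \<le> n" by (simp add: n)
    ultimately show ?thesis using sinc_power_bound[of k n x] by (simp only: mult.commute)
  qed
  have \<psi>1: "\<psi> x \<le> 1" for x
  proof -
    have "\<bar>sinc x\<bar> \<le> 1" using abs_sin_x_le_abs_x[of x] by (cases "x = 0") (auto simp: divide_simps)
    then have "\<bar>sinc x ^ n\<bar> \<le> 1" unfolding power_abs by (intro power_le_one) auto
    then show ?thesis unfolding \<psi>_def by linarith
  qed
  have int4: "integrable lborel (\<lambda>x::real. 4 * (1 / (1 + x\<^sup>2)))"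
    by (intro integrable_mult_right integrable_inverse_one_plus_square)
  have int\<psi>: "integrable lborel \<psi>"
    by (rule Bochner_Integration.integrable_bound[OF int4])
      (use \<psi>_bound nn in \<open>auto intro!: AE_I2 intro: order_trans[OF _ \<psi>_bound] simp: distrib_left\<close>)
  have int\<psi>k: "integrable lborel (\<lambda>x. \<psi> x * \<bar>x\<bar> ^ k)"
    by (rule Bochner_Integration.integrable_bound[OF int4])
      (use \<psi>_bound nn in \<open>auto intro!: AE_I2 intro: order_trans[OF _ \<psi>_bound] simp: distrib_left abs_mult\<close>)
  have M0: "M \<ge> 0" unfolding M_def by (intro Bochner_Integration.integral_nonneg) (simp add: nn)
  obtain b where [measurable]: "b \<in> borel_measurable borel" and b: "\<And>x. \<bar>b x\<bar> \<le> 1" "\<And>x. x \<notin> {- real n..real n} \<Longrightarrow> b x = 0"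
    "\<And>\<xi>. fourier_integral b \<xi> = of_real (\<psi> \<xi>)"
    using ex_spline_with_transform_sinc_power[of "2 * k + 1"] unfolding n_def[symmetric] \<psi>_def by blast
  have intb: "integrable lborel b" by (rule integrable_bounded_compact_support[of _ 1 "real n"]) (use b in auto)
  define \<phi> where "\<phi> = (\<lambda>x. \<Sum>j=1..k. c j / (\<kappa> * real j) * \<psi> (x / real j))"
  define \<beta> where "\<beta> = (\<lambda>\<zeta>. \<Sum>j=1..k. c j / \<kappa> * b (- (real j * \<zeta>)))"
  have int\<psi>j: "integrable lborel (\<lambda>x. \<psi> (x / real j))" if "j \<in> {1..k}" for j
    using lborel_integrable_real_affine[OF int\<psi>, of "1 / real j" 0] that by simp
  have int\<phi>: "integrable lborel \<phi>"
    unfolding \<phi>_def by (intro Bochner_Integration.integrable_sum integrable_mult_right int\<psi>j)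
  have "\<bar>\<phi> x\<bar> \<le> (\<Sum>j=1..k. \<bar>c j / (\<kappa> * real j)\<bar> * 1)" for x
    unfolding \<phi>_def by (intro order_trans[OF sum_abs] sum_mono) (auto simp only: abs_mult intro!: mult_left_mono, use \<psi>1 nn in \<open>auto simp: abs_le_iff intro: order_trans[of _ 0]\<close>)
  then have sq\<phi>: "square_integrable \<phi>" by (rule square_integrable_of_bounded[OF int\<phi>])
  have F\<phi>: "fourier_integral \<phi> \<xi> = (\<Sum>j=1..k. of_real (c j / \<kappa>) * fourier_integral \<psi> (real j * \<xi>))" for \<xi>
  proof -
    have "fourier_integral \<phi> \<xi> = (\<integral>x. (\<Sum>j=1..k. of_real (c j / (\<kappa> * real j)) * (of_real (\<psi> (x / real j)) * cis (- (x * \<xi>)))) \<partial>lborel)"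
      unfolding fourier_integral_def \<phi>_def by (simp add: sum_distrib_right mult.assoc)
    also have "\<dots> = (\<Sum>j=1..k. of_real (c j / (\<kappa> * real j)) * fourier_integral (\<lambda>x. \<psi> (x / real j)) \<xi>)"
      unfolding fourier_integral_def
      by (subst Bochner_Integration.integral_sum) (auto intro!: integrable_mult_right integrable_times_cis int\<psi>j simp del: of_real_divide)
    also have "\<dots> = (\<Sum>j=1..k. of_real (c j / \<kappa>) * fourier_integral \<psi> (real j * \<xi>))"
      by (intro sum.cong refl) (simp add: fourier_integral_dilate)
    finally show ?thesis .
  qed
  have key: "of_real \<kappa> * (1 - fourier_integral \<phi> \<xi>) = (\<integral>x. of_real (\<psi> x) * (1 - cis (- (x * \<xi>))) ^ k \<partial>lborel)" for \<xi>
  proof -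
    have "(\<integral>x. of_real (\<psi> x) * (1 - cis (- (x * \<xi>))) ^ k \<partial>lborel)
       = (\<integral>x. complex_of_real (\<psi> x) - (\<Sum>j=1..k. of_real (c j) * (of_real (\<psi> x) * cis (- (x * (real j * \<xi>))))) \<partial>lborel)"
    proof (rule Bochner_Integration.integral_cong[OF refl])
      fix x
      have "cis (- (x * \<xi>)) ^ j = cis (- (x * (real j * \<xi>)))" for j using Complex.DeMoivre[of "- (x * \<xi>)" j] by (simp add: mult_ac)
      then show "of_real (\<psi> x) * (1 - cis (- (x * \<xi>))) ^ k = complex_of_real (\<psi> x) - (\<Sum>j=1..k. of_real (c j) * (of_real (\<psi> x) * cis (- (x * (real j * \<xi>)))))"
        unfolding one_minus_power_eq c_def right_diff_distrib sum_distrib_left by (simp add: mult_ac)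
    qed
    also have "\<dots> = of_real \<kappa> - (\<Sum>j=1..k. of_real (c j) * fourier_integral \<psi> (real j * \<xi>))"
      unfolding fourier_integral_def \<kappa>_def
      by (subst Bochner_Integration.integral_diff)
        (auto intro!: Bochner_Integration.integrable_sum integrable_mult_right integrable_times_cis int\<psi> integrable_of_real
          simp: Bochner_Integration.integral_sum integrable_times_cis[OF int\<psi>] integral_complex_of_real)
    also have "\<dots> = of_real \<kappa> * (1 - fourier_integral \<phi> \<xi>)"
      unfolding F\<phi> using \<kappa> by (simp add: right_diff_distrib sum_distrib_left)
    finally show ?thesis by simp
  qed
  have bound: "\<kappa> * cmod (1 - fourier_integral \<phi> \<xi>) \<le> (\<integral>x. \<psi> x * B x \<partial>lborel)"
    if B: "\<And>x. cmod (1 - cis (- (x * \<xi>))) ^ k \<le> B x" "integrable lborel (\<lambda>x. \<psi> x * B x)" for B \<xi>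
  proof -
    have [measurable]: "(\<lambda>x. \<psi> x * B x) \<in> borel_measurable borel" using B(2) by auto
    have le: "norm (of_real (\<psi> x) * (1 - cis (- (x * \<xi>))) ^ k) \<le> \<psi> x * B x" for x
      using B(1)[of x] nn[of x] by (simp add: norm_mult norm_power mult_left_mono)
    have "\<kappa> * cmod (1 - fourier_integral \<phi> \<xi>) = cmod (of_real \<kappa> * (1 - fourier_integral \<phi> \<xi>))"
      using \<kappa> by (simp only: norm_mult norm_of_real abs_of_pos)
    also have "\<dots> \<le> (\<integral>x. norm (of_real (\<psi> x) * (1 - cis (- (x * \<xi>))) ^ k) \<partial>lborel)"
      unfolding key by (rule integral_norm_bound)
    also have "\<dots> \<le> (\<integral>x. \<psi> x * B x \<partial>lborel)"
    proof (rule integral_mono[OF _ B(2) le])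
      show "integrable lborel (\<lambda>x. norm (of_real (\<psi> x) * (1 - cis (- (x * \<xi>))) ^ k))"
        by (rule Bochner_Integration.integrable_bound[OF B(2)]) (use le in \<open>auto intro!: AE_I2 intro: order_trans[OF _ abs_ge_self]\<close>)
    qed
    finally show ?thesis .
  qed
  have b1: "cmod (1 - fourier_integral \<phi> \<xi>) \<le> 2 ^ k" for \<xi>
  proof -
    have "\<kappa> * cmod (1 - fourier_integral \<phi> \<xi>) \<le> (\<integral>x. \<psi> x * 2 ^ k \<partial>lborel)"
      by (rule bound) (auto intro!: power_mono cmod_one_minus_cis_le int\<psi>)
    also have "\<dots> = \<kappa> * 2 ^ k" by (simp add: \<kappa>_def)
    finally show ?thesis using \<kappa> by simp
  qed
  have b2: "cmod (1 - fourier_integral \<phi> \<xi>) \<le> M / \<kappa> * \<bar>\<xi>\<bar> ^ k" for \<xi>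
  proof -
    have eq: "\<psi> x * \<bar>x * \<xi>\<bar> ^ k = \<psi> x * \<bar>x\<bar> ^ k * \<bar>\<xi>\<bar> ^ k" for x by (simp add: abs_mult power_mult_distrib)
    have "\<kappa> * cmod (1 - fourier_integral \<phi> \<xi>) \<le> (\<integral>x. \<psi> x * \<bar>x * \<xi>\<bar> ^ k \<partial>lborel)"
    proof (rule bound)
      show "cmod (1 - cis (- (x * \<xi>))) ^ k \<le> \<bar>x * \<xi>\<bar> ^ k" for x
        using cmod_one_minus_cis_le(1)[of "- (x * \<xi>)"] by (intro power_mono) auto
      show "integrable lborel (\<lambda>x. \<psi> x * \<bar>x * \<xi>\<bar> ^ k)" unfolding eq by (intro integrable_mult_left int\<psi>k)
    qed
    also have "\<dots> = M * \<bar>\<xi>\<bar> ^ k" unfolding eq M_def by simp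
    finally show ?thesis using \<kappa> by (simp add: field_simps)
  qed
  have rep: "of_real (\<phi> x) = (\<integral>\<zeta>. of_real (\<beta> \<zeta>) * cis (\<zeta> * x) \<partial>lborel)" for x
  proof -
    have trm: "(\<integral>\<zeta>. of_real (b (- (real j * \<zeta>))) * cis (\<zeta> * x) \<partial>lborel) = of_real (\<psi> (x / real j) / real j)"
      and trmi: "integrable lborel (\<lambda>\<zeta>. of_real (b (- (real j * \<zeta>))) * cis (\<zeta> * x))" if "j \<in> {1..k}" for j
    proof -
      have j: "real j > 0" using that by simp
      have "of_real (\<psi> (x / real j)) = (\<integral>\<eta>. of_real (b \<eta>) * cis (- (\<eta> * (x / real j))) \<partial>lborel)"
        using b(3)[of "x / real j"] by (simp add: fourier_integral_def)
      also have "\<dots> = \<bar>- real j\<bar> *\<^sub>R (\<integral>\<zeta>. of_real (b (0 + - real j * \<zeta>)) * cis (- ((0 + - real j * \<zeta>) * (x / real j))) \<partial>lborel)"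
        by (rule lborel_integral_real_affine) (use j in auto)
      finally show "(\<integral>\<zeta>. of_real (b (- (real j * \<zeta>))) * cis (\<zeta> * x) \<partial>lborel) = of_real (\<psi> (x / real j) / real j)"
        using j by (simp add: scaleR_conv_of_real)
      have "integrable lborel (\<lambda>\<zeta>. b (- (real j * \<zeta>)))"
        using lborel_integrable_real_affine[OF intb, of "- real j" 0] j by simp
      from integrable_times_cis(1)[OF this, of x]
      show "integrable lborel (\<lambda>\<zeta>. of_real (b (- (real j * \<zeta>))) * cis (\<zeta> * x))" by (simp add: mult.commute)
    qed
    have "(\<integral>\<zeta>. of_real (\<beta> \<zeta>) * cis (\<zeta> * x) \<partial>lborel) = (\<integral>\<zeta>. (\<Sum>j=1..k. of_real (c j / \<kappa>) * (of_real (b (- (real j * \<zeta>))) * cis (\<zeta> * x))) \<partial>lborel)"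
      unfolding \<beta>_def by (simp add: sum_distrib_right mult.assoc)
    also have "\<dots> = (\<Sum>j=1..k. of_real (c j / \<kappa>) * of_real (\<psi> (x / real j) / real j))"
      by (subst Bochner_Integration.integral_sum) (auto intro!: integrable_mult_right trmi simp: trm simp del: of_real_divide)
    also have "\<dots> = of_real (\<phi> x)" by (simp add: \<phi>_def mult_ac)
    finally show ?thesis by simp
  qed
  define C where "C = 2 ^ k + M / \<kappa> + (\<Sum>j=1..k. \<bar>c j / \<kappa>\<bar>)"
  have s0: "(\<Sum>j=1..k. \<bar>c j / \<kappa>\<bar>) \<ge> 0" "M / \<kappa> \<ge> 0" using \<kappa> M0 by (auto intro: sum_nonneg)
  have C: "0 < C" unfolding C_def using s0 by (simp add: add_pos_nonneg)
  have \<beta>1: "\<bar>\<beta> \<zeta>\<bar> \<le> C" for \<zeta>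
  proof -
    have "\<bar>\<beta> \<zeta>\<bar> \<le> (\<Sum>j=1..k. \<bar>c j / \<kappa>\<bar> * 1)"
      unfolding \<beta>_def by (intro order_trans[OF sum_abs] sum_mono) (simp only: abs_mult, intro mult_left_mono b, auto)
    then show ?thesis using s0 zero_le_power[of "2::real" k] unfolding C_def mult_1_right by linarith
  qed
  have \<beta>2: "\<beta> \<zeta> = 0" if "\<zeta> \<notin> {- real n..real n}" for \<zeta>
  proof -
    have "b (- (real j * \<zeta>)) = 0" if "j \<in> {1..k}" for j
    proof (rule b(2))
      have "real n < \<bar>\<zeta>\<bar>" using \<open>\<zeta> \<notin> _\<close> by auto
      also have "\<dots> \<le> real j * \<bar>\<zeta>\<bar>" using that mult_right_mono[of 1 "real j" "\<bar>\<zeta>\<bar>"] by simp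
      finally have "real n < \<bar>- (real j * \<zeta>)\<bar>" by (simp add: abs_mult)
      then show "- (real j * \<zeta>) \<notin> {- real n..real n}" by auto
    qed
    then show ?thesis by (simp add: \<beta>_def)
  qed
  have m1: "cmod (1 - fourier_integral \<phi> \<xi>) \<le> C" for \<xi>
    using b1[of \<xi>] s0 by (simp add: C_def)
  have m2: "cmod (1 - fourier_integral \<phi> \<xi>) \<le> C * \<bar>\<xi>\<bar> ^ k" for \<xi>
  proof -
    have "M / \<kappa> * \<bar>\<xi>\<bar> ^ k \<le> C * \<bar>\<xi>\<bar> ^ k" using s0 zero_le_power[of "2::real" k] unfolding C_def by (intro mult_right_mono) (linarith, simp)
    then show ?thesis using b2[of \<xi>] by simp
  qed
  have \<beta>m: "\<beta> \<in> borel_measurable borel" unfolding \<beta>_def by measurable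
  have n0: "0 < real n" by (simp add: n_def)
  show ?thesis by (rule that[OF C n0 int\<phi> sq\<phi> \<beta>m \<beta>1 \<beta>2 rep m1 m2])
qed

lemma integrable_mult_of_square_integrable:
  fixes b :: "real \<Rightarrow> real" and f :: "real \<Rightarrow> complex"
  assumes "square_integrable b" "square_integrable f"
  shows "integrable lborel (\<lambda>x. of_real (b x) * f x)"
proof (rule Bochner_Integration.integrable_bound)
  have [measurable]: "b \<in> borel_measurable borel" "f \<in> borel_measurable borel"
    using assms by (auto simp: square_integrable_iff)
  show "integrable lborel (\<lambda>x. (norm (b x))\<^sup>2 + (norm (f x))\<^sup>2)"
    using assms by (auto simp: square_integrable_def)
  show "(\<lambda>x. of_real (b x) * f x) \<in> borel_measurable lborel" by measurable
  have "u * v \<le> u\<^sup>2 + v\<^sup>2" if "0 \<le> u" "0 \<le> v" for u v :: real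
    using zero_le_power2[of "u - v"] mult_nonneg_nonneg[OF that] by (simp only: power2_diff)
  then show "AE x in lborel. norm (of_real (b x) * f x) \<le> norm ((norm (b x))\<^sup>2 + (norm (f x))\<^sup>2)"
    by (intro AE_I2) (simp only: norm_mult norm_of_real real_norm_def norm_ge_zero abs_ge_zero zero_le_power2 add_nonneg_nonneg abs_of_nonneg)
qed

text \<open>Expanding the exponential and integrating term by term gives an everywhere convergent power series.\<close>

lemma exp_fourier_entire:
  fixes w :: "real \<Rightarrow> complex"
  assumes w: "integrable lborel w" and supp: "\<And>\<zeta>. \<zeta> \<notin> {-R..R} \<Longrightarrow> w \<zeta> = 0"
  shows "(\<lambda>z. \<integral>\<zeta>. w \<zeta> * exp (\<i> * of_real \<zeta> * z) \<partial>lborel) holomorphic_on UNIV"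
    and "cmod (\<integral>\<zeta>. w \<zeta> * exp (\<i> * of_real \<zeta> * z) \<partial>lborel) \<le> exp (R * \<bar>Im z\<bar>) * (\<integral>\<zeta>. cmod (w \<zeta>) \<partial>lborel)"
proof -
  have [measurable]: "w \<in> borel_measurable borel" using w by auto
  define a where "a = (\<lambda>n. \<integral>\<zeta>. w \<zeta> * ((\<i> * of_real \<zeta>) ^ n /\<^sub>R fact n) \<partial>lborel)"
  have bnd: "norm (w \<zeta> * ((\<i> * of_real \<zeta> * z) ^ n /\<^sub>R fact n)) \<le> cmod (w \<zeta>) * ((\<bar>R\<bar> * cmod z) ^ n / fact n)" for \<zeta> z n
  proof (cases "\<zeta> \<in> {-R..R}")
    case True
    then have "\<bar>\<zeta>\<bar> * cmod z \<le> \<bar>R\<bar> * cmod z" by (intro mult_right_mono) auto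
    then have "(\<bar>\<zeta>\<bar> * cmod z) ^ n \<le> (\<bar>R\<bar> * cmod z) ^ n" by (intro power_mono) auto
    then show ?thesis
      by (simp add: norm_mult norm_power divide_inverse[symmetric] mult_left_mono divide_right_mono mult.commute[of "inverse (fact n)"])
  qed (simp add: supp)
  have int: "integrable lborel (\<lambda>\<zeta>. w \<zeta> * ((\<i> * of_real \<zeta> * z) ^ n /\<^sub>R fact n))" for z n
  proof (rule Bochner_Integration.integrable_bound)
    show "integrable lborel (\<lambda>\<zeta>. cmod (w \<zeta>) * ((\<bar>R\<bar> * cmod z) ^ n / fact n))" using w by auto
    show "AE \<zeta> in lborel. norm (w \<zeta> * ((\<i> * of_real \<zeta> * z) ^ n /\<^sub>R fact n)) \<le> norm (cmod (w \<zeta>) * ((\<bar>R\<bar> * cmod z) ^ n / fact n))"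
      using bnd[where z = z and n = n] by (intro AE_I2) (auto intro: order_trans[OF _ abs_ge_self])
  qed measurable
  have sums: "(\<lambda>n. a n * z ^ n) sums (\<integral>\<zeta>. w \<zeta> * exp (\<i> * of_real \<zeta> * z) \<partial>lborel)" for z
  proof -
    define f where "f = (\<lambda>n \<zeta>. w \<zeta> * ((\<i> * of_real \<zeta> * z) ^ n /\<^sub>R fact n))"
    have sumR: "summable (\<lambda>n. c * ((\<bar>R\<bar> * cmod z) ^ n / fact n))" for c :: real
      using summable_mult[OF summable_exp[of "\<bar>R\<bar> * cmod z"], of c] by (simp add: divide_inverse mult.commute)
    have sumf: "(\<lambda>n. f n \<zeta>) sums (w \<zeta> * exp (\<i> * of_real \<zeta> * z))" for \<zeta>
      unfolding f_def by (intro sums_mult exp_converges)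
    have "(\<lambda>n. integral\<^sup>L lborel (f n)) sums (\<integral>\<zeta>. (\<Sum>n. f n \<zeta>) \<partial>lborel)"
    proof (rule sums_integral)
      show "integrable lborel (f n)" for n unfolding f_def by (rule int)
      show "AE \<zeta> in lborel. summable (\<lambda>n. norm (f n \<zeta>))"
      proof (rule AE_I2)
        fix \<zeta>
        show "summable (\<lambda>n. norm (f n \<zeta>))"
          by (rule summable_comparison_test[OF _ sumR[of "cmod (w \<zeta>)"]]) (use bnd in \<open>auto simp: f_def\<close>)
      qed
      show "summable (\<lambda>n. \<integral>\<zeta>. norm (f n \<zeta>) \<partial>lborel)"
      proof (rule summable_comparison_test[OF _ sumR[of "\<integral>\<zeta>. cmod (w \<zeta>) \<partial>lborel"]], intro exI[of _ 0] allI impI)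
        fix n :: nat
        have "(\<integral>\<zeta>. norm (f n \<zeta>) \<partial>lborel) \<le> (\<integral>\<zeta>. cmod (w \<zeta>) * ((\<bar>R\<bar> * cmod z) ^ n / fact n) \<partial>lborel)"
        proof (rule integral_mono)
          show "integrable lborel (\<lambda>\<zeta>. norm (f n \<zeta>))" unfolding f_def by (rule integrable_norm[OF int])
          show "integrable lborel (\<lambda>\<zeta>. cmod (w \<zeta>) * ((\<bar>R\<bar> * cmod z) ^ n / fact n))"
            by (rule integrable_mult_left) (rule integrable_norm[OF w])
          show "norm (f n \<zeta>) \<le> cmod (w \<zeta>) * ((\<bar>R\<bar> * cmod z) ^ n / fact n)" for \<zeta> unfolding f_def by (rule bnd)
        qed
        then show "norm (\<integral>\<zeta>. norm (f n \<zeta>) \<partial>lborel) \<le> (\<integral>\<zeta>. cmod (w \<zeta>) \<partial>lborel) * ((\<bar>R\<bar> * cmod z) ^ n / fact n)"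
          by simp
      qed
    qed
    moreover have "(\<Sum>n. f n \<zeta>) = w \<zeta> * exp (\<i> * of_real \<zeta> * z)" for \<zeta> using sumf sums_unique by metis
    moreover have "integral\<^sup>L lborel (f n) = a n * z ^ n" for n
    proof -
      have "f n = (\<lambda>\<zeta>. w \<zeta> * ((\<i> * of_real \<zeta>) ^ n /\<^sub>R fact n) * z ^ n)"
        unfolding f_def by (simp add: power_mult_distrib scaleR_conv_of_real mult_ac)
      then show ?thesis unfolding a_def by (simp only: integral_mult_left_zero)
    qed
    ultimately show ?thesis by simp
  qed
  show "(\<lambda>z. \<integral>\<zeta>. w \<zeta> * exp (\<i> * of_real \<zeta> * z) \<partial>lborel) holomorphic_on UNIV"
  proof -
    have "(\<lambda>z. \<integral>\<zeta>. w \<zeta> * exp (\<i> * of_real \<zeta> * z) \<partial>lborel) holomorphic_on ball 0 r" for r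
      by (rule power_series_holomorphic[of _ _ a]) (use sums in simp)
    then have "(\<lambda>z. \<integral>\<zeta>. w \<zeta> * exp (\<i> * of_real \<zeta> * z) \<partial>lborel) field_differentiable at z" for z
      using holomorphic_on_imp_differentiable_at[OF _ open_ball, of _ 0 "cmod z + 1" z] by auto
    then show ?thesis by (simp add: holomorphic_on_def)
  qed
  have le: "cmod (w \<zeta> * exp (\<i> * of_real \<zeta> * z)) \<le> cmod (w \<zeta>) * exp (R * \<bar>Im z\<bar>)" for \<zeta>
  proof (cases "\<zeta> \<in> {-R..R}")
    case True
    have "- (\<zeta> * Im z) \<le> \<bar>\<zeta>\<bar> * \<bar>Im z\<bar>" unfolding abs_mult[symmetric] by simp
    also have "\<dots> \<le> R * \<bar>Im z\<bar>" using True by (intro mult_right_mono) auto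
    finally show ?thesis by (simp add: norm_mult mult_left_mono)
  qed (simp add: supp)
  have "cmod (\<integral>\<zeta>. w \<zeta> * exp (\<i> * of_real \<zeta> * z) \<partial>lborel) \<le> (\<integral>\<zeta>. cmod (w \<zeta> * exp (\<i> * of_real \<zeta> * z)) \<partial>lborel)"
    by (rule integral_norm_bound)
  also have "\<dots> \<le> (\<integral>\<zeta>. cmod (w \<zeta>) * exp (R * \<bar>Im z\<bar>) \<partial>lborel)"
  proof (rule integral_mono[OF _ _ le])
    show i: "integrable lborel (\<lambda>\<zeta>. cmod (w \<zeta>) * exp (R * \<bar>Im z\<bar>))" using w by auto
    show "integrable lborel (\<lambda>\<zeta>. cmod (w \<zeta> * exp (\<i> * of_real \<zeta> * z)))"
      by (rule Bochner_Integration.integrable_bound[OF i]) (use le in \<open>auto simp: norm_mult intro!: AE_I2\<close>)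
  qed
  finally show "cmod (\<integral>\<zeta>. w \<zeta> * exp (\<i> * of_real \<zeta> * z) \<partial>lborel) \<le> exp (R * \<bar>Im z\<bar>) * (\<integral>\<zeta>. cmod (w \<zeta>) \<partial>lborel)"
    by (simp add: mult.commute)
qed

text \<open>Convolution with a kernel whose transform has compact support, expressed through the transform of \<open>F\<close>.
  For truncations of \<open>F\<close> this is Fubini's theorem; both sides are continuous with respect to the limit in
  the mean, the left side by dominated convergence and the right side by Cauchy-Schwarz.  The formula provides
  the analytic continuation of the convolution with a bound in terms of the transform of \<open>F\<close>.\<close>

lemma band_limited_convolution:
  assumes F: "is_fourier_transform F g"
    and \<phi>: "square_integrable \<phi>" and \<beta>: "integrable lborel \<beta>" "square_integrable \<beta>"
    and rep: "\<And>x. of_real (\<phi> x) = (\<integral>\<zeta>. of_real (\<beta> \<zeta>) * cis (\<zeta> * x) \<partial>lborel)"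
  shows "of_real (line_convolution F \<phi> y) = of_real (sqrt (2 * pi)) * (\<integral>\<zeta>. of_real (\<beta> \<zeta>) * g \<zeta> * cis (\<zeta> * y) \<partial>lborel)"
proof -
  note [measurable] = is_fourier_transform_measurable[OF F] square_integrable_measurable[OF \<phi>] square_integrable_measurable[OF \<beta>(2)]
  have sqF: "square_integrable F" and sqg: "square_integrable g" using F by (auto simp: is_fourier_transform_def)
  define ind where "ind = (\<lambda>n x. indicator {- real n..real n} x :: real)"
  define P where "P = (\<lambda>n. \<integral>x. ind n (y - x) * F (y - x) * \<phi> x \<partial>lborel)"
  have "P \<longlonglongrightarrow> line_convolution F \<phi> y"
    unfolding P_def line_convolution_def
  proof (rule integral_dominated_convergence)
    show "integrable lborel (\<lambda>x. \<bar>F (y - x) * \<phi> x\<bar>)" using integrable_convolution_integrand[OF sqF \<phi>, of y] by auto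
    show "AE x in lborel. norm (ind n (y - x) * F (y - x) * \<phi> x) \<le> \<bar>F (y - x) * \<phi> x\<bar>" for n
      by (intro AE_I2) (auto simp: ind_def indicator_def)
    show "AE x in lborel. (\<lambda>n. ind n (y - x) * F (y - x) * \<phi> x) \<longlonglongrightarrow> F (y - x) * \<phi> x"
    proof (rule AE_I2)
      fix x
      obtain N :: nat where N: "\<bar>y - x\<bar> \<le> real N" using real_arch_simple by blast
      have "eventually (\<lambda>n. ind n (y - x) * F (y - x) * \<phi> x = F (y - x) * \<phi> x) sequentially"
        unfolding eventually_sequentially using N by (intro exI[of _ N]) (auto simp: indicator_def ind_def)
      then show "(\<lambda>n. ind n (y - x) * F (y - x) * \<phi> x) \<longlonglongrightarrow> F (y - x) * \<phi> x" by (rule tendsto_eventually)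
    qed
    show "(\<lambda>x. ind n (y - x) * F (y - x) * \<phi> x) \<in> borel_measurable lborel" for n unfolding ind_def by measurable
  qed measurable
  then have lim1: "(\<lambda>n. complex_of_real (P n)) \<longlonglongrightarrow> of_real (line_convolution F \<phi> y)" by (rule tendsto_of_real)
  define Q where "Q = (\<integral>\<zeta>. of_real (\<beta> \<zeta>) * g \<zeta> * cis (\<zeta> * y) \<partial>lborel)"
  define s2 where "s2 = sqrt (2 * pi)"
  have s2: "s2 > 0" by (simp add: s2_def)
  have P_eq: "of_real (P n) = of_real s2 * (\<integral>\<zeta>. of_real (\<beta> \<zeta>) * truncated_fourier F n \<zeta> * cis (\<zeta> * y) \<partial>lborel)" for n
  proof -
    define Fn where "Fn = (\<lambda>x. ind n x * F x)"
    have intFn: "integrable lborel Fn" unfolding Fn_def ind_def by (rule square_integrable_imp_truncation_integrable[OF sqF])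
    then have [measurable]: "Fn \<in> borel_measurable borel" by auto
    have "P n = (\<integral>x. Fn x * \<phi> (y - x) \<partial>lborel)"
      unfolding P_def Fn_def using lborel_integral_real_affine[of "-1" "\<lambda>x. ind n x * F x * \<phi> (y - x)" y] by simp
    then have "of_real (P n) = (\<integral>x. complex_of_real (Fn x) * of_real (\<phi> (y - x)) \<partial>lborel)"
      by (simp add: integral_complex_of_real[symmetric])
    also have "\<dots> = (\<integral>x. \<integral>\<zeta>. of_real (Fn x) * (of_real (\<beta> \<zeta>) * cis (\<zeta> * (y - x))) \<partial>lborel \<partial>lborel)"
      unfolding rep by simp
    also have "\<dots> = (\<integral>\<zeta>. \<integral>x. of_real (Fn x) * (of_real (\<beta> \<zeta>) * cis (\<zeta> * (y - x))) \<partial>lborel \<partial>lborel)"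
    proof (rule lborel_pair.Fubini_integral)
      show "integrable (lborel \<Otimes>\<^sub>M lborel) (\<lambda>(\<zeta>, x). of_real (Fn x) * (of_real (\<beta> \<zeta>) * cis (\<zeta> * (y - x))))"
        by (rule integrable_pair_of_product_bound[of "\<lambda>\<zeta>. \<bar>\<beta> \<zeta>\<bar>" "\<lambda>x. \<bar>Fn x\<bar>"]) (use intFn \<beta> in \<open>auto simp: norm_mult\<close>)
    qed
    also have "\<dots> = (\<integral>\<zeta>. of_real (\<beta> \<zeta>) * cis (\<zeta> * y) * fourier_integral Fn \<zeta> \<partial>lborel)"
    proof (rule Bochner_Integration.integral_cong[OF refl])
      fix \<zeta>
      have "of_real (Fn x) * (of_real (\<beta> \<zeta>) * cis (\<zeta> * (y - x))) = of_real (\<beta> \<zeta>) * cis (\<zeta> * y) * (of_real (Fn x) * cis (- (x * \<zeta>)))" for x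
      proof -
        have "cis (\<zeta> * (y - x)) = cis (\<zeta> * y) * cis (- (x * \<zeta>))" by (simp add: cis_mult algebra_simps)
        then show ?thesis by (simp only: mult_ac)
      qed
      then show "(\<integral>x. of_real (Fn x) * (of_real (\<beta> \<zeta>) * cis (\<zeta> * (y - x))) \<partial>lborel) = of_real (\<beta> \<zeta>) * cis (\<zeta> * y) * fourier_integral Fn \<zeta>"
        unfolding fourier_integral_def by (simp only: integral_mult_right_zero)
    qed
    also have "\<dots> = (\<integral>\<zeta>. of_real s2 * (of_real (\<beta> \<zeta>) * truncated_fourier F n \<zeta> * cis (\<zeta> * y)) \<partial>lborel)"
      unfolding truncated_fourier_eq Fn_def ind_def s2_def[symmetric] using s2 by (simp add: mult_ac)
    finally show ?thesis by (simp only: integral_mult_right_zero)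
  qed
  have sqT: "square_integrable (truncated_fourier F n)" for n
  proof -
    have i: "integrable lborel (\<lambda>x. indicator {- real n..real n} x * F x)" by (rule square_integrable_imp_truncation_integrable[OF sqF])
    have "square_integrable (\<lambda>x. indicator {- real n..real n} x * F x)"
      by (rule square_integrable_bound[OF sqF, of _ 1]) (auto simp: indicator_def)
    then have "sq_integral (fourier_integral (\<lambda>x. indicator {- real n..real n} x * F x)) < \<infinity>"
      by (intro le_less_trans[OF bessel_inequality[OF i]]) (auto simp: square_integrable_iff ennreal_mult_less_top)
    then have "square_integrable (fourier_integral (\<lambda>x. indicator {- real n..real n} x * F x))" by (simp add: square_integrable_iff)
    then show ?thesis
      by (rule square_integrable_bound[where c = "1 / sqrt (2 * pi)"]) (auto simp: truncated_fourier_eq norm_mult norm_divide)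
  qed
  have int\<beta>: "integrable lborel (\<lambda>\<zeta>. of_real (\<beta> \<zeta>) * f \<zeta> * cis (\<zeta> * y))" if "square_integrable f" for f :: "real \<Rightarrow> complex"
  proof -
    have [measurable]: "f \<in> borel_measurable borel" using that by (simp add: square_integrable_iff)
    show ?thesis
      by (rule Bochner_Integration.integrable_bound[OF integrable_mult_of_square_integrable[OF \<beta>(2) that]]) (auto simp: norm_mult)
  qed
  define d where "d = (\<lambda>n. cmod ((\<integral>\<zeta>. of_real (\<beta> \<zeta>) * truncated_fourier F n \<zeta> * cis (\<zeta> * y) \<partial>lborel) - Q))"
  have le: "ennreal ((d n)\<^sup>2) \<le> sq_integral \<beta> * sq_integral (\<lambda>\<zeta>. g \<zeta> - truncated_fourier F n \<zeta>)" for n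
  proof -
    have "(\<integral>\<zeta>. of_real (\<beta> \<zeta>) * truncated_fourier F n \<zeta> * cis (\<zeta> * y) \<partial>lborel) - Q
       = (\<integral>\<zeta>. of_real (\<beta> \<zeta>) * (truncated_fourier F n \<zeta> - g \<zeta>) * cis (\<zeta> * y) \<partial>lborel)"
      unfolding Q_def Bochner_Integration.integral_diff[OF int\<beta>[OF sqT] int\<beta>[OF sqg], symmetric] by (simp add: algebra_simps)
    then have "ennreal (d n) \<le> (\<integral>\<^sup>+\<zeta>. ennreal (norm (of_real (\<beta> \<zeta>) * (truncated_fourier F n \<zeta> - g \<zeta>) * cis (\<zeta> * y))) \<partial>lborel)"
      unfolding d_def by (simp only: ennreal_norm_integral_le)
    also have "\<dots> = (\<integral>\<^sup>+\<zeta>. ennreal (norm (\<beta> \<zeta>)) * ennreal (norm (g \<zeta> - truncated_fourier F n \<zeta>)) \<partial>lborel)"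
      by (intro nn_integral_cong) (simp add: norm_mult ennreal_mult norm_minus_commute)
    finally have "(ennreal (d n))\<^sup>2 \<le> (\<integral>\<^sup>+\<zeta>. ennreal (norm (\<beta> \<zeta>)) * ennreal (norm (g \<zeta> - truncated_fourier F n \<zeta>)) \<partial>lborel)\<^sup>2"
      by (intro power_mono) auto
    also have "\<dots> \<le> (\<integral>\<^sup>+\<zeta>. (ennreal (norm (\<beta> \<zeta>)))\<^sup>2 \<partial>lborel) * (\<integral>\<^sup>+\<zeta>. (ennreal (norm (g \<zeta> - truncated_fourier F n \<zeta>)))\<^sup>2 \<partial>lborel)"
      by (rule Cauchy_Schwarz_nn_integral) measurable
    finally show ?thesis by (simp add: sq_integral_def ennreal_power d_def)
  qed
  have "(\<lambda>n. sq_integral \<beta> * sq_integral (\<lambda>\<zeta>. g \<zeta> - truncated_fourier F n \<zeta>)) \<longlonglongrightarrow> sq_integral \<beta> * 0"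
    using F \<beta>(2) by (intro ennreal_tendsto_cmult) (auto simp: is_fourier_transform_altdef square_integrable_iff)
  then have "(\<lambda>n. sq_integral \<beta> * sq_integral (\<lambda>\<zeta>. g \<zeta> - truncated_fourier F n \<zeta>)) \<longlonglongrightarrow> 0" by simp
  then have "(\<lambda>n. ennreal ((d n)\<^sup>2)) \<longlonglongrightarrow> 0"
    by (rule tendsto_sandwich[OF _ _ tendsto_const, rotated 2]) (auto intro!: always_eventually le)
  then have "(\<lambda>n. (d n)\<^sup>2) \<longlonglongrightarrow> 0" by (simp add: ennreal_tendsto_0_iff)
  then have "(\<lambda>n. sqrt ((d n)\<^sup>2)) \<longlonglongrightarrow> sqrt 0" by (rule tendsto_real_sqrt)
  then have "d \<longlonglongrightarrow> 0" by (simp add: d_def)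
  then have "(\<lambda>n. (\<integral>\<zeta>. of_real (\<beta> \<zeta>) * truncated_fourier F n \<zeta> * cis (\<zeta> * y) \<partial>lborel) - Q) \<longlonglongrightarrow> 0"
    unfolding d_def by (rule tendsto_norm_zero_cancel)
  then have "(\<lambda>n. \<integral>\<zeta>. of_real (\<beta> \<zeta>) * truncated_fourier F n \<zeta> * cis (\<zeta> * y) \<partial>lborel) \<longlonglongrightarrow> Q" by (simp add: LIM_zero_iff)
  then have "(\<lambda>n. complex_of_real (P n)) \<longlonglongrightarrow> of_real s2 * Q" unfolding P_eq by (rule tendsto_mult_left)
  from LIMSEQ_unique[OF lim1 this] show ?thesis by (simp add: Q_def s2_def)
qed

section \<open>Band-limited smoothing\<close>

lemma integral_mult_le_sqrt:
  fixes b :: "real \<Rightarrow> real" and f :: "real \<Rightarrow> complex"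
  assumes "square_integrable b" "square_integrable f"
  shows "(\<integral>x. cmod (of_real (b x) * f x) \<partial>lborel) \<le> sqrt (\<integral>x. (b x)\<^sup>2 \<partial>lborel) * sqrt (\<integral>x. (cmod (f x))\<^sup>2 \<partial>lborel)"
proof -
  have [measurable]: "b \<in> borel_measurable borel" "f \<in> borel_measurable borel"
    using assms by (auto simp: square_integrable_iff)
  have ib: "integrable lborel (\<lambda>x. (b x)\<^sup>2)" and iff: "integrable lborel (\<lambda>x. (cmod (f x))\<^sup>2)"
    using assms by (auto simp: square_integrable_def)
  have i: "integrable lborel (\<lambda>x. cmod (of_real (b x) * f x))"
    by (rule integrable_norm[OF integrable_mult_of_square_integrable[OF assms]])
  define X where "X = (\<integral>x. cmod (of_real (b x) * f x) \<partial>lborel)"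
  have X0: "X \<ge> 0" unfolding X_def by simp
  have "ennreal (X\<^sup>2) = (\<integral>\<^sup>+x. ennreal \<bar>b x\<bar> * ennreal (cmod (f x)) \<partial>lborel)\<^sup>2"
  proof -
    have "ennreal X = (\<integral>\<^sup>+x. ennreal (cmod (of_real (b x) * f x)) \<partial>lborel)"
      unfolding X_def by (rule nn_integral_eq_integral[OF i, symmetric]) auto
    also have "\<dots> = (\<integral>\<^sup>+x. ennreal \<bar>b x\<bar> * ennreal (cmod (f x)) \<partial>lborel)"
      by (simp add: norm_mult ennreal_mult)
    finally show ?thesis using X0 by (simp add: ennreal_power[symmetric])
  qed
  also have "\<dots> \<le> (\<integral>\<^sup>+x. (ennreal \<bar>b x\<bar>)\<^sup>2 \<partial>lborel) * (\<integral>\<^sup>+x. (ennreal (cmod (f x)))\<^sup>2 \<partial>lborel)"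
    by (rule Cauchy_Schwarz_nn_integral) measurable
  also have "\<dots> = ennreal (\<integral>x. (b x)\<^sup>2 \<partial>lborel) * ennreal (\<integral>x. (cmod (f x))\<^sup>2 \<partial>lborel)"
    by (simp add: ennreal_power nn_integral_eq_integral[OF ib] nn_integral_eq_integral[OF iff])
  also have "\<dots> = ennreal ((\<integral>x. (b x)\<^sup>2 \<partial>lborel) * (\<integral>x. (cmod (f x))\<^sup>2 \<partial>lborel))"
    by (intro ennreal_mult[symmetric] Bochner_Integration.integral_nonneg) auto
  finally have "X\<^sup>2 \<le> (\<integral>x. (b x)\<^sup>2 \<partial>lborel) * (\<integral>x. (cmod (f x))\<^sup>2 \<partial>lborel)"
    by (subst (asm) ennreal_le_iff) (auto intro!: mult_nonneg_nonneg)
  then have "X \<le> sqrt ((\<integral>x. (b x)\<^sup>2 \<partial>lborel) * (\<integral>x. (cmod (f x))\<^sup>2 \<partial>lborel))" by (rule real_le_rsqrt)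
  then show ?thesis by (simp add: X_def real_sqrt_mult)
qed

text \<open>The Jackson kernel rescaled to \<open>N \<phi>(N x)\<close>.  Up to a constant, the factor \<open>sqrt N\<close> is the \<open>L^2\<close> norm of the
  indicator of the frequency window \<open>[- R N, R N]\<close>.\<close>

lemma band_limited_smoothing:
  "\<exists>C R. 0 < C \<and> 0 < R \<and> (\<forall>N>0. \<forall>F g. is_fourier_transform F g \<longrightarrow>
     (\<exists>H \<mu> E. is_fourier_transform H (\<lambda>\<xi>. \<mu> \<xi> * g \<xi>) \<and> \<mu> \<in> borel_measurable borel \<and>
        (\<forall>\<xi>. cmod (1 - \<mu> \<xi>) \<le> C \<and> cmod (1 - \<mu> \<xi>) \<le> C * (\<bar>\<xi>\<bar> / N) ^ k) \<and>
        E holomorphic_on UNIV \<and> (\<forall>x. E (of_real x) = of_real (H x)) \<and>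
        (\<forall>z. cmod (E z) \<le> C * sqrt N * exp (R * N * \<bar>Im z\<bar>) * sqrt (\<integral>\<xi>. (cmod (g \<xi>))\<^sup>2 \<partial>lborel))))"
proof -
  obtain \<phi> \<beta> C0 R where C0: "0 < C0" and R: "0 < R" and int\<phi>: "integrable lborel \<phi>" and sq\<phi>: "square_integrable \<phi>"
    and [measurable]: "\<beta> \<in> borel_measurable borel" and \<beta>: "\<And>\<zeta>. \<bar>\<beta> \<zeta>\<bar> \<le> C0" "\<And>\<zeta>. \<zeta> \<notin> {-R..R} \<Longrightarrow> \<beta> \<zeta> = 0"
    and rep: "\<And>x. of_real (\<phi> x) = (\<integral>\<zeta>. of_real (\<beta> \<zeta>) * cis (\<zeta> * x) \<partial>lborel)"
    and mult: "\<And>\<xi>. cmod (1 - fourier_integral \<phi> \<xi>) \<le> C0" "\<And>\<xi>. cmod (1 - fourier_integral \<phi> \<xi>) \<le> C0 * \<bar>\<xi>\<bar> ^ k"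
  proof -
    show ?thesis by (rule jackson_kernel[of k]) (rule that)
  qed
  have [measurable]: "\<phi> \<in> borel_measurable borel" using int\<phi> by auto
  define C where "C = C0 * (1 + sqrt (2 * pi) * sqrt (2 * R))"
  have C: "C0 \<le> C" "0 < C" "C0 * sqrt (2 * pi) * sqrt (2 * R) \<le> C"
    using C0 R by (auto simp: C_def distrib_left add_pos_pos)
  have "\<exists>H \<mu> E. is_fourier_transform H (\<lambda>\<xi>. \<mu> \<xi> * g \<xi>) \<and> \<mu> \<in> borel_measurable borel \<and>
        (\<forall>\<xi>. cmod (1 - \<mu> \<xi>) \<le> C \<and> cmod (1 - \<mu> \<xi>) \<le> C * (\<bar>\<xi>\<bar> / N) ^ k) \<and>
        E holomorphic_on UNIV \<and> (\<forall>x. E (of_real x) = of_real (H x)) \<and>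
        (\<forall>z. cmod (E z) \<le> C * sqrt N * exp (R * N * \<bar>Im z\<bar>) * sqrt (\<integral>\<xi>. (cmod (g \<xi>))\<^sup>2 \<partial>lborel))"
    if N: "N > 0" and F: "is_fourier_transform F g" for N F g
  proof -
    define \<phi>N where "\<phi>N = (\<lambda>x. N * \<phi> (N * x))"
    define \<beta>N where "\<beta>N = (\<lambda>\<zeta>. \<beta> (\<zeta> / N))"
    note [measurable] = is_fourier_transform_measurable[OF F]
    have sqg: "square_integrable g" using F by (simp add: is_fourier_transform_def)
    have [measurable]: "\<phi>N \<in> borel_measurable borel" "\<beta>N \<in> borel_measurable borel" unfolding \<phi>N_def \<beta>N_def by measurable
    have int\<phi>N: "integrable lborel \<phi>N"
      unfolding \<phi>N_def using lborel_integrable_real_affine[OF int\<phi>, of N 0] N by simp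
    have sq\<phi>N: "square_integrable \<phi>N"
    proof -
      have "integrable lborel (\<lambda>x. (norm (\<phi> x))\<^sup>2)" using sq\<phi> by (simp add: square_integrable_def)
      from lborel_integrable_real_affine[OF this, of N 0] N
      have "integrable lborel (\<lambda>x. N\<^sup>2 * (\<phi> (N * x))\<^sup>2)" by simp
      then show ?thesis unfolding square_integrable_def by (simp add: \<phi>N_def power_mult_distrib)
    qed
    have \<beta>Nb: "\<bar>\<beta>N \<zeta>\<bar> \<le> C0" for \<zeta> unfolding \<beta>N_def by (rule \<beta>(1))
    have \<beta>Ns: "\<beta>N \<zeta> = 0" if "\<zeta> \<notin> {- (R * N)..R * N}" for \<zeta>
      unfolding \<beta>N_def using that N by (intro \<beta>(2)) (auto simp: field_simps)
    have int\<beta>N: "integrable lborel \<beta>N" by (rule integrable_bounded_compact_support[OF _ \<beta>Nb \<beta>Ns]) auto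
    have sq\<beta>N: "square_integrable \<beta>N" by (rule square_integrable_of_bounded[OF int\<beta>N \<beta>Nb])
    have repN: "of_real (\<phi>N x) = (\<integral>\<zeta>. of_real (\<beta>N \<zeta>) * cis (\<zeta> * x) \<partial>lborel)" for x
    proof -
      have "of_real (\<phi> (N * x)) = \<bar>1 / N\<bar> *\<^sub>R (\<integral>\<zeta>. of_real (\<beta> (0 + 1 / N * \<zeta>)) * cis ((0 + 1 / N * \<zeta>) * (N * x)) \<partial>lborel)"
        unfolding rep by (rule lborel_integral_real_affine) (use N in auto)
      then show ?thesis using N by (simp add: \<phi>N_def \<beta>N_def scaleR_conv_of_real)
    qed
    define \<mu> where "\<mu> = fourier_integral \<phi>N"
    have \<mu>: "\<mu> \<xi> = fourier_integral \<phi> (\<xi> / N)" for \<xi>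
    proof -
      have "\<mu> \<xi> = of_real N * fourier_integral (\<lambda>x. \<phi> (x / (1 / N))) \<xi>"
        unfolding \<mu>_def fourier_integral_def \<phi>N_def
        by (subst integral_mult_right_zero[symmetric]) (simp add: mult_ac)
      also have "\<dots> = fourier_integral \<phi> (\<xi> / N)" using N by (subst fourier_integral_dilate) auto
      finally show ?thesis .
    qed
    have \<mu>_bound: "cmod (1 - \<mu> \<xi>) \<le> C \<and> cmod (1 - \<mu> \<xi>) \<le> C * (\<bar>\<xi>\<bar> / N) ^ k" for \<xi>
    proof
      show "cmod (1 - \<mu> \<xi>) \<le> C" unfolding \<mu> using mult(1)[of "\<xi> / N"] C by simp
      have "cmod (1 - \<mu> \<xi>) \<le> C0 * (\<bar>\<xi>\<bar> / N) ^ k" unfolding \<mu> using mult(2)[of "\<xi> / N"] N by simp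
      also have "\<dots> \<le> C * (\<bar>\<xi>\<bar> / N) ^ k" using C N by (intro mult_right_mono) auto
      finally show "cmod (1 - \<mu> \<xi>) \<le> C * (\<bar>\<xi>\<bar> / N) ^ k" .
    qed
    define w where "w = (\<lambda>\<zeta>. of_real (\<beta>N \<zeta>) * g \<zeta>)"
    have intw: "integrable lborel w" unfolding w_def by (rule integrable_mult_of_square_integrable[OF sq\<beta>N sqg])
    have wsupp: "w \<zeta> = 0" if "\<zeta> \<notin> {- (R * N)..R * N}" for \<zeta> unfolding w_def using \<beta>Ns[OF that] by simp
    define E where "E = (\<lambda>z. of_real (sqrt (2 * pi)) * (\<integral>\<zeta>. w \<zeta> * exp (\<i> * of_real \<zeta> * z) \<partial>lborel))"
    note ent = exp_fourier_entire[OF intw wsupp]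
    have E_hol: "E holomorphic_on UNIV" unfolding E_def by (intro holomorphic_intros ent(1))
    have E_real: "E (of_real x) = of_real (line_convolution F \<phi>N x)" for x
      unfolding band_limited_convolution[OF F sq\<phi>N int\<beta>N sq\<beta>N repN] E_def w_def
      by (simp add: cis_conv_exp mult_ac)
    have E_bound: "cmod (E z) \<le> C * sqrt N * exp (R * N * \<bar>Im z\<bar>) * sqrt (\<integral>\<xi>. (cmod (g \<xi>))\<^sup>2 \<partial>lborel)" for z
    proof -
      define G0 where "G0 = sqrt (\<integral>\<xi>. (cmod (g \<xi>))\<^sup>2 \<partial>lborel)"
      have G0: "G0 \<ge> 0" unfolding G0_def by (simp add: Bochner_Integration.integral_nonneg)
      have "(\<integral>\<zeta>. (\<beta>N \<zeta>)\<^sup>2 \<partial>lborel) \<le> (\<integral>\<zeta>. C0\<^sup>2 * indicator {- (R * N)..R * N} \<zeta> \<partial>lborel)"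
      proof (rule integral_mono)
        show "integrable lborel (\<lambda>\<zeta>. (\<beta>N \<zeta>)\<^sup>2)" using sq\<beta>N by (simp add: square_integrable_def)
        show "integrable lborel (\<lambda>\<zeta>. C0\<^sup>2 * indicator {- (R * N)..R * N} \<zeta> :: real)"
          by (intro integrable_mult_right) (auto simp: integrable_indicator_iff emeasure_lborel_Icc_eq)
        show "(\<beta>N \<zeta>)\<^sup>2 \<le> C0\<^sup>2 * indicator {- (R * N)..R * N} \<zeta>" for \<zeta>
          using power_mono[OF \<beta>Nb[of \<zeta>], of 2] \<beta>Ns[of \<zeta>] by (auto simp: indicator_def)
      qed
      also have "\<dots> = C0\<^sup>2 * (2 * R * N)" using R N by simp
      finally have "sqrt (\<integral>\<zeta>. (\<beta>N \<zeta>)\<^sup>2 \<partial>lborel) \<le> sqrt (C0\<^sup>2 * (2 * R * N))" by (rule real_sqrt_le_mono)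
      also have "\<dots> = C0 * sqrt (2 * R) * sqrt N" using C0 by (simp add: real_sqrt_mult)
      finally have b: "sqrt (\<integral>\<zeta>. (\<beta>N \<zeta>)\<^sup>2 \<partial>lborel) \<le> C0 * sqrt (2 * R) * sqrt N" .
      have "(\<integral>\<zeta>. cmod (w \<zeta>) \<partial>lborel) \<le> sqrt (\<integral>\<zeta>. (\<beta>N \<zeta>)\<^sup>2 \<partial>lborel) * G0"
        unfolding w_def G0_def by (rule integral_mult_le_sqrt[OF sq\<beta>N sqg])
      also have "\<dots> \<le> C0 * sqrt (2 * R) * sqrt N * G0" by (intro mult_right_mono b G0)
      finally have wb: "(\<integral>\<zeta>. cmod (w \<zeta>) \<partial>lborel) \<le> C0 * sqrt (2 * R) * sqrt N * G0" .
      have "cmod (E z) = sqrt (2 * pi) * cmod (\<integral>\<zeta>. w \<zeta> * exp (\<i> * of_real \<zeta> * z) \<partial>lborel)"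
        unfolding E_def by (simp only: norm_mult norm_of_real) simp
      also have "\<dots> \<le> sqrt (2 * pi) * (exp (R * N * \<bar>Im z\<bar>) * (\<integral>\<zeta>. cmod (w \<zeta>) \<partial>lborel))"
        by (intro mult_left_mono ent(2)) auto
      also have "\<dots> \<le> sqrt (2 * pi) * (exp (R * N * \<bar>Im z\<bar>) * (C0 * sqrt (2 * R) * sqrt N * G0))"
        by (intro mult_left_mono wb) auto
      also have "\<dots> = (C0 * sqrt (2 * pi) * sqrt (2 * R)) * (sqrt N * exp (R * N * \<bar>Im z\<bar>) * G0)" by (simp only: mult_ac)
      also have "\<dots> \<le> C * (sqrt N * exp (R * N * \<bar>Im z\<bar>) * G0)" using C(3) N G0 by (intro mult_right_mono) auto
      finally show ?thesis by (simp only: G0_def mult.assoc)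
    qed
    have [measurable]: "\<mu> \<in> borel_measurable borel" unfolding \<mu>_def by measurable
    have "is_fourier_transform (line_convolution F \<phi>N) (\<lambda>\<xi>. \<mu> \<xi> * g \<xi>)"
      unfolding \<mu>_def by (rule is_fourier_transform_convolution[OF F int\<phi>N sq\<phi>N])
    then show ?thesis using \<mu>_bound E_hol E_real E_bound \<open>\<mu> \<in> borel_measurable borel\<close> by blast
  qed
  then show ?thesis using C R by blast
qed

text \<open>The decay estimate with no derivative handles small frequencies and the one with \<open>k\<close> derivatives the
  large ones, where \<open>1 + \<xi>^2 \<le> 2 \<xi>^2\<close>.\<close>

lemma fourier_transform_of_smooth_compact_support:
  assumes G: "bounded_derivs k UNIV M G" and supp: "\<And>x. x \<notin> {a..b} \<Longrightarrow> G x = 0" and ab: "a < b"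
  shows "\<exists>h. is_fourier_transform G h \<and> (\<forall>\<xi>. (1 + \<xi>\<^sup>2) ^ k * (cmod (h \<xi>))\<^sup>2 \<le> 2 ^ k * ((b - a) * M)\<^sup>2)"
proof -
  have G0: "bounded_derivs 0 UNIV M G"
    using bounded_derivs_continuous[OF G] bounded_derivs_bound[OF G] by auto
  have cont: "continuous_on UNIV G" using bounded_derivs_continuous[OF G] .
  then have [measurable]: "G \<in> borel_measurable borel" by (rule borel_measurable_continuous_onI)
  have M: "\<bar>G x\<bar> \<le> M" for x using bounded_derivs_bound[OF G] by simp
  have M0: "0 \<le> M" using M[of 0] by simp
  have int: "integrable lborel G"
    by (rule integrable_bounded_compact_support[of _ M "max \<bar>a\<bar> \<bar>b\<bar>"]) (use M in \<open>auto intro!: supp\<close>)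
  have sq: "square_integrable G" by (rule square_integrable_of_bounded[OF int M])
  define h where "h = (\<lambda>\<xi>. of_real (1 / sqrt (2 * pi)) * fourier_integral G \<xi>)"
  have FT: "is_fourier_transform G h" unfolding h_def by (rule is_fourier_transform_compact_support[OF sq supp])
  have FI: "fourier_integral G \<xi> = integral {a..b} (\<lambda>x. of_real (G x) * cis (- (x * \<xi>)))" for \<xi>
  proof -
    have "fourier_integral G \<xi> = set_lebesgue_integral lborel {a..b} (\<lambda>x. of_real (G x) * cis (- (x * \<xi>)))"
      unfolding fourier_integral_def set_lebesgue_integral_def
      by (intro Bochner_Integration.integral_cong) (use supp in \<open>auto simp: indicator_def\<close>)
    also have "\<dots> = integral {a..b} (\<lambda>x. of_real (G x) * cis (- (x * \<xi>)))"
    proof (rule set_borel_integral_eq_integral(2))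
      have "integrable lborel (\<lambda>x. indicator {a..b} x *\<^sub>R (of_real (G x) * cis (- (x * \<xi>))))"
        by (rule Bochner_Integration.integrable_bound[OF integrable_times_cis(2)[OF int, of \<xi>]]) (auto simp: norm_mult indicator_def)
      then show "set_integrable lborel {a..b} (\<lambda>x. of_real (G x) * cis (- (x * \<xi>)))" by (simp add: set_integrable_def)
    qed
    finally show ?thesis .
  qed
  define B where "B = (b - a) * M"
  have B0: "0 \<le> B" using ab M0 by (simp add: B_def)
  have d0: "cmod (fourier_integral G \<xi>) \<le> B" for \<xi>
    using fourier_integral_decay[OF ab G0 supp, of \<xi>] unfolding FI B_def by simp
  have dk: "\<bar>\<xi>\<bar> ^ k * cmod (fourier_integral G \<xi>) \<le> B" for \<xi>
    using fourier_integral_decay[OF ab G supp, of \<xi>] unfolding FI B_def by simp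
  have "(1 + \<xi>\<^sup>2) ^ k * (cmod (h \<xi>))\<^sup>2 \<le> 2 ^ k * B\<^sup>2" for \<xi>
  proof -
    define u where "u = cmod (fourier_integral G \<xi>)"
    have u: "0 \<le> u" "u \<le> B" "\<bar>\<xi>\<bar> ^ k * u \<le> B" using d0 dk by (auto simp: u_def)
    have "cmod (h \<xi>) = u / sqrt (2 * pi)" by (simp add: h_def u_def norm_mult norm_divide)
    also have "\<dots> \<le> u / 1" using u pi_gt3 by (intro divide_left_mono) auto
    finally have hu: "(cmod (h \<xi>))\<^sup>2 \<le> u\<^sup>2" by (intro power_mono) auto
    have "(1 + \<xi>\<^sup>2) ^ k * u\<^sup>2 \<le> 2 ^ k * B\<^sup>2"
    proof (cases "\<bar>\<xi>\<bar> \<le> 1")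
      case True
      then have "\<xi>\<^sup>2 \<le> 1" by (simp add: abs_square_le_1)
      then have "(1 + \<xi>\<^sup>2) ^ k \<le> 2 ^ k" by (intro power_mono) auto
      moreover have "u\<^sup>2 \<le> B\<^sup>2" using u by (intro power_mono) auto
      ultimately show ?thesis by (rule mult_mono) auto
    next
      case False
      then have "1 \<le> \<bar>\<xi>\<bar>\<^sup>2" by (intro one_le_power) simp
      then have "(1 + \<xi>\<^sup>2) ^ k \<le> (2 * \<bar>\<xi>\<bar>\<^sup>2) ^ k" by (intro power_mono) auto
      also have "\<dots> = 2 ^ k * (\<bar>\<xi>\<bar> ^ k)\<^sup>2" by (simp only: power_mult_distrib power_mult[symmetric] mult.commute)
      finally have "(1 + \<xi>\<^sup>2) ^ k * u\<^sup>2 \<le> 2 ^ k * (\<bar>\<xi>\<bar> ^ k)\<^sup>2 * u\<^sup>2" by (rule mult_right_mono) simp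
      also have "\<dots> = 2 ^ k * (\<bar>\<xi>\<bar> ^ k * u)\<^sup>2" by (simp only: power_mult_distrib mult.assoc)
      also have "\<dots> \<le> 2 ^ k * B\<^sup>2" using u by (intro mult_left_mono power_mono) auto
      finally show ?thesis .
    qed
    moreover have "(1 + \<xi>\<^sup>2) ^ k * (cmod (h \<xi>))\<^sup>2 \<le> (1 + \<xi>\<^sup>2) ^ k * u\<^sup>2" by (rule mult_left_mono[OF hu]) simp
    ultimately show ?thesis by simp
  qed
  then show ?thesis using FT unfolding B_def by blast
qed

section \<open>Nodes, Sobolev norms and rates\<close>

text \<open>If two points coincide, the minimal separation is 0, hence so is the covering radius; but finitely many
  points cannot cover the interval with radius 0.\<close>

lemma quasi_uniform_inj:
  assumes "quasi_uniform 0 pi \<theta>" "m \<ge> 1"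
  shows "inj_on (\<theta> m) {..m}"
proof (rule inj_onI, rule ccontr)
  fix i j assume ij: "i \<in> {..m}" "j \<in> {..m}" "\<theta> m i = \<theta> m j" "i \<noteq> j"
  define dst where "dst = (\<lambda>t. Min ((\<lambda>j. \<bar>t - \<theta> m j\<bar>) ` {..m}))"
  define D where "D = {\<bar>\<theta> m i - \<theta> m j\<bar> | i j. i \<le> m \<and> j \<le> m \<and> i \<noteq> j}"
  obtain c where c: "(SUP t\<in>{0..pi}. dst t) \<le> c * Min D"
    using assms unfolding quasi_uniform_def dst_def D_def by blast
  have "D \<subseteq> (\<lambda>(i, j). \<bar>\<theta> m i - \<theta> m j\<bar>) ` ({..m} \<times> {..m})" unfolding D_def by auto
  then have fin: "finite D" by (rule finite_subset) auto
  have "\<bar>\<theta> m i - \<theta> m j\<bar> \<in> D" unfolding D_def using ij by blast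
  then have D0: "0 \<in> D" using ij by simp
  have "Min D = 0" by (rule Min_eqI[OF fin _ D0]) (auto simp: D_def)
  then have le0: "(SUP t\<in>{0..pi}. dst t) \<le> 0" using c by simp
  have "infinite {0..pi}" using pi_gt_zero by (simp add: infinite_Icc)
  then obtain t where t: "t \<in> {0..pi}" "t \<notin> \<theta> m ` {..m}"
    using finite_subset[of "{0..pi}" "\<theta> m ` {..m}"] by blast
  have "dst t > 0" unfolding dst_def using t by (subst Min_gr_iff) auto
  moreover have "dst t \<le> (SUP t\<in>{0..pi}. dst t)"
  proof (rule cSUP_upper[OF t(1)])
    have "dst u \<le> pi + \<bar>\<theta> m 0\<bar>" if "u \<in> {0..pi}" for u
    proof -
      have "dst u \<le> \<bar>u - \<theta> m 0\<bar>" unfolding dst_def by (rule Min_le) auto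
      then show ?thesis using that by auto
    qed
    then show "bdd_above (dst ` {0..pi})" by (intro bdd_aboveI2)
  qed
  ultimately show False using le0 by simp
qed

lemma quasi_Chebyshev_inj:
  assumes J: "bounded_interval J" and x: "quasi_Chebyshev J x" and m: "m \<ge> 1"
  shows "inj_on (x m) {..m}"
proof -
  obtain \<theta> where \<theta>: "quasi_uniform 0 pi \<theta>" 
    "\<And>j. j \<le> m \<Longrightarrow> x m j = (Inf J + Sup J) / 2 + (Sup J - Inf J) / 2 * cos (\<theta> m j)"
    using x m unfolding quasi_Chebyshev_def by blast
  obtain a b where ab: "a \<in> J" "b \<in> J" "a < b" and bd: "bounded J" using J unfolding bounded_interval_def by blast
  have "Inf J \<le> a" "b \<le> Sup J"
    using ab bd by (auto intro!: cInf_lower cSup_upper simp: bounded_imp_bdd_below bounded_imp_bdd_above)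
  then have pos: "Sup J - Inf J > 0" using ab by simp
  show ?thesis
  proof (rule inj_onI)
    fix i j assume ij: "i \<in> {..m}" "j \<in> {..m}" "x m i = x m j"
    then have "cos (\<theta> m i) = cos (\<theta> m j)" using \<theta>(2)[of i] \<theta>(2)[of j] pos by simp
    moreover have "\<theta> m i \<in> {0..pi}" "\<theta> m j \<in> {0..pi}" using \<theta>(1) ij m unfolding quasi_uniform_def by auto
    ultimately have "\<theta> m i = \<theta> m j" using cos_inj_pi[of "\<theta> m i" "\<theta> m j"] by auto
    then show "i = j" using quasi_uniform_inj[OF \<theta>(1) m] ij by (auto dest: inj_onD)
  qed
qed

lemma sobolev_norm_line_nonneg: "0 \<le> sobolev_norm_line s F"
  unfolding sobolev_norm_line_def by (intro real_sqrt_ge_zero Bochner_Integration.integral_nonneg) auto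

lemma sobolev_norm_le_extension:
  assumes "F \<in> sobolev_extensions s I f"
  shows "sobolev_norm s I f \<le> sobolev_norm_line s F"
  unfolding sobolev_norm_def
  by (rule cINF_lower[OF _ assms]) (auto intro!: bdd_belowI2[of _ 0] sobolev_norm_line_nonneg)

lemma sobolev_line_mono:
  assumes F: "F \<in> sobolev_space_line r" and s: "s \<le> r"
  shows "F \<in> sobolev_space_line s" "sobolev_norm_line s F \<le> sobolev_norm_line r F"
proof -
  define g where "g = fourier_transform F"
  have FT: "is_fourier_transform F g" and int: "integrable lborel (\<lambda>\<xi>. (1 + \<xi>\<^sup>2) powr r * (cmod (g \<xi>))\<^sup>2)"
    using F by (auto simp: sobolev_space_line_def g_def)
  note [measurable] = is_fourier_transform_measurable[OF FT]
  have le: "(1 + \<xi>\<^sup>2) powr s * (cmod (g \<xi>))\<^sup>2 \<le> (1 + \<xi>\<^sup>2) powr r * (cmod (g \<xi>))\<^sup>2" for \<xi>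
    using s by (intro mult_right_mono powr_mono) auto
  have int': "integrable lborel (\<lambda>\<xi>. (1 + \<xi>\<^sup>2) powr s * (cmod (g \<xi>))\<^sup>2)"
    by (rule Bochner_Integration.integrable_bound[OF int]) (use le in auto)
  then show "F \<in> sobolev_space_line s" using FT by (auto simp: sobolev_space_line_def g_def)
  show "sobolev_norm_line s F \<le> sobolev_norm_line r F"
    unfolding sobolev_norm_line_def g_def[symmetric] by (intro real_sqrt_le_mono integral_mono int int' le)
qed

text \<open>Interpolation between the two multiplier bounds: the constant one is used for \<open>|\<xi>| \<ge> N\<close>, the power
  for \<open>|\<xi>| < N\<close>, where lowering the exponent from \<open>k\<close> to \<open>\<delta>\<close> only increases it.\<close>

lemma smoothing_weight_bound:
  fixes N C a \<delta> \<xi> :: real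
  assumes N: "N > 0" and C: "C > 0" and k: "k \<ge> 1" and \<delta>: "0 \<le> \<delta>" "\<delta> \<le> real k"
    and a: "a \<le> C" "a \<le> C * (\<bar>\<xi>\<bar> / N) ^ k"
  shows "a \<le> C * N powr (- \<delta>) * (1 + \<xi>\<^sup>2) powr (\<delta> / 2)"
proof -
  have sq: "(t\<^sup>2) powr (\<delta> / 2) = t powr \<delta>" if "t > 0" for t :: real
  proof -
    have "t\<^sup>2 = t powr 2" using that by (simp add: powr_numeral)
    then show ?thesis by (simp only: powr_powr) simp
  qed
  show ?thesis
  proof (cases "\<bar>\<xi>\<bar> \<ge> N")
    case True
    then have "N\<^sup>2 \<le> 1 + \<xi>\<^sup>2" using N power_mono[of N "\<bar>\<xi>\<bar>" 2] by simp
    then have "(N\<^sup>2) powr (\<delta> / 2) \<le> (1 + \<xi>\<^sup>2) powr (\<delta> / 2)" using \<delta> by (intro powr_mono2) auto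
    then have "N powr \<delta> \<le> (1 + \<xi>\<^sup>2) powr (\<delta> / 2)" by (simp add: sq[OF N])
    then have "C * N powr (- \<delta>) * N powr \<delta> \<le> C * N powr (- \<delta>) * (1 + \<xi>\<^sup>2) powr (\<delta> / 2)"
      using C by (intro mult_left_mono) auto
    moreover have "N powr (- \<delta>) * N powr \<delta> = 1" using N by (simp flip: powr_add)
    ultimately show ?thesis using a(1) by (simp add: mult.assoc)
  next
    case False
    show ?thesis
    proof (cases "\<xi> = 0")
      case True
      then have "a \<le> 0" using a(2) k by (simp add: power_0_left)
      also have "\<dots> \<le> C * N powr (- \<delta>) * (1 + \<xi>\<^sup>2) powr (\<delta> / 2)" using C by simp
      finally show ?thesis .
    next
      case nz: False
      have "(\<bar>\<xi>\<bar> / N) ^ k = (\<bar>\<xi>\<bar> / N) powr real k" using nz N by (simp add: powr_realpow)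
      also have "\<dots> \<le> (\<bar>\<xi>\<bar> / N) powr \<delta>" using nz N False \<delta> by (intro powr_mono') auto
      also have "\<dots> = N powr (- \<delta>) * \<bar>\<xi>\<bar> powr \<delta>" by (simp only: powr_divide powr_minus_divide times_divide_eq_left mult_1)
      also have "\<bar>\<xi>\<bar> powr \<delta> = (\<xi>\<^sup>2) powr (\<delta> / 2)"
        by (subst sq[symmetric]) (use nz in \<open>simp_all only: power2_abs zero_less_abs_iff not_False_eq_True\<close>)
      also have "N powr (- \<delta>) * (\<xi>\<^sup>2) powr (\<delta> / 2) \<le> N powr (- \<delta>) * (1 + \<xi>\<^sup>2) powr (\<delta> / 2)"
        using \<delta> by (intro mult_left_mono powr_mono2) auto
      finally have "C * (\<bar>\<xi>\<bar> / N) ^ k \<le> C * (N powr (- \<delta>) * (1 + \<xi>\<^sup>2) powr (\<delta> / 2))"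
        using C by (intro mult_left_mono) auto
      then show ?thesis using a(2) by (simp add: mult.assoc)
    qed
  qed
qed

text \<open>From \<open>e^y \<ge> (1 + y / n)^n \<ge> (y / n)^n\<close>.\<close>

lemma exponential_beats_power:
  fixes p r :: real
  assumes "0 < p" "p < 1"
  shows "\<exists>C>0. \<forall>m\<ge>1. sqrt (real m) * p ^ m \<le> C * real m powr (- r)"
proof -
  define c where "c = - ln p"
  have c: "c > 0" using assms by (simp add: c_def)
  define n where "n = nat \<lceil>r + 1/2\<rceil> + 1"
  have n: "n > 0" "r + 1/2 \<le> real n" unfolding n_def using real_nat_ceiling_ge[of "r + 1/2"] by auto
  define C where "C = (real n / c) ^ n"
  have C: "C > 0" using n c by (simp add: C_def)
  have bound: "real m powr (r + 1/2) * exp (- c * real m) \<le> C" if "m \<ge> 1" for m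
  proof -
    have "real m powr (r + 1/2) \<le> real m powr real n" using n that by (intro powr_mono) auto
    also have "\<dots> = (real n / c) ^ n * (c * real m / real n) ^ n"
      using that n c by (simp add: powr_realpow power_mult_distrib[symmetric])
    also have "\<dots> \<le> C * exp (c * real m)"
    proof -
      have "(c * real m / real n) ^ n \<le> (1 + c * real m / real n) ^ n" using c by (intro power_mono) auto
      also have "\<dots> \<le> exp (c * real m)"
        using c n by (intro exp_ge_one_plus_x_over_n_power_n) (auto intro: order_trans[of _ 0])
      finally show ?thesis unfolding C_def[symmetric] using C by (intro mult_left_mono) auto
    qed
    finally have "real m powr (r + 1/2) * exp (- c * real m) \<le> C * exp (c * real m) * exp (- c * real m)"
      by (rule mult_right_mono) simp
    then show ?thesis by (simp add: mult.assoc flip: exp_add)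
  qed
  have "sqrt (real m) * p ^ m \<le> C * real m powr (- r)" if "m \<ge> 1" for m
  proof -
    have e: "exp (- c * real m) = p ^ m" using assms by (simp add: c_def exp_of_nat_mult mult.commute)
    have "sqrt (real m) * p ^ m = (real m powr (r + 1/2) * exp (- c * real m)) * real m powr (- r)"
    proof -
      have "real m powr (r + 1/2) * real m powr (- r) = sqrt (real m)"
        using that by (simp add: powr_add[symmetric] powr_half_sqrt)
      then have "sqrt (real m) * p ^ m = (real m powr (r + 1/2) * real m powr (- r)) * p ^ m" by simp
      then show ?thesis unfolding e by (simp only: mult_ac)
    qed
    also have "\<dots> \<le> C * real m powr (- r)"
      using bound[OF that] by (intro mult_right_mono) auto
    finally show ?thesis .
  qed
  then show ?thesis using C by blast
qed

section \<open>Approximation by translates of the hyperbolic tangent\<close>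

text \<open>The extension used in the end has transform \<open>(1 - \<mu>) g + h\<close>, a smoothing error and a smooth, compactly
  supported error.  The first trades \<open>r - s\<close> orders of smoothness for the factor \<open>P\<close>; the second decays like
  \<open>(1 + \<xi>^2)^{-k/2}\<close>, and \<open>k \<ge> r + 1\<close> leaves the integrable weight \<open>1 / (1 + \<xi>^2)\<close>.\<close>

lemma sobolev_bound_of_sum:
  assumes F: "is_fourier_transform F g" and G: "is_fourier_transform G h" and \<mu>: "\<mu> \<in> borel_measurable borel"
    and FG: "is_fourier_transform H (\<lambda>\<xi>. (1 - \<mu> \<xi>) * g \<xi> + h \<xi>)"
    and r: "integrable lborel (\<lambda>\<xi>. (1 + \<xi>\<^sup>2) powr r * (cmod (g \<xi>))\<^sup>2)"
    and sr: "0 \<le> s" "s \<le> r" and k: "r + 1 \<le> real k"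
    and P: "0 \<le> P" "\<And>\<xi>. cmod (1 - \<mu> \<xi>) \<le> P * (1 + \<xi>\<^sup>2) powr ((r - s) / 2)"
    and B: "0 \<le> B" "\<And>\<xi>. (1 + \<xi>\<^sup>2) ^ k * (cmod (h \<xi>))\<^sup>2 \<le> B\<^sup>2"
  shows "H \<in> sobolev_space_line s"
    and "sobolev_norm_line s H \<le> 2 * (P * sqrt (\<integral>\<xi>. (1 + \<xi>\<^sup>2) powr r * (cmod (g \<xi>))\<^sup>2 \<partial>lborel)
       + B * sqrt (\<integral>\<xi>. 1 / (1 + \<xi>\<^sup>2) \<partial>lborel))"
proof -
  note [measurable] = is_fourier_transform_measurable[OF F] is_fourier_transform_measurable[OF G] \<mu>
  define T where "T = (\<lambda>\<xi>. (1 + \<xi>\<^sup>2) powr r * (cmod (g \<xi>))\<^sup>2)"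
  define A where "A = (\<integral>\<xi>. 1 / (1 + \<xi>\<^sup>2) \<partial>(lborel :: real measure))"
  define X where "X = integral\<^sup>L lborel T"
  have A0: "A \<ge> 0" unfolding A_def by (intro Bochner_Integration.integral_nonneg) (auto intro: divide_nonneg_nonneg)
  have X0: "X \<ge> 0" unfolding X_def T_def by (intro Bochner_Integration.integral_nonneg) auto
  have one: "1 \<le> 1 + \<xi>\<^sup>2" "0 < 1 + \<xi>\<^sup>2" for \<xi> :: real using zero_le_power2[of \<xi>] by (linarith, linarith)
  have le1: "(1 + \<xi>\<^sup>2) powr s * (cmod ((1 - \<mu> \<xi>) * g \<xi>))\<^sup>2 \<le> P\<^sup>2 * T \<xi>" for \<xi>
  proof -
    have "(cmod (1 - \<mu> \<xi>))\<^sup>2 \<le> (P * (1 + \<xi>\<^sup>2) powr ((r - s) / 2))\<^sup>2" by (intro power_mono P) auto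
    also have "\<dots> = P\<^sup>2 * (1 + \<xi>\<^sup>2) powr (r - s)"
      by (simp add: power_mult_distrib power2_eq_square[of "_ powr _"] flip: powr_add)
    finally have "(1 + \<xi>\<^sup>2) powr s * (cmod (1 - \<mu> \<xi>))\<^sup>2 * (cmod (g \<xi>))\<^sup>2 \<le> (1 + \<xi>\<^sup>2) powr s * (P\<^sup>2 * (1 + \<xi>\<^sup>2) powr (r - s)) * (cmod (g \<xi>))\<^sup>2"
      by (intro mult_right_mono mult_left_mono) auto
    also have "\<dots> = P\<^sup>2 * ((1 + \<xi>\<^sup>2) powr s * (1 + \<xi>\<^sup>2) powr (r - s)) * (cmod (g \<xi>))\<^sup>2" by (simp only: mult_ac)
    also have "(1 + \<xi>\<^sup>2) powr s * (1 + \<xi>\<^sup>2) powr (r - s) = (1 + \<xi>\<^sup>2) powr r" by (simp flip: powr_add)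
    finally show ?thesis by (simp only: T_def norm_mult power_mult_distrib mult.assoc)
  qed
  have le2: "(1 + \<xi>\<^sup>2) powr s * (cmod (h \<xi>))\<^sup>2 \<le> B\<^sup>2 * (1 / (1 + \<xi>\<^sup>2))" for \<xi>
  proof -
    have "(1 + \<xi>\<^sup>2) powr (s + 1) \<le> (1 + \<xi>\<^sup>2) powr real k" using sr k one by (intro powr_mono) auto
    also have "\<dots> = (1 + \<xi>\<^sup>2) ^ k" using one by (intro powr_realpow)
    finally have "(1 + \<xi>\<^sup>2) powr s * (1 + \<xi>\<^sup>2) \<le> (1 + \<xi>\<^sup>2) ^ k" using one(2)[of \<xi>] by (simp add: powr_add)
    then have "(1 + \<xi>\<^sup>2) powr s * (1 + \<xi>\<^sup>2) * (cmod (h \<xi>))\<^sup>2 \<le> (1 + \<xi>\<^sup>2) ^ k * (cmod (h \<xi>))\<^sup>2" by (rule mult_right_mono) simp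
    then have "(1 + \<xi>\<^sup>2) powr s * (cmod (h \<xi>))\<^sup>2 * (1 + \<xi>\<^sup>2) \<le> B\<^sup>2" using B(2)[of \<xi>] by (simp only: mult_ac)
    then have "(1 + \<xi>\<^sup>2) powr s * (cmod (h \<xi>))\<^sup>2 \<le> B\<^sup>2 / (1 + \<xi>\<^sup>2)" by (simp only: pos_le_divide_eq[OF one(2)])
    then show ?thesis by simp
  qed
  have le: "(1 + \<xi>\<^sup>2) powr s * (cmod ((1 - \<mu> \<xi>) * g \<xi> + h \<xi>))\<^sup>2 \<le> 2 * (P\<^sup>2 * T \<xi>) + 2 * (B\<^sup>2 * (1 / (1 + \<xi>\<^sup>2)))" for \<xi>
  proof -
    have "(1 + \<xi>\<^sup>2) powr s * (cmod ((1 - \<mu> \<xi>) * g \<xi> + h \<xi>))\<^sup>2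
      \<le> (1 + \<xi>\<^sup>2) powr s * (2 * (cmod ((1 - \<mu> \<xi>) * g \<xi>))\<^sup>2 + 2 * (cmod (h \<xi>))\<^sup>2)"
      by (intro mult_left_mono norm_add_power2_le) auto
    also have "\<dots> = 2 * ((1 + \<xi>\<^sup>2) powr s * (cmod ((1 - \<mu> \<xi>) * g \<xi>))\<^sup>2) + 2 * ((1 + \<xi>\<^sup>2) powr s * (cmod (h \<xi>))\<^sup>2)"
      by (simp only: distrib_left mult.left_commute)
    also have "\<dots> \<le> 2 * (P\<^sup>2 * T \<xi>) + 2 * (B\<^sup>2 * (1 / (1 + \<xi>\<^sup>2)))" by (intro add_mono mult_left_mono le1 le2) auto
    finally show ?thesis .
  qed
  have intR: "integrable lborel (\<lambda>\<xi>. 2 * (P\<^sup>2 * T \<xi>) + 2 * (B\<^sup>2 * (1 / (1 + \<xi>\<^sup>2))))"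
    by (intro Bochner_Integration.integrable_add integrable_mult_right integrable_inverse_one_plus_square) (use r in \<open>simp add: T_def\<close>)
  have int: "integrable lborel (\<lambda>\<xi>. (1 + \<xi>\<^sup>2) powr s * (cmod ((1 - \<mu> \<xi>) * g \<xi> + h \<xi>))\<^sup>2)"
    by (rule Bochner_Integration.integrable_bound[OF intR]) (use le in \<open>auto intro!: AE_I2 intro: order_trans[OF _ abs_ge_self]\<close>)
  show "H \<in> sobolev_space_line s" by (rule sobolev_line_of_transform(1)[OF FG int])
  have "(\<integral>\<xi>. (1 + \<xi>\<^sup>2) powr s * (cmod ((1 - \<mu> \<xi>) * g \<xi> + h \<xi>))\<^sup>2 \<partial>lborel) \<le> (\<integral>\<xi>. 2 * (P\<^sup>2 * T \<xi>) + 2 * (B\<^sup>2 * (1 / (1 + \<xi>\<^sup>2))) \<partial>lborel)"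
    by (rule integral_mono[OF int intR le])
  also have "\<dots> = 2 * (P\<^sup>2 * X) + 2 * (B\<^sup>2 * A)"
  proof -
    have "integrable lborel T" using r by (simp add: T_def)
    then show ?thesis unfolding X_def A_def
      by (subst Bochner_Integration.integral_add)
        (simp_all only: integrable_mult_right integrable_inverse_one_plus_square integral_mult_right_zero)
  qed
  also have "\<dots> \<le> (2 * (P * sqrt X + B * sqrt A))\<^sup>2"
  proof -
    have e: "(P * sqrt X)\<^sup>2 = P\<^sup>2 * X" "(B * sqrt A)\<^sup>2 = B\<^sup>2 * A" using X0 A0 by (auto simp: power_mult_distrib)
    have nn: "0 \<le> P * sqrt X" "0 \<le> B * sqrt A" using P B X0 A0 by auto
    have "2 * u\<^sup>2 + 2 * v\<^sup>2 \<le> (2 * (u + v))\<^sup>2" if "0 \<le> u" "0 \<le> v" for u v :: real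
      using mult_nonneg_nonneg[OF that] by (simp add: power2_eq_square algebra_simps)
    from this[OF nn] show ?thesis unfolding e .
  qed
  finally have "sqrt (\<integral>\<xi>. (1 + \<xi>\<^sup>2) powr s * (cmod ((1 - \<mu> \<xi>) * g \<xi> + h \<xi>))\<^sup>2 \<partial>lborel) \<le> sqrt ((2 * (P * sqrt X + B * sqrt A))\<^sup>2)"
    by (rule real_sqrt_le_mono)
  also have "\<dots> = 2 * (P * sqrt X + B * sqrt A)"
    using P B X0 A0 by (intro real_sqrt_unique) auto
  finally show "sobolev_norm_line s H \<le> 2 * (P * sqrt (\<integral>\<xi>. (1 + \<xi>\<^sup>2) powr r * (cmod (g \<xi>))\<^sup>2 \<partial>lborel) + B * sqrt (\<integral>\<xi>. 1 / (1 + \<xi>\<^sup>2) \<partial>lborel))"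
    unfolding sobolev_line_of_transform(2)[OF FG int] X_def T_def A_def .
qed

text \<open>The two steps combined, for a function on the line.  The extension of the error is
  \<open>F - H + \<omega> e\<close> with \<open>H\<close> the smoothed \<open>F\<close>, \<open>e\<close> the error of approximating \<open>H\<close>, and \<open>\<omega>\<close> a cutoff
  that is 1 on the interval.  The coefficients depend on \<open>F\<close> and \<open>m\<close> only, so one choice serves all
  \<open>s\<close>.\<close>

theorem tanh_approximation_on_line:
  fixes \<alpha> \<beta> y1 y2 r :: real and y :: "nat \<Rightarrow> nat \<Rightarrow> real"
  assumes \<alpha>\<beta>: "\<alpha> \<le> \<beta>" and r: "0 \<le> r"
    and y: "\<And>m j. 1 \<le> m \<Longrightarrow> j \<le> m \<Longrightarrow> y m j \<in> {y1..y2}" and inj: "\<And>m. 1 \<le> m \<Longrightarrow> inj_on (y m) {..m}"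
  shows "\<exists>K>0. \<forall>m\<ge>1. \<forall>F\<in>sobolev_space_line r. \<exists>a :: nat \<Rightarrow> real. \<forall>s. 0 \<le> s \<and> s \<le> r \<longrightarrow>
     (\<exists>H \<in> sobolev_space_line s. (\<forall>t\<in>{\<alpha>..\<beta>}. H t = F t - (\<Sum>i\<le>m. a i * tanh (t - y m i))) \<and>
        sobolev_norm_line s H \<le> K * real m powr (- (r - s)) * sobolev_norm_line r F)"
proof -
  define k where "k = nat \<lceil>r\<rceil> + 1"
  have k: "r + 1 \<le> real k" "k \<ge> 1" unfolding k_def using real_nat_ceiling_ge[of r] by auto
  \<comment> \<open>The cutoff lives on \<open>[a0, b0]\<close>; analytic estimates are needed on a further neighbourhood of width 1.\<close>
  define a0 where "a0 = \<alpha> - 1"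
  define b0 where "b0 = \<beta> + 1"
  have ab0: "a0 < \<alpha>" "\<beta> < b0" "a0 < b0" using \<alpha>\<beta> by (auto simp: a0_def b0_def)
  obtain \<omega> M\<omega> where \<omega>: "bounded_derivs k UNIV M\<omega> \<omega>" "\<And>x. x \<in> {\<alpha>..\<beta>} \<Longrightarrow> \<omega> x = 1" "\<And>x. x \<notin> {a0..b0} \<Longrightarrow> \<omega> x = 0"
    using ex_smooth_cutoff[OF ab0(1) \<alpha>\<beta> ab0(2), of k] by blast
  have M\<omega>: "0 \<le> M\<omega>" using bounded_derivs_bound[OF \<omega>(1), of 0] by simp
  obtain q C1 where q: "0 < q" "q < 1" and C1: "0 < C1" and approx:
    "\<And>n z H M. even n \<Longrightarrow> inj_on z {..<n} \<Longrightarrow> (\<forall>j<n. z j \<in> {y1..y2}) \<Longrightarrow> H holomorphic_on UNIV \<Longrightarrow>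
       (\<forall>z. \<bar>Im z\<bar> < pi / 4 \<longrightarrow> cmod (H z) \<le> M) \<Longrightarrow>
       \<exists>(c :: nat \<Rightarrow> real) E. E holomorphic_on {z. \<bar>Im z\<bar> < pi / 4} \<and>
          (\<forall>x. Re (E (of_real x)) = Re (H (of_real x)) - (\<Sum>j<n. c j * tanh (x - z j))) \<and>
          (\<forall>z. Re z \<in> {a0 - 1..b0 + 1} \<longrightarrow> \<bar>Im z\<bar> \<le> pi / 8 \<longrightarrow> cmod (E z) \<le> C1 * q ^ n * M)"
    using tanh_span_approximation[of y1 y2 "a0 - 1" "b0 + 1"] by (elim exE conjE) (rule that; blast)
  obtain C2 R where C2: "0 < C2" and R: "0 < R" and smooth:
    "\<And>N F g. N > 0 \<Longrightarrow> is_fourier_transform F g \<Longrightarrow>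
     (\<exists>H \<mu> E. is_fourier_transform H (\<lambda>\<xi>. \<mu> \<xi> * g \<xi>) \<and> \<mu> \<in> borel_measurable borel \<and>
        (\<forall>\<xi>. cmod (1 - \<mu> \<xi>) \<le> C2 \<and> cmod (1 - \<mu> \<xi>) \<le> C2 * (\<bar>\<xi>\<bar> / N) ^ k) \<and>
        E holomorphic_on UNIV \<and> (\<forall>x. E (of_real x) = of_real (H x)) \<and>
        (\<forall>z. cmod (E z) \<le> C2 * sqrt N * exp (R * N * \<bar>Im z\<bar>) * sqrt (\<integral>\<xi>. (cmod (g \<xi>))\<^sup>2 \<partial>lborel)))"
    using band_limited_smoothing[of k] by (elim exE conjE) (rule that; blast)
  \<comment> \<open>Chosen so that the growth of the smoothed function uses up half of the exponential gain: \<open>sqrt q\<close> remains.\<close>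
  define \<epsilon> where "\<epsilon> = - 2 * ln q / (R * pi)"
  have "ln q < 0" using q by simp
  then have "0 < - 2 * ln q" "0 < R * pi" using R by auto
  then have \<epsilon>: "\<epsilon> > 0" unfolding \<epsilon>_def by (rule divide_pos_pos)
  have sqrtq: "exp (R * \<epsilon> * (pi / 4)) * q = sqrt q"
  proof -
    have "R * \<epsilon> * (pi / 4) = - (ln q / 2)" using R by (simp add: \<epsilon>_def field_simps)
    then have "exp (R * \<epsilon> * (pi / 4)) * q = exp (- (ln q / 2)) * exp (ln q)" using q by simp
    also have "\<dots> = exp (ln q / 2)" by (simp flip: exp_add)
    also have "\<dots> = sqrt q" using q by (simp add: powr_half_sqrt[symmetric] powr_def)
    finally show ?thesis .
  qed
  obtain C3 where C3: "C3 > 0" "\<And>m. m \<ge> 1 \<Longrightarrow> sqrt (real m) * sqrt q ^ m \<le> C3 * real m powr (- r)"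
    using exponential_beats_power[of "sqrt q" r] q by auto
  define C4 where "C4 = (1 + 1 / \<epsilon>) powr r"
  define C5 where "C5 = sqrt (2 ^ k) * ((b0 - a0) * (2 ^ k * (M\<omega> * (fact k * (8 / pi) ^ k * (C1 * C2 * sqrt \<epsilon> * C3)))))"
  define A where "A = sqrt (\<integral>\<xi>. 1 / (1 + \<xi>\<^sup>2) \<partial>(lborel :: real measure))"
  have A0: "A \<ge> 0" unfolding A_def by (intro real_sqrt_ge_zero Bochner_Integration.integral_nonneg) (auto intro: divide_nonneg_nonneg)
  have "1 + 1 / \<epsilon> > 0" using \<epsilon> by (simp add: add_pos_pos)
  then have C4: "C4 > 0" unfolding C4_def by simp
  have C5: "C5 \<ge> 0" unfolding C5_def using ab0 M\<omega> C1 C2 \<epsilon> C3 by (intro mult_nonneg_nonneg) auto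
  define K where "K = 2 * (C2 * C4 + C5 * A)"
  have K: "K > 0" using C2 C4 C5 A0 by (simp add: K_def add_pos_nonneg)
  have main: "\<exists>a :: nat \<Rightarrow> real. \<forall>s. 0 \<le> s \<and> s \<le> r \<longrightarrow>
     (\<exists>H \<in> sobolev_space_line s. (\<forall>t\<in>{\<alpha>..\<beta>}. H t = F t - (\<Sum>i\<le>m. a i * tanh (t - y m i))) \<and>
        sobolev_norm_line s H \<le> K * real m powr (- (r - s)) * sobolev_norm_line r F)"
    if m: "m \<ge> 1" and F: "F \<in> sobolev_space_line r" for m F
  proof -
    define g where "g = fourier_transform F"
    have FT: "is_fourier_transform F g" and intr: "integrable lborel (\<lambda>\<xi>. (1 + \<xi>\<^sup>2) powr r * (cmod (g \<xi>))\<^sup>2)"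
      using F by (auto simp: sobolev_space_line_def g_def)
    define X where "X = sobolev_norm_line r F"
    have X_eq: "X = sqrt (\<integral>\<xi>. (1 + \<xi>\<^sup>2) powr r * (cmod (g \<xi>))\<^sup>2 \<partial>lborel)" by (simp add: X_def sobolev_norm_line_def g_def)
    have X0: "0 \<le> X" unfolding X_def by (rule sobolev_norm_line_nonneg)
    define G0 where "G0 = sqrt (\<integral>\<xi>. (cmod (g \<xi>))\<^sup>2 \<partial>lborel)"
    have G0_le: "G0 \<le> X"
    proof -
      have "integrable lborel (\<lambda>\<xi>. (cmod (g \<xi>))\<^sup>2)" using FT by (simp add: is_fourier_transform_def square_integrable_def)
      moreover have "(cmod (g \<xi>))\<^sup>2 \<le> (1 + \<xi>\<^sup>2) powr r * (cmod (g \<xi>))\<^sup>2" for \<xi>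
        using mult_right_mono[OF ge_one_powr_ge_zero[of "1 + \<xi>\<^sup>2" r], of "(cmod (g \<xi>))\<^sup>2"] r by simp
      ultimately show ?thesis unfolding G0_def X_eq by (intro real_sqrt_le_mono integral_mono intr)
    qed
    have G00: "0 \<le> G0" unfolding G0_def by (intro real_sqrt_ge_zero Bochner_Integration.integral_nonneg) auto
    define N where "N = \<epsilon> * real m"
    have N: "N > 0" using \<epsilon> m by (simp add: N_def)
    obtain H \<mu> E where H: "is_fourier_transform H (\<lambda>\<xi>. \<mu> \<xi> * g \<xi>)" and \<mu>m: "\<mu> \<in> borel_measurable borel"
      and \<mu>: "\<And>\<xi>. cmod (1 - \<mu> \<xi>) \<le> C2" "\<And>\<xi>. cmod (1 - \<mu> \<xi>) \<le> C2 * (\<bar>\<xi>\<bar> / N) ^ k"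
      and E: "E holomorphic_on UNIV" "\<And>x. E (of_real x) = of_real (H x)"
        "\<And>z. cmod (E z) \<le> C2 * sqrt N * exp (R * N * \<bar>Im z\<bar>) * G0"
    proof -
      from smooth[OF N FT, folded G0_def] show ?thesis by (elim exE conjE) (rule that; blast)
    qed
    define M where "M = C2 * sqrt N * exp (R * N * (pi / 4)) * G0"
    have M0: "0 \<le> M" using C2 N G00 by (simp add: M_def)
    have EM: "\<forall>z. \<bar>Im z\<bar> < pi / 4 \<longrightarrow> cmod (E z) \<le> M"
    proof (intro allI impI)
      fix z assume "\<bar>Im z\<bar> < pi / 4"
      then have "exp (R * N * \<bar>Im z\<bar>) \<le> exp (R * N * (pi / 4))" using R N by simp
      then have "C2 * sqrt N * exp (R * N * \<bar>Im z\<bar>) * G0 \<le> M"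
        unfolding M_def using C2 N G00 by (intro mult_right_mono mult_left_mono) auto
      then show "cmod (E z) \<le> M" using E(3)[of z] by simp
    qed
    \<comment> \<open>\<open>newton_sum_in_span_tanh\<close> needs an even number of nodes; of the \<open>m + 1\<close> nodes at most one is dropped.\<close>
    define n where "n = (if even m then m else m + 1)"
    have n: "even n" "m \<le> n" "n \<le> m + 1" by (auto simp: n_def)
    have inj_n: "inj_on (y m) {..<n}" using inj[OF m] by (rule inj_on_subset) (use n in auto)
    have y_n: "\<forall>j<n. y m j \<in> {y1..y2}" using y[OF m] n by auto
    obtain c D where D: "D holomorphic_on {z. \<bar>Im z\<bar> < pi / 4}"
      "\<And>x. Re (D (of_real x)) = Re (E (of_real x)) - (\<Sum>j<n. c j * tanh (x - y m j))"
      "\<And>z. Re z \<in> {a0 - 1..b0 + 1} \<Longrightarrow> \<bar>Im z\<bar> \<le> pi / 8 \<Longrightarrow> cmod (D z) \<le> C1 * q ^ n * M"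
    proof -
      from approx[OF n(1) inj_n y_n E(1) EM] show ?thesis by (elim exE conjE) (rule that, assumption, erule spec, blast)
    qed
    define \<tau> where "\<tau> = C1 * C2 * sqrt \<epsilon> * C3 * real m powr (- r) * G0"
    have \<tau>0: "0 \<le> \<tau>" unfolding \<tau>_def using C1 C2 \<epsilon> C3 G00 by simp
    have err: "C1 * q ^ n * M \<le> \<tau>"
    proof -
      have "q ^ n \<le> q ^ m" using q n by (intro power_decreasing) auto
      then have "C1 * q ^ n * M \<le> C1 * q ^ m * M" using C1 M0 by (intro mult_right_mono mult_left_mono) auto
      also have "exp (R * N * (pi / 4)) = exp (R * \<epsilon> * (pi / 4)) ^ m"
        by (simp add: N_def exp_of_nat_mult[symmetric] mult_ac)
      then have "C1 * q ^ m * M = C1 * C2 * sqrt \<epsilon> * (sqrt (real m) * (exp (R * \<epsilon> * (pi / 4)) * q) ^ m) * G0"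
        unfolding M_def by (simp add: N_def real_sqrt_mult power_mult_distrib mult_ac)
      also have "\<dots> \<le> C1 * C2 * sqrt \<epsilon> * (C3 * real m powr (- r)) * G0"
        unfolding sqrtq using C1 C2 \<epsilon> G00 C3(2)[OF m] by (intro mult_right_mono mult_left_mono) auto
      also have "\<dots> = \<tau>" by (simp add: \<tau>_def mult_ac)
      finally show ?thesis .
    qed
    define e where "e = (\<lambda>x. Re (D (of_real x)))"
    have "bounded_derivs k {a0..b0} (fact k * (8/pi) ^ k * \<tau>) e"
      unfolding e_def by (rule bounded_derivs_of_small_on_strip[OF D(1) \<tau>0]) (use D(3) err in fastforce)
    from bounded_derivs_mult[OF M\<omega> _ bounded_derivs_mono[OF \<omega>(1) order_refl] this] \<tau>0
    have "bounded_derivs k {a0..b0} (2 ^ k * (M\<omega> * (fact k * (8/pi) ^ k * \<tau>))) (\<lambda>x. \<omega> x * e x)" by simp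
    then have "bounded_derivs k UNIV (2 ^ k * (M\<omega> * (fact k * (8/pi) ^ k * \<tau>))) (\<lambda>x. \<omega> x * e x)"
      by (rule bounded_derivs_UNIV_of_support[rotated]) (use \<omega>(3) M\<omega> \<tau>0 in auto)
    from fourier_transform_of_smooth_compact_support[OF this _ ab0(3)] \<omega>(3)
    obtain h where h: "is_fourier_transform (\<lambda>x. \<omega> x * e x) h"
      and hb: "\<And>\<xi>. (1 + \<xi>\<^sup>2) ^ k * (cmod (h \<xi>))\<^sup>2 \<le> 2 ^ k * ((b0 - a0) * (2 ^ k * (M\<omega> * (fact k * (8/pi) ^ k * \<tau>))))\<^sup>2"
      by auto
    define B where "B = C5 * real m powr (- r) * G0"
    have B0: "0 \<le> B" unfolding B_def using C5 G00 by simp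
    have B_eq: "2 ^ k * ((b0 - a0) * (2 ^ k * (M\<omega> * (fact k * (8/pi) ^ k * \<tau>))))\<^sup>2 = B\<^sup>2"
    proof -
      have "B = sqrt (2 ^ k) * ((b0 - a0) * (2 ^ k * (M\<omega> * (fact k * (8/pi) ^ k * \<tau>))))"
        unfolding B_def C5_def \<tau>_def by (simp only: mult_ac)
      then show ?thesis by (simp add: power_mult_distrib)
    qed
    define H' where "H' = (\<lambda>x. F x - H x + \<omega> x * e x)"
    have "is_fourier_transform (\<lambda>x. (F x + (-1) * H x) + 1 * (\<omega> x * e x)) (\<lambda>\<xi>. (g \<xi> + of_real (-1) * (\<mu> \<xi> * g \<xi>)) + of_real 1 * h \<xi>)"
      by (intro is_fourier_transform_add_cmult FT H h)
    then have FT': "is_fourier_transform H' (\<lambda>\<xi>. (1 - \<mu> \<xi>) * g \<xi> + h \<xi>)"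
      unfolding H'_def by (simp add: algebra_simps)
    define a where "a = (\<lambda>i. if i < n then c i else 0)"
    have sum_a: "(\<Sum>i\<le>m. a i * tanh (t - y m i)) = (\<Sum>j<n. c j * tanh (t - y m j))" for t
      by (rule sum.mono_neutral_cong_right) (use n in \<open>auto simp: a_def\<close>)
    have eq: "H' t = F t - (\<Sum>i\<le>m. a i * tanh (t - y m i))" if "t \<in> {\<alpha>..\<beta>}" for t
      using \<omega>(2)[OF that] D(2)[of t] E(2)[of t] by (simp add: H'_def e_def sum_a)
    have "H' \<in> sobolev_space_line s \<and> sobolev_norm_line s H' \<le> K * real m powr (- (r - s)) * X" if s: "0 \<le> s" "s \<le> r" for s
    proof -
      define P where "P = C2 * N powr (- (r - s))"
      have P0: "0 \<le> P" using C2 by (simp add: P_def)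
      have Pb: "cmod (1 - \<mu> \<xi>) \<le> P * (1 + \<xi>\<^sup>2) powr ((r - s) / 2)" for \<xi>
        unfolding P_def by (rule smoothing_weight_bound[OF N C2 k(2)]) (use s k \<mu> in auto)
      have hB: "(1 + \<xi>\<^sup>2) ^ k * (cmod (h \<xi>))\<^sup>2 \<le> B\<^sup>2" for \<xi> using hb[of \<xi>] unfolding B_eq .
      note bound = sobolev_bound_of_sum[OF FT h \<mu>m FT' intr s k(1) P0 Pb B0 hB]
      have P_le: "P \<le> C2 * C4 * real m powr (- (r - s))"
      proof -
        have "\<epsilon> powr (- (r - s)) = (1 / \<epsilon>) powr (r - s)" by (simp only: powr_minus_divide powr_divide powr_one_eq_one)
        also have "\<dots> \<le> (1 + 1 / \<epsilon>) powr (r - s)" using s \<epsilon> by (intro powr_mono2) auto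
        also have "\<dots> \<le> C4" unfolding C4_def using s \<epsilon> by (intro powr_mono) auto
        finally have "\<epsilon> powr (- (r - s)) \<le> C4" .
        then have "C2 * (\<epsilon> powr (- (r - s)) * real m powr (- (r - s))) \<le> C2 * (C4 * real m powr (- (r - s)))"
          using C2 by (intro mult_left_mono mult_right_mono) auto
        then show ?thesis by (simp only: P_def N_def powr_mult mult.assoc)
      qed
      have B_le: "B \<le> C5 * real m powr (- (r - s)) * X"
        unfolding B_def using C5 G0_le G00 m s by (intro mult_mono mult_left_mono powr_mono) auto
      have "sobolev_norm_line s H' \<le> 2 * (P * X + B * A)" using bound(2) unfolding X_eq[symmetric] A_def .
      also have "\<dots> \<le> 2 * ((C2 * C4 * real m powr (- (r - s))) * X + (C5 * real m powr (- (r - s)) * X) * A)"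
        by (intro mult_left_mono add_mono mult_right_mono P_le B_le X0 A0) auto
      also have "\<dots> = K * real m powr (- (r - s)) * X" by (simp add: K_def algebra_simps)
      finally show ?thesis using bound(1) by simp
    qed
    then show ?thesis using eq unfolding X_def by blast
  qed
  then show ?thesis using K by blast
qed

text \<open>What remains is to pick an extension of \<open>f\<close> whose norm is at most twice the infimum.  If the infimum
  is 0 there may be no such extension; then the coefficients 0 work, because the norms increase with \<open>s\<close>.\<close>

theorem theorem2:
  fixes I I' :: "real set" and r :: real and x :: "nat \<Rightarrow> nat \<Rightarrow> real"
  assumes "bounded_interval I" and "bounded_interval I'" and "r \<ge> 0"
    and "quasi_Chebyshev I' x"
  shows "\<exists>K>0. \<forall>m\<ge>1. \<forall>f \<in> sobolev_space r I. \<exists>a :: nat \<Rightarrow> real. \<forall>s. 0 \<le> s \<and> s \<le> r \<longrightarrow>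
    (\<lambda>t. f t - (\<Sum>i\<le>m. a i * tanh (t - x m i))) \<in> sobolev_space s I \<and>
    sobolev_norm s I (\<lambda>t. f t - (\<Sum>i\<le>m. a i * tanh (t - x m i)))
      \<le> K * real m powr (- (r - s)) * sobolev_norm r I f"
proof -
  obtain \<alpha> \<beta> where I: "I \<subseteq> {\<alpha>..\<beta>}" "\<alpha> \<le> \<beta>"
  proof -
    have "bounded I" "\<exists>a\<in>I. True" using assms(1) unfolding bounded_interval_def by auto
    then obtain B where B: "\<And>t. t \<in> I \<Longrightarrow> \<bar>t\<bar> \<le> B" by (auto simp: bounded_iff)
    moreover from this have "0 \<le> B" using \<open>\<exists>a\<in>I. True\<close> by force
    ultimately show ?thesis by (intro that[of "-B" B]) (fastforce simp: abs_le_iff)+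
  qed
  obtain B' where B': "\<And>t. t \<in> I' \<Longrightarrow> \<bar>t\<bar> \<le> B'"
    using assms(2) unfolding bounded_interval_def by (auto simp: bounded_iff)
  have nodes: "x m j \<in> {-B'..B'}" if "1 \<le> m" "j \<le> m" for m j
    using B'[of "x m j"] assms(4) that unfolding quasi_Chebyshev_def by (auto simp: abs_le_iff)
  obtain K where K: "K > 0" and line: "\<And>m F. m \<ge> 1 \<Longrightarrow> F \<in> sobolev_space_line r \<Longrightarrow> \<exists>a :: nat \<Rightarrow> real. \<forall>s. 0 \<le> s \<and> s \<le> r \<longrightarrow>
     (\<exists>H \<in> sobolev_space_line s. (\<forall>t\<in>{\<alpha>..\<beta>}. H t = F t - (\<Sum>i\<le>m. a i * tanh (t - x m i))) \<and>
        sobolev_norm_line s H \<le> K * real m powr (- (r - s)) * sobolev_norm_line r F)"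
    using tanh_approximation_on_line[OF I(2) assms(3) nodes quasi_Chebyshev_inj[OF assms(2,4)]] by blast
  have main: "\<exists>a :: nat \<Rightarrow> real. \<forall>s. 0 \<le> s \<and> s \<le> r \<longrightarrow>
    (\<lambda>t. f t - (\<Sum>i\<le>m. a i * tanh (t - x m i))) \<in> sobolev_space s I \<and>
    sobolev_norm s I (\<lambda>t. f t - (\<Sum>i\<le>m. a i * tanh (t - x m i)))
      \<le> (2 * K) * real m powr (- (r - s)) * sobolev_norm r I f"
    if m: "m \<ge> 1" and f: "f \<in> sobolev_space r I" for m f
  proof -
    define \<nu> where "\<nu> = sobolev_norm r I f"
    have ne: "sobolev_extensions r I f \<noteq> {}" using f by (simp add: sobolev_space_def)
    have bdd: "bdd_below (sobolev_norm_line r ` sobolev_extensions r I f)" by (auto intro!: bdd_belowI2[of _ 0] sobolev_norm_line_nonneg)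
    have \<nu>0: "0 \<le> \<nu>" unfolding \<nu>_def sobolev_norm_def by (rule cINF_greatest[OF ne]) (rule sobolev_norm_line_nonneg)
    show ?thesis
    proof (cases "\<nu> = 0")
      case True
      have "f \<in> sobolev_space s I \<and> sobolev_norm s I f \<le> 0" if s: "0 \<le> s" "s \<le> r" for s
      proof
        have sub: "F \<in> sobolev_extensions s I f" if "F \<in> sobolev_extensions r I f" for F
          using that sobolev_line_mono(1)[OF _ s(2)] by (auto simp: sobolev_extensions_def)
        then show "f \<in> sobolev_space s I" using ne by (auto simp: sobolev_space_def)
        have "sobolev_norm s I f \<le> sobolev_norm r I f"
          unfolding sobolev_norm_def[of r]
        proof (rule cINF_greatest[OF ne])
          fix F assume F: "F \<in> sobolev_extensions r I f"
          have "sobolev_norm s I f \<le> sobolev_norm_line s F" by (rule sobolev_norm_le_extension[OF sub[OF F]])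
          also have "\<dots> \<le> sobolev_norm_line r F" using F s by (intro sobolev_line_mono(2)) (auto simp: sobolev_extensions_def)
          finally show "sobolev_norm s I f \<le> sobolev_norm_line r F" .
        qed
        then show "sobolev_norm s I f \<le> 0" using True by (simp add: \<nu>_def)
      qed
      then show ?thesis using True by (intro exI[of _ "\<lambda>_. 0"]) (simp add: \<nu>_def)
    next
      case False
      then have "\<nu> < 2 * \<nu>" using \<nu>0 by simp
      then obtain F where F: "F \<in> sobolev_extensions r I f" "sobolev_norm_line r F < 2 * \<nu>"
        unfolding \<nu>_def sobolev_norm_def using cINF_less_iff[OF ne bdd] by blast
      have FI: "F \<in> sobolev_space_line r" "AE t in lborel. t \<in> I \<longrightarrow> F t = f t" using F(1) by (auto simp: sobolev_extensions_def)
      obtain a :: "nat \<Rightarrow> real" where a: "\<And>s. 0 \<le> s \<Longrightarrow> s \<le> r \<Longrightarrow>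
        \<exists>H \<in> sobolev_space_line s. (\<forall>t\<in>{\<alpha>..\<beta>}. H t = F t - (\<Sum>i\<le>m. a i * tanh (t - x m i))) \<and>
        sobolev_norm_line s H \<le> K * real m powr (- (r - s)) * sobolev_norm_line r F"
        using line[OF m FI(1)] by blast
      define d where "d = (\<lambda>t. f t - (\<Sum>i\<le>m. a i * tanh (t - x m i)))"
      have "d \<in> sobolev_space s I \<and> sobolev_norm s I d \<le> (2 * K) * real m powr (- (r - s)) * \<nu>" if s: "0 \<le> s" "s \<le> r" for s
      proof -
        obtain H where H: "H \<in> sobolev_space_line s" "\<And>t. t \<in> {\<alpha>..\<beta>} \<Longrightarrow> H t = F t - (\<Sum>i\<le>m. a i * tanh (t - x m i))"
          "sobolev_norm_line s H \<le> K * real m powr (- (r - s)) * sobolev_norm_line r F" using a[OF s] by blast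
        have "AE t in lborel. t \<in> I \<longrightarrow> H t = d t"
          using FI(2) by eventually_elim (use H(2) I in \<open>auto simp: d_def\<close>)
        then have ext: "H \<in> sobolev_extensions s I d" using H(1) by (simp add: sobolev_extensions_def)
        have "sobolev_norm s I d \<le> K * real m powr (- (r - s)) * sobolev_norm_line r F"
          using sobolev_norm_le_extension[OF ext] H(3) by simp
        also have "\<dots> \<le> K * real m powr (- (r - s)) * (2 * \<nu>)" using K F(2) by (intro mult_left_mono) auto
        finally show ?thesis using ext by (auto simp: sobolev_space_def mult_ac)
      qed
      then show ?thesis unfolding d_def \<nu>_def by blast
    qed
  qed
  show ?thesis
  proof (intro exI[of _ "2 * K"] conjI allI impI ballI)
    show "0 < 2 * K" using K by simp
  qed (use main in blast)
qed

end
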